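(* Let $\Sigma(x)$ be an $\boldsymbol{e}$-invariant partial type and suppose $\boldsymbol{e}\in\operatorname{dcl}(\Sigma)$, i.e. there is a small tuple $c_0$ of realizations of $\Sigma$ with $\boldsymbol{e}\in\operatorname{dcl}(c_0)$. Let $c$ and $d$ be tuples of realizations of $\Sigma$ (indexed by the same set). (1) The following are equivalent: (a) $c\equiv^{\mathrm{KP}}_{\boldsymbol{e}} d$; (b) $c\equiv_{\operatorname{bdd}(\boldsymbol{e})\cap\Sigma} d$; (c) there is $\sigma\in\pi_b^{-1}[\operatorname{Gal}^c_{\mathrm L}(\Sigma,\boldsymbol{e})]$ such that $\sigma(c)=d$. (2) The following are equivalent: (a) $c\equiv^{\mathrm{S}}_{\boldsymbol{e}} d$; (b) $c\equiv_{\operatorname{acl}(\boldsymbol{e})\cap\Sigma} d$; (c) there is $\sigma\in\pi_b^{-1}[\operatorname{Gal}^0_{\mathrm L}(\Sigma,\boldsymbol{e})]$ such that $\sigma(c)=d$.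
   Context: Setup. $T$ is a complete first-order theory with monster model $\mathfrak{C}$; "small" means of size less than the degree of saturation and strong homogeneity of $\mathfrak{C}$. All sets, tuples, ordinals, cardinals and (elementary sub)models considered are small. A hyperimaginary is an equivalence class $a_E$ of an $\emptyset$-type-definable equivalence relation $E$ on $\mathfrak{C}^\alpha$ ($\alpha$ a small ordinal), with representative $a$; it is countable if $a$ is a countable tuple. Automorphisms act on hyperimaginaries. $\boldsymbol{e}=a_E$ is a fixed arbitrary hyperimaginary and $\operatorname{Aut}_{\boldsymbol{e}}(\mathfrak{C})=\{f\in\operatorname{Aut}(\mathfrak{C}): f(\boldsymbol{e})=\boldsymbol{e}\text{ setwise}\}$. For a tuple or set $c$, $\boldsymbol{e}\in\operatorname{dcl}(c)$ means every automorphism fixing $c$ pointwise fixes $\boldsymbol{e}$. Lascar, KP and Shelah strong types. $\operatorname{Autf}_{\mathrm L}(\mathfrak{C},\boldsymbol{e})$ is the (normal) subgroup of $\operatorname{Aut}_{\boldsymbol{e}}(\mathfrak{C})$ generated by those $f\in\operatorname{Aut}_{\boldsymbol{e}}(\mathfrak{C})$ that fix pointwise some model $M\models T$ with $\boldsymbol{e}\in\operatorname{dcl}(M)$. Put $\operatorname{Gal}_{\mathrm L}(T,\boldsymbol{e})=\operatorname{Aut}_{\boldsymbol{e}}(\mathfrak{C})/\operatorname{Autf}_{\mathrm L}(\mathfrak{C},\boldsymbol{e})$ with quotient map $\pi$. Its topology is the quotient topology under the well-defined map $\{\operatorname{tp}(f(M)/M): f\in\operatorname{Aut}_{\boldsymbol{e}}(\mathfrak{C})\}\to\operatorname{Gal}_{\mathrm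 L}(T,\boldsymbol{e})$, $\operatorname{tp}(f(M)/M)\mapsto [f]$, for a small model $M$ with $\boldsymbol{e}\in\operatorname{dcl}(M)$ (the domain has the logic topology; the result is independent of $M$ and is a quasi-compact topological group). $\operatorname{Autf}_{\mathrm{KP}}(\mathfrak{C},\boldsymbol{e})$ is the $\pi$-preimage of the closure of the trivial subgroup, and $\operatorname{Autf}_{\mathrm{S}}(\mathfrak{C},\boldsymbol{e})$ is the $\pi$-preimage of the connected component of the identity. For $X\in\{\mathrm L,\mathrm{KP},\mathrm S\}$, $c\equiv^X_{\boldsymbol{e}} d$ means there is $f\in\operatorname{Autf}_X(\mathfrak{C},\boldsymbol{e})$ with $f(c)=d$. Relativization. $\Sigma(x)$ is a partial type, $x$ a possibly infinite tuple of variables; $\boldsymbol{e}$-invariant means that for $f\in\operatorname{Aut}_{\boldsymbol{e}}(\mathfrak{C})$, $b\models\Sigma$ iff $f(b)\models\Sigma$. $\Sigma(\mathfrak{C})$ is its solution set. A tuple of realizations of $\Sigma$ is a tuple $(b_i)_{i<\lambda}$ with each $b_i\models\Sigma$. $\operatorname{Aut}_{\boldsymbol{e}}(\Sigma)=\{f\upharpoonright\Sigma(\mathfrak{C}): f\in\operatorname{Aut}_{\boldsymbol{e}}(\mathfrak{C})\}$; $\operatorname{Autf}_{\mathrm L}(\Sigma,\boldsymbol{e})$ is the normal subgroup of all $\sigma\in\operatorname{Aut}_{\boldsymbol{e}}(\Sigma)$ with $b\equiv^{\mathrm L}_{\boldsymbol{e}}\sigma(b)$ for every tuple $b$ (of any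 length) of realizations of $\Sigma$; $\operatorname{Gal}_{\mathrm L}(\Sigma,\boldsymbol{e})=\operatorname{Aut}_{\boldsymbol{e}}(\Sigma)/\operatorname{Autf}_{\mathrm L}(\Sigma,\boldsymbol{e})$, with quotient map $\pi_b:\operatorname{Aut}_{\boldsymbol{e}}(\Sigma)\to\operatorname{Gal}_{\mathrm L}(\Sigma,\boldsymbol{e})$, $\sigma\mapsto[\sigma]$. A Lascar tuple is a small tuple $b$ of realizations of $\Sigma$ with $\operatorname{Autf}_{\mathrm L}(\Sigma,\boldsymbol{e})=\{\sigma\in\operatorname{Aut}_{\boldsymbol{e}}(\Sigma): b\equiv^{\mathrm L}_{\boldsymbol{e}}\sigma(b)\}$. Fix a Lascar tuple $b$ with $\boldsymbol{e}\in\operatorname{dcl}(b)$ (it exists when $\boldsymbol{e}\in\operatorname{dcl}(\Sigma)$). $\operatorname{Gal}_{\mathrm L}(\Sigma,\boldsymbol{e})$ carries the quotient topology under the well-defined surjection $\nu_b: S_b(b)=\{\operatorname{tp}(\sigma(b)/b):\sigma\in\operatorname{Aut}_{\boldsymbol{e}}(\Sigma)\}\to\operatorname{Gal}_{\mathrm L}(\Sigma,\boldsymbol{e})$, $\operatorname{tp}(\sigma(b)/b)\mapsto[\sigma]$, where $S_b(b)$ has the logic topology (independent of $b$; a topological group). $\operatorname{Gal}^c_{\mathrm L}(\Sigma,\boldsymbol{e})$ is the closure of its trivial subgroup and $\operatorname{Gal}^0_{\mathrm L}(\Sigma,\boldsymbol{e})$ its connected component containing the identity. $\operatorname{bdd}(\boldsymbol{e})\cap\Sigma$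 and $\operatorname{acl}(\boldsymbol{e})\cap\Sigma$. A hyperimaginary is bounded (algebraic) over $\boldsymbol{e}$ if its $\operatorname{Aut}_{\boldsymbol{e}}(\mathfrak{C})$-orbit is small (finite). Write $\boldsymbol{c}\in\operatorname{bdd}(\boldsymbol{e})\restriction\Sigma$ (resp. $\operatorname{acl}(\boldsymbol{e})\restriction\Sigma$) if $\boldsymbol{c}$ is a hyperimaginary, not necessarily countable, bounded (resp. algebraic) over $\boldsymbol{e}$ having a representative that is a tuple of realizations of $\Sigma$. Every hyperimaginary $\boldsymbol{c}$ is interdefinable (fixed by the same automorphisms) with a small sequence $(\boldsymbol{c}_i: i<\lambda_{\boldsymbol{c}})$ of countable hyperimaginaries; fix one for each $\boldsymbol{c}$, and put $\operatorname{bdd}(\boldsymbol{e})\cap\Sigma=\bigcup_{\boldsymbol{c}\in\operatorname{bdd}(\boldsymbol{e})\restriction\Sigma}\{\boldsymbol{c}_i:i<\lambda_{\boldsymbol{c}}\}$ and $\operatorname{acl}(\boldsymbol{e})\cap\Sigma=\bigcup_{\boldsymbol{c}\in\operatorname{acl}(\boldsymbol{e})\restriction\Sigma}\{\boldsymbol{c}_i:i<\lambda_{\boldsymbol{c}}\}$. For a set $D$ of hyperimaginaries, $c\equiv_D d$ means some automorphism of $\mathfrak{C}$ fixing every element of $D$ maps $c$ to $d$. *)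

theory Defs
  imports "HOL-Algebra.Generated_Groups" "HOL-Analysis.Abstract_Topology_2"
begin

unbundle cardinal_syntax

section \<open>First-order logic\<close>

datatype ('f, 'v) tm = Var 'v | Fn 'f "('f, 'v) tm list"

datatype ('f, 'r, 'v) fm =
    Bot
  | Eq "('f, 'v) tm" "('f, 'v) tm"
  | Rel 'r "('f, 'v) tm list"
  | Imp "('f, 'r, 'v) fm" "('f, 'r, 'v) fm"
  | All 'v "('f, 'r, 'v) fm"

primrec tvars :: "('f, 'v) tm \<Rightarrow> 'v set" where
  "tvars (Var v) = {v}"
| "tvars (Fn f ts) = \<Union> (set (map tvars ts))"

primrec fv :: "('f, 'r, 'v) fm \<Rightarrow> 'v set" where
  "fv Bot = {}"
| "fv (Eq t u) = tvars t \<union> tvars u"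
| "fv (Rel r ts) = \<Union> (tvars ` set ts)"
| "fv (Imp \<phi> \<psi>) = fv \<phi> \<union> fv \<psi>"
| "fv (All v \<phi>) = fv \<phi> - {v}"

text \<open>
  The symbols of a language are the elements of the domains of the two arity maps, so that a
  language need not have any function or relation symbols. The universe of a structure is the whole
  type \<^typ>\<open>'m\<close>; values of the interpretations on lists of the wrong length are irrelevant.
\<close>

record ('f, 'r) language =
  farity :: "'f \<rightharpoonup> nat"
  rarity :: "'r \<rightharpoonup> nat"

record ('f, 'r, 'm) struct = "('f, 'r) language" +
  fint :: "'f \<Rightarrow> 'm list \<Rightarrow> 'm"
  rint :: "'r \<Rightarrow> 'm list \<Rightarrow> bool"

primrec wf_tm :: "('f, 'r, 'z) language_scheme \<Rightarrow> ('f, 'v) tm \<Rightarrow> bool" where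
  "wf_tm L (Var v) \<longleftrightarrow> True"
| "wf_tm L (Fn f ts) \<longleftrightarrow> farity L f = Some (length ts) \<and> list_all id (map (wf_tm L) ts)"

primrec wf_fm :: "('f, 'r, 'z) language_scheme \<Rightarrow> ('f, 'r, 'v) fm \<Rightarrow> bool" where
  "wf_fm L Bot \<longleftrightarrow> True"
| "wf_fm L (Eq t u) \<longleftrightarrow> wf_tm L t \<and> wf_tm L u"
| "wf_fm L (Rel r ts) \<longleftrightarrow> rarity L r = Some (length ts) \<and> (\<forall>t\<in>set ts. wf_tm L t)"
| "wf_fm L (Imp \<phi> \<psi>) \<longleftrightarrow> wf_fm L \<phi> \<and> wf_fm L \<psi>"
| "wf_fm L (All v \<phi>) \<longleftrightarrow> wf_fm L \<phi>"

primrec eval :: "('f, 'r, 'm) struct \<Rightarrow> ('v \<Rightarrow> 'm) \<Rightarrow> ('f, 'v) tm \<Rightarrow> 'm" where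
  "eval S s (Var v) = s v"
| "eval S s (Fn f ts) = fint S f (map (eval S s) ts)"

text \<open>\<open>sat S D s \<phi>\<close> is satisfaction in the substructure of \<open>S\<close> with universe \<open>D\<close>.\<close>

primrec sat :: "('f, 'r, 'm) struct \<Rightarrow> 'm set \<Rightarrow> ('v \<Rightarrow> 'm) \<Rightarrow> ('f, 'r, 'v) fm \<Rightarrow> bool" where
  "sat S D s Bot \<longleftrightarrow> False"
| "sat S D s (Eq t u) \<longleftrightarrow> eval S s t = eval S s u"
| "sat S D s (Rel r ts) \<longleftrightarrow> rint S r (map (eval S s) ts)"
| "sat S D s (Imp \<phi> \<psi>) \<longleftrightarrow> (sat S D s \<phi> \<longrightarrow> sat S D s \<psi>)"
| "sat S D s (All v \<phi>) \<longleftrightarrow> (\<forall>x\<in>D. sat S D (s(v := x)) \<phi>)"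

definition sentences :: "('f, 'r, 'z) language_scheme \<Rightarrow> ('f, 'r, nat) fm set" where
  "sentences L = {\<phi>. wf_fm L \<phi> \<and> fv \<phi> = {}}"

text \<open>A theory is identified with its set of consequences.\<close>

definition complete_theory :: "('f, 'r, 'z) language_scheme \<Rightarrow> ('f, 'r, nat) fm set \<Rightarrow> bool" where
  "complete_theory L T \<longleftrightarrow> T \<subseteq> sentences L \<and> (\<forall>\<phi>\<in>sentences L. (\<phi> \<in> T) \<noteq> (Imp \<phi> Bot \<in> T))"

definition is_model :: "('f, 'r, 'm) struct \<Rightarrow> ('f, 'r, nat) fm set \<Rightarrow> bool" where
  "is_model S T \<longleftrightarrow> (\<forall>\<phi>\<in>T. \<forall>s. sat S UNIV s \<phi>)"

definition elementary_sub :: "('f, 'r, 'm) struct \<Rightarrow> 'm set \<Rightarrow> bool" where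
  "elementary_sub S M \<longleftrightarrow> M \<noteq> {} \<and>
    (\<forall>f xs. farity S f = Some (length xs) \<and> set xs \<subseteq> M \<longrightarrow> fint S f xs \<in> M) \<and>
    (\<forall>(\<phi> :: ('f, 'r, nat) fm) s. wf_fm S \<phi> \<and> range s \<subseteq> M \<longrightarrow> sat S M s \<phi> = sat S UNIV s \<phi>)"


section \<open>Tuples and types\<close>

text \<open>
  A tuple of elements of \<^typ>\<open>'x\<close> indexed by a set \<open>I\<close> is a map \<open>a :: 'i \<rightharpoonup> 'x\<close> with \<open>dom a = I\<close>;
  \<open>act f a\<close> is the tuple \<open>f(a)\<close>. A tuple \<open>b\<close> of tuples is a map \<open>'i \<rightharpoonup> ('j \<rightharpoonup> 'x)\<close>, on which
  \<open>f\<close> acts by \<open>act (act f) b\<close>, and \<open>flat b\<close> is its concatenation.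
\<close>

definition act :: "('x \<Rightarrow> 'y) \<Rightarrow> ('i \<rightharpoonup> 'x) \<Rightarrow> ('i \<rightharpoonup> 'y)" where
  "act f a = (\<lambda>i. map_option f (a i))"

definition flat :: "('i \<rightharpoonup> ('j \<rightharpoonup> 'x)) \<Rightarrow> ('i \<times> 'j \<rightharpoonup> 'x)" where
  "flat b = (\<lambda>(i, j). Option.bind (b i) (\<lambda>t. t j))"

text \<open>
  A formula whose free variables are indexed by \<^typ>\<open>'i\<close> has type \<open>('f, 'r, nat + 'i) fm\<close>: the
  variables \<open>Inr i\<close> are the possible free variables, and the \<open>Inl n\<close> guarantee an infinite
  supply of variables for quantification whatever \<^typ>\<open>'i\<close> is. A formula with parameters
  is a formula in variables \<^typ>\<open>'i + 'm\<close>, where \<open>Inr m\<close> is to be assigned the element \<open>m\<close>.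
\<close>

definition formulas :: "('f, 'r, 'z) language_scheme \<Rightarrow> 'i set \<Rightarrow> ('f, 'r, nat + 'i) fm set" where
  "formulas L I = {\<phi>. wf_fm L \<phi> \<and> fv \<phi> \<subseteq> Inr ` I}"

definition holds :: "('f, 'r, 'm) struct \<Rightarrow> ('i \<rightharpoonup> 'm) \<Rightarrow> ('f, 'r, nat + 'i) fm \<Rightarrow> bool" where
  "holds S a \<phi> \<longleftrightarrow> sat S UNIV (case_sum (\<lambda>n. undefined) (\<lambda>i. the (a i))) \<phi>"

definition tp :: "('f, 'r, 'm) struct \<Rightarrow> ('i \<rightharpoonup> 'm) \<Rightarrow> 'm set \<Rightarrow> ('f, 'r, nat + ('i + 'm)) fm set" where
  "tp S a A = {\<phi> \<in> formulas S (dom a <+> A). holds S (case_sum a Some) \<phi>}"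

definition logic_topology :: "('f, 'r, 'v) fm set set \<Rightarrow> ('f, 'r, 'v) fm set topology" where
  "logic_topology P = topology_generated_by {{p \<in> P. \<phi> \<in> p} | \<phi>. True}"

definition quotient_topology :: "'x topology \<Rightarrow> ('x \<Rightarrow> 'y) \<Rightarrow> 'y topology" where
  "quotient_topology X h =
    topology (\<lambda>U. U \<subseteq> h ` topspace X \<and> openin X {x \<in> topspace X. h x \<in> U})"

lemma openin_quotient_topology:
  "openin (quotient_topology X h) U \<longleftrightarrow>
    U \<subseteq> h ` topspace X \<and> openin X {x \<in> topspace X. h x \<in> U}"
proof -
  have "istopology (\<lambda>U. U \<subseteq> h ` topspace X \<and> openin X {x \<in> topspace X. h x \<in> U})"
    unfolding istopology_def
  proof (intro conjI allI impI)
    fix A B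
    assume "A \<subseteq> h ` topspace X \<and> openin X {x \<in> topspace X. h x \<in> A}"
      and "B \<subseteq> h ` topspace X \<and> openin X {x \<in> topspace X. h x \<in> B}"
    moreover have "{x \<in> topspace X. h x \<in> A \<inter> B} =
        {x \<in> topspace X. h x \<in> A} \<inter> {x \<in> topspace X. h x \<in> B}" by auto
    ultimately show "openin X {x \<in> topspace X. h x \<in> A \<inter> B}" by auto
  next
    fix K
    assume K: "\<forall>A\<in>K. A \<subseteq> h ` topspace X \<and> openin X {x \<in> topspace X. h x \<in> A}"
    have "{x \<in> topspace X. h x \<in> \<Union>K} = (\<Union>A\<in>K. {x \<in> topspace X. h x \<in> A})" by auto
    with K show "openin X {x \<in> topspace X. h x \<in> \<Union>K}" by auto
  qed auto
  then show ?thesis by (simp add: quotient_topology_def)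
qed

lemma quotient_map_quotient_topology: "quotient_map X (quotient_topology X h) h"
proof -
  have "topspace (quotient_topology X h) = h ` topspace X"
  proof
    have "{x \<in> topspace X. h x \<in> h ` topspace X} = topspace X" by auto
    then have "openin (quotient_topology X h) (h ` topspace X)"
      by (simp add: openin_quotient_topology)
    then show "h ` topspace X \<subseteq> topspace (quotient_topology X h)" by (rule openin_subset)
  qed (auto simp: topspace_def openin_quotient_topology)
  then show ?thesis by (auto simp: quotient_map_def openin_quotient_topology)
qed

lemma topspace_logic_topology_tp:
  assumes "P \<subseteq> {tp S a A | a. True}"
  shows "topspace (logic_topology P) = P"
proof -
  have "Imp Bot Bot \<in> p" if "p \<in> P" for p
    using that assms by (auto simp: tp_def formulas_def holds_def)
  then show ?thesis by (auto simp: logic_topology_def)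
qed


section \<open>The monster model\<close>

definition small :: "'k rel \<Rightarrow> 'x set \<Rightarrow> bool" where
  "small \<kappa> A \<longleftrightarrow> |A| <o \<kappa>"

definition saturated :: "('f, 'r, 'm) struct \<Rightarrow> 'k rel \<Rightarrow> bool" where
  "saturated S \<kappa> \<longleftrightarrow> (\<forall>A. small \<kappa> A \<longrightarrow>
    (\<forall>p \<subseteq> formulas S ((UNIV :: unit set) <+> A).
      (\<forall>q \<subseteq> p. finite q \<longrightarrow> (\<exists>x. \<forall>\<phi>\<in>q. holds S (case_sum (\<lambda>_. Some x) Some) \<phi>)) \<longrightarrow>
      (\<exists>x. \<forall>\<phi>\<in>p. holds S (case_sum (\<lambda>_. Some x) Some) \<phi>)))"

definition aut :: "('f, 'r, 'm) struct \<Rightarrow> ('m \<Rightarrow> 'm) set" where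
  "aut S = {f. bij f \<and>
    (\<forall>g xs. farity S g = Some (length xs) \<longrightarrow> f (fint S g xs) = fint S g (map f xs)) \<and>
    (\<forall>r xs. rarity S r = Some (length xs) \<longrightarrow> rint S r (map f xs) = rint S r xs)}"

definition strongly_homogeneous :: "('f, 'r, 'm) struct \<Rightarrow> 'k rel \<Rightarrow> bool" where
  "strongly_homogeneous S \<kappa> \<longleftrightarrow> (\<forall>a b :: 'k \<rightharpoonup> 'm.
    small \<kappa> (dom a) \<and> dom a = dom b \<and> tp S a {} = tp S b {} \<longrightarrow> (\<exists>f\<in>aut S. act f a = b))"

text \<open>
  The degree of saturation and strong homogeneity is a cardinal \<open>\<kappa>\<close> well-ordering the type \<^typ>\<open>'k\<close>.
  As \<^typ>\<open>'k\<close> has \<open>\<kappa>\<close> elements, its small subsets serve as index sets for tuples of all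
  small lengths.
\<close>

definition monster ::
    "('f, 'r, nat) fm set \<Rightarrow> ('f, 'r, 'm) struct \<Rightarrow> 'k rel \<Rightarrow> bool" where
  "monster T S \<kappa> \<longleftrightarrow> complete_theory S T \<and> is_model S T \<and>
    card_order \<kappa> \<and> small \<kappa> (dom (farity S) <+> dom (rarity S) <+> (UNIV :: nat set)) \<and>
    saturated S \<kappa> \<and> strongly_homogeneous S \<kappa>"

text \<open>
  \<open>\<kappa> > 2\<close> to the power \<open>|L| + \<aleph>\<^sub>0 + |I|\<close>. The customary strong limit \<open>\<kappa>\<close> satisfies this for every
  small \<open>I\<close>; requiring it only for the index set \<open>I\<close> of the hyperimaginary over which one works
  also admits successor cardinals.
\<close>

definition sufficiently_large :: "('f, 'r, 'm) struct \<Rightarrow> 'k rel \<Rightarrow> 'i set \<Rightarrow> bool" where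
  "sufficiently_large S \<kappa> I \<longleftrightarrow>
    small \<kappa> (Pow (dom (farity S) <+> dom (rarity S) <+> (UNIV :: nat set) <+> I))"

definition small_model :: "('f, 'r, 'm) struct \<Rightarrow> 'k rel \<Rightarrow> 'm set \<Rightarrow> bool" where
  "small_model S \<kappa> M \<longleftrightarrow> small \<kappa> M \<and> elementary_sub S M"


section \<open>Hyperimaginaries\<close>

definition type_definable_equiv ::
    "('f, 'r, 'm) struct \<Rightarrow> 'i set \<Rightarrow> (('i \<rightharpoonup> 'm) \<times> ('i \<rightharpoonup> 'm)) set \<Rightarrow> bool" where
  "type_definable_equiv S I E \<longleftrightarrow> equiv {a. dom a = I} E \<and>
    (\<exists>\<Phi> \<subseteq> formulas S (I <+> I).
      E = {(a, b). dom a = I \<and> dom b = I \<and> (\<forall>\<phi>\<in>\<Phi>. holds S (case_sum a b) \<phi>)})"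

text \<open>
  \<open>hyperimaginary S \<kappa> I h\<close>: \<open>h\<close> is a hyperimaginary with representatives indexed by \<open>I\<close>. It is
  the class itself, as a set of tuples, and \<open>f\<close> maps it to \<open>act f ` h\<close>.
\<close>

definition hyperimaginary ::
    "('f, 'r, 'm) struct \<Rightarrow> 'k rel \<Rightarrow> 'i set \<Rightarrow> ('i \<rightharpoonup> 'm) set \<Rightarrow> bool" where
  "hyperimaginary S \<kappa> I h \<longleftrightarrow> small \<kappa> I \<and>
    (\<exists>E a. type_definable_equiv S I E \<and> dom a = I \<and> h = E `` {a})"

definition fixes_hyp :: "('m \<Rightarrow> 'm) \<Rightarrow> ('i \<rightharpoonup> 'm) set \<Rightarrow> bool" where
  "fixes_hyp f h \<longleftrightarrow> act f ` h = h"

definition Aut_over :: "('f, 'r, 'm) struct \<Rightarrow> ('i \<rightharpoonup> 'm) set \<Rightarrow> ('m \<Rightarrow> 'm) set" where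
  "Aut_over S e = {f \<in> aut S. fixes_hyp f e}"

definition Aut_group :: "('f, 'r, 'm) struct \<Rightarrow> ('i \<rightharpoonup> 'm) set \<Rightarrow> ('m \<Rightarrow> 'm) monoid" where
  "Aut_group S e = \<lparr>carrier = Aut_over S e, mult = (\<circ>), one = id\<rparr>"

definition in_dcl :: "('f, 'r, 'm) struct \<Rightarrow> ('i \<rightharpoonup> 'm) set \<Rightarrow> 'm set \<Rightarrow> bool" where
  "in_dcl S e A \<longleftrightarrow> (\<forall>f\<in>aut S. (\<forall>x\<in>A. f x = x) \<longrightarrow> fixes_hyp f e)"

definition orbit :: "('f, 'r, 'm) struct \<Rightarrow> ('i \<rightharpoonup> 'm) set \<Rightarrow> ('j \<rightharpoonup> 'm) set \<Rightarrow> ('j \<rightharpoonup> 'm) set set" where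
  "orbit S e h = {act f ` h | f. f \<in> Aut_over S e}"


section \<open>Lascar, KP and Shelah strong automorphisms\<close>

definition Autf_L :: "('f, 'r, 'm) struct \<Rightarrow> 'k rel \<Rightarrow> ('i \<rightharpoonup> 'm) set \<Rightarrow> ('m \<Rightarrow> 'm) set" where
  "Autf_L S \<kappa> e = generate (Aut_group S e)
    {f \<in> Aut_over S e. \<exists>M. small_model S \<kappa> M \<and> in_dcl S e M \<and> (\<forall>x\<in>M. f x = x)}"

definition Gal_L :: "('f, 'r, 'm) struct \<Rightarrow> 'k rel \<Rightarrow> ('i \<rightharpoonup> 'm) set \<Rightarrow> ('m \<Rightarrow> 'm) set monoid" where
  "Gal_L S \<kappa> e = Aut_group S e Mod Autf_L S \<kappa> e"

definition proj_L ::
    "('f, 'r, 'm) struct \<Rightarrow> 'k rel \<Rightarrow> ('i \<rightharpoonup> 'm) set \<Rightarrow> ('m \<Rightarrow> 'm) \<Rightarrow> ('m \<Rightarrow> 'm) set" where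
  "proj_L S \<kappa> e f = Autf_L S \<kappa> e #>\<^bsub>Aut_group S e\<^esub> f"

text \<open>The model \<open>M\<close>, as a tuple, is \<open>Some |` M\<close>, indexed by its own elements.\<close>

definition Gal_L_top ::
    "('f, 'r, 'm) struct \<Rightarrow> 'k rel \<Rightarrow> ('i \<rightharpoonup> 'm) set \<Rightarrow> 'm set \<Rightarrow> ('m \<Rightarrow> 'm) set topology" where
  "Gal_L_top S \<kappa> e M = quotient_topology
    (logic_topology {tp S (act f (Some |` M)) M | f. f \<in> Aut_over S e})
    (\<lambda>p. THE C. \<exists>f\<in>Aut_over S e. p = tp S (act f (Some |` M)) M \<and> C = proj_L S \<kappa> e f)"

definition Autf_KP ::
    "('f, 'r, 'm) struct \<Rightarrow> 'k rel \<Rightarrow> ('i \<rightharpoonup> 'm) set \<Rightarrow> 'm set \<Rightarrow> ('m \<Rightarrow> 'm) set" where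
  "Autf_KP S \<kappa> e M = {f \<in> Aut_over S e.
    proj_L S \<kappa> e f \<in> Gal_L_top S \<kappa> e M closure_of {\<one>\<^bsub>Gal_L S \<kappa> e\<^esub>}}"

definition Autf_S ::
    "('f, 'r, 'm) struct \<Rightarrow> 'k rel \<Rightarrow> ('i \<rightharpoonup> 'm) set \<Rightarrow> 'm set \<Rightarrow> ('m \<Rightarrow> 'm) set" where
  "Autf_S S \<kappa> e M = {f \<in> Aut_over S e.
    proj_L S \<kappa> e f \<in> connected_component_of_set (Gal_L_top S \<kappa> e M) \<one>\<^bsub>Gal_L S \<kappa> e\<^esub>}"

text \<open>Conjugacy of tuples of tuples under a set of automorphisms.\<close>

definition conj_by :: "('m \<Rightarrow> 'm) set \<Rightarrow> ('i \<rightharpoonup> ('j \<rightharpoonup> 'm)) \<Rightarrow> ('i \<rightharpoonup> ('j \<rightharpoonup> 'm)) \<Rightarrow> bool" where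
  "conj_by F c d \<longleftrightarrow> (\<exists>f\<in>F. act (act f) c = d)"

definition equiv_L ::
    "('f, 'r, 'm) struct \<Rightarrow> 'k rel \<Rightarrow> ('l \<rightharpoonup> 'm) set \<Rightarrow>
      ('i \<rightharpoonup> ('j \<rightharpoonup> 'm)) \<Rightarrow> ('i \<rightharpoonup> ('j \<rightharpoonup> 'm)) \<Rightarrow> bool" where
  "equiv_L S \<kappa> e c d \<longleftrightarrow> conj_by (Autf_L S \<kappa> e) c d"

definition equiv_KP ::
    "('f, 'r, 'm) struct \<Rightarrow> 'k rel \<Rightarrow> ('l \<rightharpoonup> 'm) set \<Rightarrow> 'm set \<Rightarrow>
      ('i \<rightharpoonup> ('j \<rightharpoonup> 'm)) \<Rightarrow> ('i \<rightharpoonup> ('j \<rightharpoonup> 'm)) \<Rightarrow> bool" where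
  "equiv_KP S \<kappa> e M c d \<longleftrightarrow> conj_by (Autf_KP S \<kappa> e M) c d"

definition equiv_S ::
    "('f, 'r, 'm) struct \<Rightarrow> 'k rel \<Rightarrow> ('l \<rightharpoonup> 'm) set \<Rightarrow> 'm set \<Rightarrow>
      ('i \<rightharpoonup> ('j \<rightharpoonup> 'm)) \<Rightarrow> ('i \<rightharpoonup> ('j \<rightharpoonup> 'm)) \<Rightarrow> bool" where
  "equiv_S S \<kappa> e M c d \<longleftrightarrow> conj_by (Autf_S S \<kappa> e M) c d"

definition equiv_over ::
    "('f, 'r, 'm) struct \<Rightarrow> ('l \<rightharpoonup> 'm) set set \<Rightarrow>
      ('i \<rightharpoonup> ('j \<rightharpoonup> 'm)) \<Rightarrow> ('i \<rightharpoonup> ('j \<rightharpoonup> 'm)) \<Rightarrow> bool" where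
  "equiv_over S D c d \<longleftrightarrow> conj_by {f \<in> aut S. \<forall>h\<in>D. fixes_hyp f h} c d"


section \<open>Relativization to a partial type\<close>

definition partial_type ::
    "('f, 'r, 'm) struct \<Rightarrow> 'k rel \<Rightarrow> 'j set \<Rightarrow> ('f, 'r, nat + ('j + 'm)) fm set \<Rightarrow> bool" where
  "partial_type S \<kappa> J \<Sigma> \<longleftrightarrow> small \<kappa> J \<and> (\<exists>A. small \<kappa> A \<and> \<Sigma> \<subseteq> formulas S (J <+> A))"

definition sols ::
    "('f, 'r, 'm) struct \<Rightarrow> 'j set \<Rightarrow> ('f, 'r, nat + ('j + 'm)) fm set \<Rightarrow> ('j \<rightharpoonup> 'm) set" where
  "sols S J \<Sigma> = {b. dom b = J \<and> (\<forall>\<phi>\<in>\<Sigma>. holds S (case_sum b Some) \<phi>)}"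

text \<open>
  Below, \<open>Z\<close> stands for the solution set of \<open>\<Sigma>\<close>. A tuple of realizations of
  \<open>\<Sigma>\<close> is a map into \<open>Z\<close>, so that \<open>\<sigma>\<close> in \<open>Aut_rel S e Z\<close> acts on it by \<open>act \<sigma>\<close>.
\<close>

definition invariant_over :: "('f, 'r, 'm) struct \<Rightarrow> ('i \<rightharpoonup> 'm) set \<Rightarrow> ('j \<rightharpoonup> 'm) set \<Rightarrow> bool" where
  "invariant_over S e Z \<longleftrightarrow> (\<forall>f\<in>Aut_over S e. \<forall>b. b \<in> Z \<longleftrightarrow> act f b \<in> Z)"

definition tuple_of :: "'k rel \<Rightarrow> ('j \<rightharpoonup> 'm) set \<Rightarrow> ('k \<rightharpoonup> ('j \<rightharpoonup> 'm)) \<Rightarrow> bool" where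
  "tuple_of \<kappa> Z b \<longleftrightarrow> small \<kappa> (dom b) \<and> ran b \<subseteq> Z"

definition in_dcl_type ::
    "('f, 'r, 'm) struct \<Rightarrow> 'k rel \<Rightarrow> ('i \<rightharpoonup> 'm) set \<Rightarrow> ('j \<rightharpoonup> 'm) set \<Rightarrow> bool" where
  "in_dcl_type S \<kappa> e Z \<longleftrightarrow> (\<exists>c. tuple_of \<kappa> Z c \<and> in_dcl S e (ran (flat c)))"

definition Aut_rel ::
    "('f, 'r, 'm) struct \<Rightarrow> ('i \<rightharpoonup> 'm) set \<Rightarrow> ('j \<rightharpoonup> 'm) set \<Rightarrow> (('j \<rightharpoonup> 'm) \<Rightarrow> ('j \<rightharpoonup> 'm)) set" where
  "Aut_rel S e Z = {restrict (act f) Z | f. f \<in> Aut_over S e}"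

definition Aut_rel_group ::
    "('f, 'r, 'm) struct \<Rightarrow> ('i \<rightharpoonup> 'm) set \<Rightarrow> ('j \<rightharpoonup> 'm) set \<Rightarrow> (('j \<rightharpoonup> 'm) \<Rightarrow> ('j \<rightharpoonup> 'm)) monoid" where
  "Aut_rel_group S e Z = \<lparr>carrier = Aut_rel S e Z, mult = compose Z, one = restrict id Z\<rparr>"

definition Autf_rel ::
    "('f, 'r, 'm) struct \<Rightarrow> 'k rel \<Rightarrow> ('i \<rightharpoonup> 'm) set \<Rightarrow> ('j \<rightharpoonup> 'm) set \<Rightarrow>
      (('j \<rightharpoonup> 'm) \<Rightarrow> ('j \<rightharpoonup> 'm)) set" where
  "Autf_rel S \<kappa> e Z =
    {\<sigma> \<in> Aut_rel S e Z. \<forall>b. tuple_of \<kappa> Z b \<longrightarrow> equiv_L S \<kappa> e b (act \<sigma> b)}"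

definition Gal_rel ::
    "('f, 'r, 'm) struct \<Rightarrow> 'k rel \<Rightarrow> ('i \<rightharpoonup> 'm) set \<Rightarrow> ('j \<rightharpoonup> 'm) set \<Rightarrow>
      (('j \<rightharpoonup> 'm) \<Rightarrow> ('j \<rightharpoonup> 'm)) set monoid" where
  "Gal_rel S \<kappa> e Z = Aut_rel_group S e Z Mod Autf_rel S \<kappa> e Z"

definition proj_rel ::
    "('f, 'r, 'm) struct \<Rightarrow> 'k rel \<Rightarrow> ('i \<rightharpoonup> 'm) set \<Rightarrow> ('j \<rightharpoonup> 'm) set \<Rightarrow>
      (('j \<rightharpoonup> 'm) \<Rightarrow> ('j \<rightharpoonup> 'm)) \<Rightarrow> (('j \<rightharpoonup> 'm) \<Rightarrow> ('j \<rightharpoonup> 'm)) set" where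
  "proj_rel S \<kappa> e Z \<sigma> = Autf_rel S \<kappa> e Z #>\<^bsub>Aut_rel_group S e Z\<^esub> \<sigma>"

definition Lascar_tuple ::
    "('f, 'r, 'm) struct \<Rightarrow> 'k rel \<Rightarrow> ('i \<rightharpoonup> 'm) set \<Rightarrow> ('j \<rightharpoonup> 'm) set \<Rightarrow> ('k \<rightharpoonup> ('j \<rightharpoonup> 'm)) \<Rightarrow> bool" where
  "Lascar_tuple S \<kappa> e Z b \<longleftrightarrow> tuple_of \<kappa> Z b \<and>
    Autf_rel S \<kappa> e Z = {\<sigma> \<in> Aut_rel S e Z. equiv_L S \<kappa> e b (act \<sigma> b)}"

definition Gal_rel_top ::
    "('f, 'r, 'm) struct \<Rightarrow> 'k rel \<Rightarrow> ('i \<rightharpoonup> 'm) set \<Rightarrow> ('j \<rightharpoonup> 'm) set \<Rightarrow> ('k \<rightharpoonup> ('j \<rightharpoonup> 'm)) \<Rightarrow>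
      (('j \<rightharpoonup> 'm) \<Rightarrow> ('j \<rightharpoonup> 'm)) set topology" where
  "Gal_rel_top S \<kappa> e Z b = quotient_topology
    (logic_topology {tp S (flat (act \<sigma> b)) (ran (flat b)) | \<sigma>. \<sigma> \<in> Aut_rel S e Z})
    (\<lambda>p. THE C. \<exists>\<sigma>\<in>Aut_rel S e Z.
      p = tp S (flat (act \<sigma> b)) (ran (flat b)) \<and> C = proj_rel S \<kappa> e Z \<sigma>)"

definition Gal_c ::
    "('f, 'r, 'm) struct \<Rightarrow> 'k rel \<Rightarrow> ('i \<rightharpoonup> 'm) set \<Rightarrow> ('j \<rightharpoonup> 'm) set \<Rightarrow> ('k \<rightharpoonup> ('j \<rightharpoonup> 'm)) \<Rightarrow>
      (('j \<rightharpoonup> 'm) \<Rightarrow> ('j \<rightharpoonup> 'm)) set set" where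
  "Gal_c S \<kappa> e Z b = Gal_rel_top S \<kappa> e Z b closure_of {\<one>\<^bsub>Gal_rel S \<kappa> e Z\<^esub>}"

definition Gal_0 ::
    "('f, 'r, 'm) struct \<Rightarrow> 'k rel \<Rightarrow> ('i \<rightharpoonup> 'm) set \<Rightarrow> ('j \<rightharpoonup> 'm) set \<Rightarrow> ('k \<rightharpoonup> ('j \<rightharpoonup> 'm)) \<Rightarrow>
      (('j \<rightharpoonup> 'm) \<Rightarrow> ('j \<rightharpoonup> 'm)) set set" where
  "Gal_0 S \<kappa> e Z b =
    connected_component_of_set (Gal_rel_top S \<kappa> e Z b) \<one>\<^bsub>Gal_rel S \<kappa> e Z\<^esub>"

definition proj_preimage ::
    "('f, 'r, 'm) struct \<Rightarrow> 'k rel \<Rightarrow> ('i \<rightharpoonup> 'm) set \<Rightarrow> ('j \<rightharpoonup> 'm) set \<Rightarrow>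
      (('j \<rightharpoonup> 'm) \<Rightarrow> ('j \<rightharpoonup> 'm)) set set \<Rightarrow> (('j \<rightharpoonup> 'm) \<Rightarrow> ('j \<rightharpoonup> 'm)) set" where
  "proj_preimage S \<kappa> e Z H = {\<sigma> \<in> Aut_rel S e Z. proj_rel S \<kappa> e Z \<sigma> \<in> H}"


section \<open>Bounded and algebraic closure inside a partial type\<close>

definition bdd_restr ::
    "('f, 'r, 'm) struct \<Rightarrow> 'k rel \<Rightarrow> ('i \<rightharpoonup> 'm) set \<Rightarrow> ('j \<rightharpoonup> 'm) set \<Rightarrow> ('k \<times> 'j \<rightharpoonup> 'm) set set" where
  "bdd_restr S \<kappa> e Z = {h. (\<exists>I. hyperimaginary S \<kappa> I h) \<and> small \<kappa> (orbit S e h) \<and>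
    (\<exists>b. tuple_of \<kappa> Z b \<and> flat b \<in> h)}"

definition acl_restr ::
    "('f, 'r, 'm) struct \<Rightarrow> 'k rel \<Rightarrow> ('i \<rightharpoonup> 'm) set \<Rightarrow> ('j \<rightharpoonup> 'm) set \<Rightarrow> ('k \<times> 'j \<rightharpoonup> 'm) set set" where
  "acl_restr S \<kappa> e Z = {h. (\<exists>I. hyperimaginary S \<kappa> I h) \<and> finite (orbit S e h) \<and>
    (\<exists>b. tuple_of \<kappa> Z b \<and> flat b \<in> h)}"

text \<open>
  A choice, for every hyperimaginary, of an interdefinable small sequence of countable
  hyperimaginaries.
\<close>

definition countable_decomposition ::
    "('f, 'r, 'm) struct \<Rightarrow> 'k rel \<Rightarrow> (('i \<rightharpoonup> 'm) set \<Rightarrow> ('k \<rightharpoonup> ('k \<rightharpoonup> 'm) set)) \<Rightarrow> bool" where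
  "countable_decomposition S \<kappa> dec \<longleftrightarrow> (\<forall>h I. hyperimaginary S \<kappa> I h \<longrightarrow>
    small \<kappa> (dom (dec h)) \<and>
    (\<forall>g \<in> ran (dec h). \<exists>N. countable N \<and> hyperimaginary S \<kappa> N g) \<and>
    (\<forall>f\<in>aut S. fixes_hyp f h \<longleftrightarrow> (\<forall>g \<in> ran (dec h). fixes_hyp f g)))"

definition bdd_in ::
    "('f, 'r, 'm) struct \<Rightarrow> 'k rel \<Rightarrow> ('i \<rightharpoonup> 'm) set \<Rightarrow> ('j \<rightharpoonup> 'm) set \<Rightarrow>
      (('k \<times> 'j \<rightharpoonup> 'm) set \<Rightarrow> ('k \<rightharpoonup> ('k \<rightharpoonup> 'm) set)) \<Rightarrow> ('k \<rightharpoonup> 'm) set set" where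
  "bdd_in S \<kappa> e Z dec = (\<Union>h\<in>bdd_restr S \<kappa> e Z. ran (dec h))"

definition acl_in ::
    "('f, 'r, 'm) struct \<Rightarrow> 'k rel \<Rightarrow> ('i \<rightharpoonup> 'm) set \<Rightarrow> ('j \<rightharpoonup> 'm) set \<Rightarrow>
      (('k \<times> 'j \<rightharpoonup> 'm) set \<Rightarrow> ('k \<rightharpoonup> ('k \<rightharpoonup> 'm) set)) \<Rightarrow> ('k \<rightharpoonup> 'm) set set" where
  "acl_in S \<kappa> e Z dec = (\<Union>h\<in>acl_restr S \<kappa> e Z. ran (dec h))"

end

theory Submission
  imports Defs "HOL-Algebra.Free_Abelian_Groups"
begin

text \<open>
  Let \<open>G\<close> be the group of automorphisms fixing \<open>e\<close>. A set of automorphisms is closed on a small set \<open>B\<close> if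
  membership of \<open>g\<close> is a closed condition on the type of \<open>g(B)\<close> over \<open>B\<close> (\<open>closed_on\<close>). Saturation and strong
  homogeneity are combined in \<open>limit_extension\<close>, and yield that closed sets have the finite intersection property, that products,
  inverses and translates of closed sets are closed, and that a closed set invariant under the pointwise stabilizer of a part \<open>A\<close> of
  \<open>B\<close> is closed on \<open>A\<close> already (\<open>closed_on_support\<close>). Both groups of Lascar strong types are thus quotients of
  \<open>G\<close> in which the closed sets are the closed unions of cosets (locale \<open>galois_quotient\<close>): for the full group the subgroup is
  \<open>N = Autf\<^sub>L\<close>, for the relativized group it is the group \<open>K\<close> of all automorphisms that are Lascar strong on
  \<open>\<Sigma>\<close>. As \<open>b\<close> is a Lascar tuple, \<open>K\<close> is the product of \<open>N\<close> and the pointwise stabilizer \<open>F\<close> of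
  \<open>b\<close>. Let \<open>N\<^sup>c\<close> and \<open>N\<^sup>0\<close> be the preimages in \<open>G\<close> of the closure of the trivial subgroup of \<open>G/N\<close> and
  of the component of the identity, and define \<open>K\<^sup>c\<close> and \<open>K\<^sup>0\<close> likewise.

  A closed union of cosets of \<open>K\<close> is a closed union of cosets of \<open>N\<close>. Hence \<open>N\<^sup>c \<subseteq> K\<^sup>c\<close> and
  \<open>N\<^sup>0 \<subseteq> K\<^sup>0\<close>, which shows that (a) implies (c). Conversely \<open>N\<^sup>c F\<close> is closed and a union of cosets of
  \<open>K\<close>, so it contains \<open>K\<^sup>c\<close>. Also \<open>K\<^sup>0 \<subseteq> U F\<close> for every open subgroup \<open>U\<close> of \<open>G\<close> containing \<open>N\<close>, as
  \<open>U F\<close> is clopen; since \<open>N\<^sup>0\<close> contains the intersection of all these \<open>U\<close> (\<open>Inter_open_subgroups\<close>), compactness gives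
  \<open>K\<^sup>0 \<subseteq> N\<^sup>0 F\<close>. Elements of \<open>F\<close> act on a given tuple of realizations of \<open>\<Sigma>\<close> like elements of
  \<open>N\<close>, so (c) implies (a).

  For (b), let \<open>h\<close> be bounded over \<open>e\<close> with a representative in \<open>\<Sigma>\<close>. Its stabilizer is closed and
  contains \<open>N\<close> (\<open>Autf_fixes_bounded\<close>, an argument with types finitely satisfiable in a model), hence \<open>K\<close> and
  \<open>K\<^sup>c\<close>; if \<open>h\<close> is algebraic, the stabilizer has finite index, is open, and contains \<open>K\<^sup>0\<close>. So (c)
  implies (b). Conversely every closed subgroup containing \<open>K\<close> is the stabilizer of a hyperimaginary with representative
  \<open>b\<close> (\<open>hyperimaginary_of_closed_subgroup\<close>). For \<open>K\<^sup>c\<close> this hyperimaginary is bounded, because \<open>G/N\<close> is small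
  (\<open>Small_Gal_L\<close>), and for an open subgroup it is algebraic. An automorphism that fixes all bounded hyperimaginaries with a
  representative in \<open>\<Sigma>\<close> is therefore in \<open>K\<^sup>c\<close>, and one that fixes the algebraic ones is in all open subgroups containing
  \<open>K\<close>, thus in \<open>K\<^sup>0\<close>.
\<close>

section \<open>Definable predicates\<close>

lemma eval_cong: "(\<And>v. v \<in> tvars t \<Longrightarrow> s v = s' v) \<Longrightarrow> eval S s t = eval S s' t"
proof (induction t)
  case (Fn f ts)
  then have "map (eval S s) ts = map (eval S s') ts" by (simp, blast)
  then show ?case by (simp only: eval.simps)
qed simp

lemma sat_cong: "(\<And>v. v \<in> fv \<phi> \<Longrightarrow> s v = s' v) \<Longrightarrow> sat S D s \<phi> = sat S D s' \<phi>"
proof (induction \<phi> arbitrary: s s')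
  case (Eq t u)
  then show ?case using eval_cong[of t s s' S] eval_cong[of u s s' S] by auto
next
  case (Rel r ts)
  then have "map (eval S s) ts = map (eval S s') ts" by (auto intro!: eval_cong)
  then show ?case by (simp only: sat.simps)
next
  case (Imp \<phi>1 \<phi>2)
  have "sat S D s \<phi>1 = sat S D s' \<phi>1" by (rule Imp.IH(1), rule Imp.prems, simp)
  moreover have "sat S D s \<phi>2 = sat S D s' \<phi>2" by (rule Imp.IH(2), rule Imp.prems, simp)
  ultimately show ?case by simp
next
  case (All v \<phi>)
  have "sat S D (s(v := x)) \<phi> = sat S D (s'(v := x)) \<phi>" for x
    by (rule All.IH) (use All.prems in auto)
  then show ?case by simp
qed simp

lemma finite_tvars: "finite (tvars t)"
  by (induction t) auto

lemma finite_fv: "finite (fv \<phi>)"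
  by (induction \<phi>) (auto simp: finite_tvars)

lemma eval_map_tm: "eval S s (map_tm id \<rho> t) = eval S (\<lambda>w. s (\<rho> w)) t"
  by (induction t) (auto simp: comp_def intro!: arg_cong[where f = "fint S _"])

lemma tvars_map_tm: "tvars (map_tm id \<rho> t) = \<rho> ` tvars t"
  by (induction t) auto

lemma set2_tm_eq_tvars: "set2_tm t = tvars t"
  by (induction t) auto

lemma wf_map_tm: "wf_tm L (map_tm id \<rho> t) = wf_tm L t"
  by (induction t) (auto simp: list_all_iff)

text \<open>
  Bound variables are renamed to members of an infinite set \<open>U\<close> on the way, which makes room for
  a map \<open>\<rho>\<close> that is not injective.
\<close>

lemma sat_rename:
  fixes \<phi> :: "('f, 'r, 'v) fm" and \<rho> :: "'v \<Rightarrow> 'w" and S :: "('f, 'r, 'm) struct"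
  assumes "infinite U"
  shows "\<exists>\<phi>'. wf_fm S \<phi>' = wf_fm S \<phi> \<and> fv \<phi>' \<subseteq> \<rho> ` fv \<phi> \<and> set3_fm \<phi>' \<subseteq> \<rho> ` fv \<phi> \<union> U \<and>
    (\<forall>D (s :: 'w \<Rightarrow> 'm). sat S D s \<phi>' = sat S D (\<lambda>w. s (\<rho> w)) \<phi>)"
proof (induction \<phi> arbitrary: \<rho>)
  case Bot
  show ?case by (rule exI[of _ Bot]) auto
next
  case (Eq t u)
  show ?case
    by (rule exI[of _ "Eq (map_tm id \<rho> t) (map_tm id \<rho> u)"])
      (simp add: wf_map_tm eval_map_tm tvars_map_tm set2_tm_eq_tvars image_Un comp_def)
next
  case (Rel r ts)
  have "map (eval S s) (map (map_tm id \<rho>) ts) = map (eval S (\<lambda>w. s (\<rho> w))) ts" for s :: "'w \<Rightarrow> 'm"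
    by (simp add: eval_map_tm)
  then have "sat S D s (Rel r (map (map_tm id \<rho>) ts)) = sat S D (\<lambda>w. s (\<rho> w)) (Rel r ts)"
    for s :: "'w \<Rightarrow> 'm" and D by (simp only: sat.simps)
  moreover have "fv (Rel r (map (map_tm id \<rho>) ts)) = \<rho> ` fv (Rel r ts)"
    "set3_fm (Rel r (map (map_tm id \<rho>) ts)) = \<rho> ` fv (Rel r ts)"
    by (auto simp: tvars_map_tm set2_tm_eq_tvars)
  moreover have "wf_fm S (Rel r (map (map_tm id \<rho>) ts)) = wf_fm S (Rel r ts)"
    by (simp add: wf_map_tm)
  ultimately show ?case
    by (intro exI[of _ "Rel r (map (map_tm id \<rho>) ts)"]) blast
next
  case (Imp \<phi>1 \<phi>2)
  obtain \<psi>1 \<psi>2 where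
    "wf_fm S \<psi>1 = wf_fm S \<phi>1" "fv \<psi>1 \<subseteq> \<rho> ` fv \<phi>1" "set3_fm \<psi>1 \<subseteq> \<rho> ` fv \<phi>1 \<union> U"
    "\<forall>D (s :: 'w \<Rightarrow> 'm). sat S D s \<psi>1 = sat S D (\<lambda>w. s (\<rho> w)) \<phi>1"
    "wf_fm S \<psi>2 = wf_fm S \<phi>2" "fv \<psi>2 \<subseteq> \<rho> ` fv \<phi>2" "set3_fm \<psi>2 \<subseteq> \<rho> ` fv \<phi>2 \<union> U"
    "\<forall>D (s :: 'w \<Rightarrow> 'm). sat S D s \<psi>2 = sat S D (\<lambda>w. s (\<rho> w)) \<phi>2"
    using Imp.IH by metis
  then show ?case by (intro exI[of _ "Imp \<psi>1 \<psi>2"]) auto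
next
  case (All v \<phi>)
  have "finite (\<rho> ` fv \<phi>)" by (simp add: finite_fv)
  then obtain n where n: "n \<in> U" "n \<notin> \<rho> ` fv \<phi>"
    using assms by (meson finite_subset subsetI)
  obtain \<psi> where \<psi>: "wf_fm S \<psi> = wf_fm S \<phi>" "fv \<psi> \<subseteq> \<rho>(v := n) ` fv \<phi>"
    "set3_fm \<psi> \<subseteq> \<rho>(v := n) ` fv \<phi> \<union> U"
    "\<forall>D (s :: 'w \<Rightarrow> 'm). sat S D s \<psi> = sat S D (\<lambda>w. s ((\<rho>(v := n)) w)) \<phi>"
    using All.IH by metis
  have "sat S D (\<lambda>w. (s(n := x)) ((\<rho>(v := n)) w)) \<phi> = sat S D ((\<lambda>w. s (\<rho> w))(v := x)) \<phi>" for D s x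
    by (rule sat_cong) (use n in auto)
  moreover have "\<rho>(v := n) ` fv \<phi> \<subseteq> insert n (\<rho> ` (fv \<phi> - {v}))" by auto
  ultimately show ?case
    using \<psi> n(1) by (intro exI[of _ "All n \<psi>"]) auto
qed

text \<open>
  Variables may be taken from any type, so that a tuple, a tuple together with its parameters and a finite sequence of
  automorphisms are all assignments.
\<close>

definition definable :: "('f, 'r, 'm) struct \<Rightarrow> 'v set \<Rightarrow> (('v \<Rightarrow> 'm) \<Rightarrow> bool) \<Rightarrow> bool" where
  "definable S V P \<longleftrightarrow>
    (\<exists>\<phi> :: ('f, 'r, 'v) fm. wf_fm S \<phi> \<and> fv \<phi> \<subseteq> V \<and> P = (\<lambda>s. sat S UNIV s \<phi>))"

lemma definableI:
  fixes \<phi> :: "('f, 'r, 'v) fm" and S :: "('f, 'r, 'm) struct"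
  assumes "wf_fm S \<phi>" "fv \<phi> \<subseteq> V" "\<And>s. P s = sat S UNIV s \<phi>"
  shows "definable S V P"
  unfolding definable_def using assms by (intro exI[of _ \<phi>]) auto

lemma definableE:
  fixes S :: "('f, 'r, 'm) struct"
  assumes "definable S V P"
  obtains \<phi> :: "('f, 'r, 'v) fm" where "wf_fm S \<phi>" "fv \<phi> \<subseteq> V" "\<And>s. P s = sat S UNIV s \<phi>"
  using assms unfolding definable_def by auto

lemma definable_cong: "definable S V P \<Longrightarrow> (\<And>v. v \<in> V \<Longrightarrow> s v = s' v) \<Longrightarrow> P s = P s'"
  by (elim definableE) (metis sat_cong subsetD)

lemma definable_mono: "definable S V P \<Longrightarrow> V \<subseteq> W \<Longrightarrow> definable S W P"
  unfolding definable_def by blast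

lemma definable_iff: "definable S V P \<Longrightarrow> (\<And>s. P s \<longleftrightarrow> Q s) \<Longrightarrow> definable S V Q"
  by (subst (asm) ext[of P Q]) auto

lemma definable_True: "definable S V (\<lambda>s. True)"
  by (rule definableI[of _ "Imp Bot Bot"]) auto

lemma definable_Imp:
  assumes "definable S V P" "definable S V Q"
  shows "definable S V (\<lambda>s. P s \<longrightarrow> Q s)"
proof -
  obtain \<phi> \<psi> where "wf_fm S \<phi>" "fv \<phi> \<subseteq> V" "\<And>s. P s = sat S UNIV s \<phi>"
    "wf_fm S \<psi>" "fv \<psi> \<subseteq> V" "\<And>s. Q s = sat S UNIV s \<psi>"
    using assms by (elim definableE) blast
  then show ?thesis by (intro definableI[of _ "Imp \<phi> \<psi>"]) auto
qed

lemma definable_not: "definable S V P \<Longrightarrow> definable S V (\<lambda>s. \<not> P s)"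
proof -
  have "definable S V (\<lambda>s. False)" by (rule definableI[of _ Bot]) auto
  then show "definable S V P \<Longrightarrow> definable S V (\<lambda>s. \<not> P s)"
    using definable_Imp[of S V P "\<lambda>s. False"] by simp
qed

lemma definable_conj:
  "definable S V P \<Longrightarrow> definable S V Q \<Longrightarrow> definable S V (\<lambda>s. P s \<and> Q s)"
  using definable_not[OF definable_Imp[OF _ definable_not], of S V P Q] by simp

lemma definable_disj:
  "definable S V P \<Longrightarrow> definable S V Q \<Longrightarrow> definable S V (\<lambda>s. P s \<or> Q s)"
  using definable_Imp[OF definable_not, of S V P Q] by (simp add: disj_imp)

lemma definable_eq: "v \<in> V \<Longrightarrow> w \<in> V \<Longrightarrow> definable S V (\<lambda>s. s v = s w)"
  by (rule definableI[of _ "Eq (Var v) (Var w)"]) auto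

lemma definable_finite_support:
  assumes "definable S V P"
  obtains W where "finite W" "W \<subseteq> V" "definable S W P"
  using assms by (elim definableE) (metis finite_fv definableI order_refl)

lemma definable_ex:
  assumes "definable S V P"
  shows "definable S (V - {v}) (\<lambda>s. \<exists>x. P (s(v := x)))"
proof -
  obtain \<phi> where "wf_fm S \<phi>" "fv \<phi> \<subseteq> V" "\<And>s. P s = sat S UNIV s \<phi>"
    using assms by (elim definableE) blast
  then show ?thesis by (intro definableI[of _ "Imp (All v (Imp \<phi> Bot)) Bot"]) auto
qed

text \<open>
  As a formula has only finitely many free variables, any set of variables may be quantified
  out at once.
\<close>

lemma definable_proj:
  assumes "definable S V P"
  shows "definable S (V \<inter> W) (\<lambda>s. \<exists>s'. (\<forall>w\<in>W. s' w = s w) \<and> P s')"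
proof -
  obtain V0 where V0: "finite V0" "V0 \<subseteq> V" "definable S V0 P"
    using assms by (rule definable_finite_support)
  have "definable S (V0 - F) (\<lambda>s. \<exists>s'. (\<forall>w. w \<notin> F \<longrightarrow> s' w = s w) \<and> P s')"
    if "finite F" for F
    using that
  proof (induction F rule: finite_induct)
    case empty
    have "(\<lambda>s. \<exists>s'. (\<forall>w. w \<notin> {} \<longrightarrow> s' w = s w) \<and> P s') = P" by (auto simp: fun_eq_iff[symmetric])
    then show ?case using V0 by simp
  next
    case (insert v F)
    have d: "definable S (V0 - F - {v})
        (\<lambda>s. \<exists>x s'. (\<forall>w. w \<notin> F \<longrightarrow> s' w = (s(v := x)) w) \<and> P s')"
      using insert.IH by (rule definable_ex)
    have eq: "(\<exists>x s'. (\<forall>w. w \<notin> F \<longrightarrow> s' w = (s(v := x)) w) \<and> P s') \<longleftrightarrow>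
        (\<exists>s'. (\<forall>w. w \<notin> insert v F \<longrightarrow> s' w = s w) \<and> P s')" for s
    proof
      assume "\<exists>x s'. (\<forall>w. w \<notin> F \<longrightarrow> s' w = (s(v := x)) w) \<and> P s'"
      then obtain x s' where "\<forall>w. w \<notin> F \<longrightarrow> s' w = (s(v := x)) w" "P s'" by blast
      then show "\<exists>s'. (\<forall>w. w \<notin> insert v F \<longrightarrow> s' w = s w) \<and> P s'"
        by (intro exI[of _ s']) auto
    next
      assume "\<exists>s'. (\<forall>w. w \<notin> insert v F \<longrightarrow> s' w = s w) \<and> P s'"
      then obtain s' where "\<forall>w. w \<notin> insert v F \<longrightarrow> s' w = s w" "P s'" by blast
      then show "\<exists>x s'. (\<forall>w. w \<notin> F \<longrightarrow> s' w = (s(v := x)) w) \<and> P s'"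
        by (intro exI[of _ "s' v"] exI[of _ s']) auto
    qed
    show ?case by (subst Diff_insert) (rule definable_iff[OF d eq])
  qed
  from this[OF finite_Diff[OF V0(1)], of W]
  have d: "definable S (V0 - (V0 - W)) (\<lambda>s. \<exists>s'. (\<forall>w. w \<notin> V0 - W \<longrightarrow> s' w = s w) \<and> P s')" .
  have eq: "(\<exists>s'. (\<forall>w. w \<notin> V0 - W \<longrightarrow> s' w = s w) \<and> P s') \<longleftrightarrow>
      (\<exists>s'. (\<forall>w\<in>W. s' w = s w) \<and> P s')" for s
  proof
    assume "\<exists>s'. (\<forall>w\<in>W. s' w = s w) \<and> P s'"
    then obtain s' where s': "\<forall>w\<in>W. s' w = s w" "P s'" by blast
    have "P (\<lambda>w. if w \<in> V0 then s' w else s w)"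
      using s'(2) definable_cong[OF V0(3), of s' "\<lambda>w. if w \<in> V0 then s' w else s w"] by simp
    then show "\<exists>s'. (\<forall>w. w \<notin> V0 - W \<longrightarrow> s' w = s w) \<and> P s'"
      using s'(1) by (intro exI[of _ "\<lambda>w. if w \<in> V0 then s' w else s w"]) auto
  qed auto
  have "V0 - (V0 - W) \<subseteq> V \<inter> W" using V0(2) by auto
  from definable_iff[OF definable_mono[OF d this] eq] show ?thesis .
qed

lemma definable_rename:
  fixes \<rho> :: "'v \<Rightarrow> 'w" and S :: "('f, 'r, 'm) struct"
  assumes "definable S V P" "infinite (UNIV :: 'w set)"
  shows "definable S (\<rho> ` V) (\<lambda>s. P (\<lambda>w. s (\<rho> w)))"
proof -
  obtain \<phi> :: "('f, 'r, 'v) fm" where \<phi>: "wf_fm S \<phi>" "fv \<phi> \<subseteq> V" "\<And>s. P s = sat S UNIV s \<phi>"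
    using assms by (elim definableE) blast
  obtain \<phi>' :: "('f, 'r, 'w) fm" where "wf_fm S \<phi>' = wf_fm S \<phi>" "fv \<phi>' \<subseteq> \<rho> ` fv \<phi>"
    "\<And>D s. sat S D (s :: 'w \<Rightarrow> 'm) \<phi>' = sat S D (\<lambda>w. s (\<rho> w)) \<phi>"
    using sat_rename[OF assms(2), of S \<phi> \<rho>] by metis
  with \<phi> show ?thesis by (intro definableI[of _ \<phi>']) (auto, blast)
qed

lemma eval_aut:
  assumes "f \<in> aut S" "wf_tm S t"
  shows "eval S (\<lambda>w. f (s w)) t = f (eval S s t)"
  using assms(2)
proof (induction t)
  case (Fn g ts)
  have "eval S (\<lambda>w. f (s w)) t = f (eval S s t)" if "t \<in> set ts" for t
    using Fn that by (auto simp: list_all_iff)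
  then have "map (eval S (\<lambda>w. f (s w))) ts = map f (map (eval S s) ts)"
    by simp
  moreover have "fint S g (map f (map (eval S s) ts)) = f (fint S g (map (eval S s) ts))"
    using assms(1) Fn.prems unfolding aut_def by (simp del: map_map)
  ultimately show ?case by (simp only: eval.simps)
qed simp

text \<open>
  The universe is moved along, so that the lemma also carries elementary submodels to elementary submodels.
\<close>

lemma sat_aut:
  assumes "f \<in> aut S"
  shows "wf_fm S \<phi> \<Longrightarrow> sat S (f ` D) (\<lambda>w. f (s w)) \<phi> = sat S D s \<phi>"
proof (induction \<phi> arbitrary: s)
  case (Eq t u)
  have "inj f" using assms by (simp add: aut_def bij_def)
  then show ?case using Eq by (simp add: eval_aut[OF assms] inj_eq)
next
  case (Rel r ts)
  then have "map (eval S (\<lambda>w. f (s w))) ts = map f (map (eval S s) ts)"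
    by (simp add: eval_aut[OF assms])
  moreover have "rint S r (map f (map (eval S s) ts)) = rint S r (map (eval S s) ts)"
    using assms(1) Rel.prems unfolding aut_def by (simp del: map_map)
  ultimately show ?case by (simp only: sat.simps)
next
  case (All v \<phi>)
  have *: "(\<lambda>w. f (s w))(v := f x) = (\<lambda>w. f ((s(v := x)) w))" for x by auto
  have "sat S (f ` D) ((\<lambda>w. f (s w))(v := f x)) \<phi> = sat S D (s(v := x)) \<phi>" for x
    using All.prems by (subst *) (rule All.IH, simp)
  then show ?case by simp
qed auto

lemma definable_aut:
  assumes "f \<in> aut S" "definable S V P"
  shows "P (\<lambda>w. f (s w)) = P s"
proof -
  have "f ` UNIV = UNIV" using assms(1) by (simp add: aut_def bij_def)
  with sat_aut[OF assms(1), of _ UNIV s] assms(2) show ?thesis by (elim definableE) simp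
qed

abbreviation ginv :: "('x \<Rightarrow> 'x) \<Rightarrow> 'x \<Rightarrow> 'x" where
  "ginv f \<equiv> inv_into UNIV f"

lemma id_aut: "id \<in> aut S"
  by (simp add: aut_def)

lemma comp_aut: "f \<in> aut S \<Longrightarrow> g \<in> aut S \<Longrightarrow> f \<circ> g \<in> aut S"
  unfolding aut_def by (auto simp: bij_comp simp flip: map_map)

lemma
  assumes "f \<in> aut S"
  shows aut_ginv: "f (ginv f x) = x" and ginv_aut: "ginv f (f x) = x"
    and aut_comp_ginv: "f \<circ> ginv f = id" and ginv_comp_aut: "ginv f \<circ> f = id"
    and ginv_ginv: "ginv (ginv f) = f"
proof -
  have b: "bij f" using assms by (simp add: aut_def)
  then show "f (ginv f x) = x" "ginv f (f x) = x" for x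
    by (simp_all add: bij_is_surj surj_f_inv_f bij_is_inj)
  then show "f \<circ> ginv f = id" "ginv f \<circ> f = id" by (auto simp: fun_eq_iff)
  show "ginv (ginv f) = f" using b by (rule inv_inv_eq)
qed

lemma inv_aut:
  assumes f: "f \<in> aut S"
  shows "ginv f \<in> aut S"
proof -
  have b: "bij f" using f by (simp add: aut_def)
  have 1: "map f (map (ginv f) xs) = xs" for xs
    using aut_comp_ginv[OF f] by simp
  have hf: "f (fint S g ys) = fint S g (map f ys)" if "farity S g = Some (length ys)" for g ys
    using f that unfolding aut_def by blast
  have hr: "rint S r (map f ys) = rint S r ys" if "rarity S r = Some (length ys)" for r ys
    using f that unfolding aut_def by blast
  have "ginv f (fint S g xs) = fint S g (map (ginv f) xs)" if "farity S g = Some (length xs)" for g xs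
  proof -
    have "f (fint S g (map (ginv f) xs)) = fint S g (map f (map (ginv f) xs))"
      by (rule hf) (simp add: that)
    then have "f (fint S g (map (ginv f) xs)) = fint S g xs" by (simp only: 1)
    then show ?thesis using ginv_aut[OF f] by metis
  qed
  moreover have "rint S r (map (ginv f) xs) = rint S r xs" if "rarity S r = Some (length xs)" for r xs
  proof -
    have "rint S r (map f (map (ginv f) xs)) = rint S r (map (ginv f) xs)"
      by (rule hr) (simp add: that)
    then show ?thesis by (simp only: 1)
  qed
  ultimately show ?thesis using b by (simp add: aut_def bij_imp_bij_inv)
qed

lemma holds_cong:
  "\<phi> \<in> formulas S I \<Longrightarrow> (\<And>i. i \<in> I \<Longrightarrow> the (a i) = the (b i)) \<Longrightarrow> holds S a \<phi> = holds S b \<phi>"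
  unfolding holds_def formulas_def by (rule sat_cong) auto

text \<open>
  Types consist of formulas whose variables are the members of an index set. This lemma and the next one pass from
  these formulas to definable predicates and back, renaming the variables along any map \<open>\<rho>\<close>.
\<close>

lemma definable_holds:
  fixes \<rho> :: "'i \<Rightarrow> 'w" and S :: "('f, 'r, 'm) struct"
  assumes "\<phi> \<in> formulas S I" "infinite (UNIV :: 'w set)"
  shows "definable S (\<rho> ` I) (\<lambda>s. holds S (\<lambda>i. Some (s (\<rho> i))) \<phi>)"
proof -
  define \<rho>' :: "nat + 'i \<Rightarrow> 'w" where "\<rho>' = case_sum (\<lambda>n. undefined) \<rho>"
  have "definable S (Inr ` I) (\<lambda>s. sat S UNIV s \<phi>)"
    using assms(1) by (intro definableI[of _ \<phi>]) (auto simp: formulas_def)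
  from definable_rename[OF this assms(2), of \<rho>']
  have "definable S (\<rho> ` I) (\<lambda>s. sat S UNIV (\<lambda>w. s (\<rho>' w)) \<phi>)"
    by (simp add: \<rho>'_def image_image)
  then show ?thesis
  proof (rule definable_iff)
    show "sat S UNIV (\<lambda>w. s (\<rho>' w)) \<phi> \<longleftrightarrow> holds S (\<lambda>i. Some (s (\<rho> i))) \<phi>" for s
      unfolding holds_def
      by (rule sat_cong) (use assms(1) in \<open>auto simp: formulas_def \<rho>'_def\<close>)
  qed
qed

lemma definable_formula:
  fixes \<rho> :: "'v \<Rightarrow> 'i" and S :: "('f, 'r, 'm) struct"
  assumes "definable S V P"
  obtains \<phi> :: "('f, 'r, nat + 'i) fm"
  where "\<phi> \<in> formulas S (\<rho> ` V)" "\<And>a. holds S a \<phi> = P (\<lambda>v. the (a (\<rho> v)))"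
proof -
  have "definable S ((\<lambda>v. Inr (\<rho> v) :: nat + 'i) ` V) (\<lambda>s. P (\<lambda>w. s (Inr (\<rho> w))))"
    by (rule definable_rename[OF assms]) simp
  then obtain \<phi> :: "('f, 'r, nat + 'i) fm" where
    \<phi>: "wf_fm S \<phi>" "fv \<phi> \<subseteq> (\<lambda>v. Inr (\<rho> v)) ` V" "\<And>s. P (\<lambda>w. s (Inr (\<rho> w))) = sat S UNIV s \<phi>"
    by (elim definableE) blast
  show thesis
  proof (rule that)
    show "\<phi> \<in> formulas S (\<rho> ` V)" using \<phi>(1,2) by (auto simp: formulas_def)
    show "holds S a \<phi> = P (\<lambda>v. the (a (\<rho> v)))" for a
      using \<phi>(3)[of "case_sum (\<lambda>n. undefined) (\<lambda>i. the (a i))"] by (simp add: holds_def)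
  qed
qed


section \<open>Compactness in the monster model\<close>

locale monster_model =
  fixes T :: "('f, 'r, nat) fm set" and S :: "('f, 'r, 'm) struct" and \<kappa> :: "'k rel"
  assumes monster: "monster T S \<kappa>"
begin

abbreviation "Small \<equiv> small \<kappa>"

lemma Card_order_\<kappa>: "Card_order \<kappa>" and Field_\<kappa>: "Field \<kappa> = UNIV"
  using monster card_order_on_Card_order[of UNIV \<kappa>] by (simp_all add: monster_def)

lemma Small_subset: "Small A \<Longrightarrow> B \<subseteq> A \<Longrightarrow> Small B"
  unfolding small_def using card_of_mono1 ordLeq_ordLess_trans by blast

lemma Small_image: "Small A \<Longrightarrow> Small (f ` A)"
  unfolding small_def using card_of_image ordLeq_ordLess_trans by blast

lemma Small_language: "Small (dom (farity S) <+> dom (rarity S) <+> (UNIV :: nat set))"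
  using monster by (simp add: monster_def)

lemma Small_nat: "Small (UNIV :: nat set)"
proof -
  have "Small ((\<lambda>x. case x of Inr (Inr n) \<Rightarrow> n | _ \<Rightarrow> 0) `
      (dom (farity S) <+> dom (rarity S) <+> (UNIV :: nat set)))"
    using Small_language by (rule Small_image)
  then show ?thesis
    by (rule Small_subset) (auto simp: image_iff intro!: bexI[of _ "Inr (Inr _)"])
qed

lemma infinite_\<kappa>: "infinite (Field \<kappa>)"
  using Small_nat Card_order_\<kappa> unfolding small_def
  by (metis card_of_Field_ordIso card_of_ordLeq_finite infinite_UNIV_nat ordIso_symmetric ordLess_imp_ordLeq ordLess_ordIso_trans)

lemma Small_finite: "finite A \<Longrightarrow> Small A"
  unfolding small_def
  using Small_nat card_of_Well_order finite_ordLess_infinite2 infinite_UNIV_nat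
  by (metis ordLess_transitive small_def)

lemma Small_Un: "Small A \<Longrightarrow> Small B \<Longrightarrow> Small (A \<union> B)"
  unfolding small_def using Card_order_\<kappa> infinite_\<kappa> card_of_Un_ordLess_infinite_Field by blast

lemma Small_insert: "Small A \<Longrightarrow> Small (insert x A)"
  using Small_Un[of "{x}" A] by (simp add: Small_finite)

lemma Small_Times: "Small A \<Longrightarrow> Small B \<Longrightarrow> Small (A \<times> B)"
  unfolding small_def using Card_order_\<kappa> infinite_\<kappa> card_of_Times_ordLess_infinite_Field by blast

lemma Small_inj:
  assumes "Small A"
  obtains \<iota> :: "'a \<Rightarrow> 'k" where "inj_on \<iota> A"
proof -
  have "|A| \<le>o |UNIV :: 'k set|"
    using assms Card_order_\<kappa> Field_\<kappa> unfolding small_def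
    by (metis card_of_Field_ordIso ordIso_symmetric ordLess_imp_ordLeq ordLess_ordIso_trans)
  then show thesis using that by (meson card_of_ordLeq)
qed

text \<open>
  Strong homogeneity freed from the index type of \<open>\<kappa>\<close>: the variables are reindexed along an injection into it.
\<close>

lemma homogeneous:
  fixes s1 s2 :: "'v \<Rightarrow> 'm"
  assumes inf: "infinite (UNIV :: 'v set)" and V: "Small V"
    and sub: "\<And>P. definable S V P \<Longrightarrow> P s1 \<Longrightarrow> P s2"
  obtains f where "f \<in> aut S" "\<And>v. v \<in> V \<Longrightarrow> f (s1 v) = s2 v"
proof -
  obtain \<iota> :: "'v \<Rightarrow> 'k" where \<iota>: "inj_on \<iota> V" using Small_inj[OF V] .
  define \<rho> :: "'k + 'm \<Rightarrow> 'v" where "\<rho> = case_sum (inv_into V \<iota>) (\<lambda>_. undefined)"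
  define a where "a s = (\<lambda>k. if k \<in> \<iota> ` V then Some (s (inv_into V \<iota> k) :: 'm) else None)" for s
  have dom: "dom (a s) = \<iota> ` V" for s by (auto simp: a_def dom_def)
  have eqv: "P s1 = P s2" if "definable S V P" for P
    using sub[OF that] sub[OF definable_not[OF that]] by blast
  have "holds S (case_sum (a s1) Some) \<phi> = holds S (case_sum (a s2) Some) \<phi>"
    if \<phi>: "\<phi> \<in> formulas S (\<iota> ` V <+> {})" for \<phi>
  proof -
    have "definable S (\<rho> ` (\<iota> ` V <+> {})) (\<lambda>s. holds S (\<lambda>i. Some (s (\<rho> i))) \<phi>)"
      using \<phi> inf by (rule definable_holds)
    moreover have "\<rho> ` (\<iota> ` V <+> {}) \<subseteq> V" by (auto simp: \<rho>_def inv_into_into)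
    ultimately have "definable S V (\<lambda>s. holds S (\<lambda>i. Some (s (\<rho> i))) \<phi>)"
      by (rule definable_mono)
    from eqv[OF this]
    have "holds S (\<lambda>i. Some (s1 (\<rho> i))) \<phi> = holds S (\<lambda>i. Some (s2 (\<rho> i))) \<phi>" .
    moreover have "holds S (case_sum (a s) Some) \<phi> = holds S (\<lambda>i. Some (s (\<rho> i))) \<phi>" for s
      using \<phi> by (rule holds_cong) (auto simp: a_def \<rho>_def)
    ultimately show ?thesis by simp
  qed
  then have "tp S (a s1) {} = tp S (a s2) {}" by (auto simp: tp_def dom)
  moreover have "small \<kappa> (dom (a s1))" using V by (simp add: dom Small_image)
  ultimately obtain f where f: "f \<in> aut S" "act f (a s1) = a s2"
    using monster dom unfolding monster_def strongly_homogeneous_def by metis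
  have "f (s1 v) = s2 v" if "v \<in> V" for v
    using fun_cong[OF f(2), of "\<iota> v"] that \<iota> by (simp add: act_def a_def)
  with f(1) show thesis by (rule that)
qed

lemma lower_bound_finite:
  assumes "\<D> \<noteq> {}" "\<And>P Q. P \<in> \<D> \<Longrightarrow> Q \<in> \<D> \<Longrightarrow> \<exists>R\<in>\<D>. \<forall>s. R s \<longrightarrow> P s \<and> Q s"
    and "finite F" "F \<subseteq> \<D>"
  shows "\<exists>R\<in>\<D>. \<forall>P\<in>F. \<forall>s. R s \<longrightarrow> P s"
  using assms(3,4)
proof (induction F rule: finite_induct)
  case empty
  then show ?case using assms(1) by auto
next
  case (insert P F)
  then obtain R where "R \<in> \<D>" "\<forall>P\<in>F. \<forall>s. R s \<longrightarrow> P s" by auto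
  moreover obtain R' where "R' \<in> \<D>" "\<forall>s. R' s \<longrightarrow> P s \<and> R s"
    using assms(2)[of P R] insert.prems \<open>R \<in> \<D>\<close> by auto
  ultimately show ?case by (intro bexI[of _ R']) auto
qed

text \<open>
  One more variable \<open>v\<close> receives a value \<open>x\<close>. The conditions on \<open>x\<close> are obtained by quantifying out the
  variables outside \<open>D\<close>, and form a type over the values on \<open>D\<close> in one variable.
\<close>

lemma saturation_step:
  fixes D :: "'v set" and s :: "'v \<Rightarrow> 'm"
  assumes D: "Small D" "v \<notin> D" and ne: "\<D> \<noteq> {}"
    and def: "\<And>P. P \<in> \<D> \<Longrightarrow> definable S V P"
    and dir: "\<And>P Q. P \<in> \<D> \<Longrightarrow> Q \<in> \<D> \<Longrightarrow> \<exists>R\<in>\<D>. \<forall>s. R s \<longrightarrow> P s \<and> Q s"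
    and sat: "\<And>P. P \<in> \<D> \<Longrightarrow> \<exists>s'. (\<forall>w\<in>D. s' w = s w) \<and> P s'"
  shows "\<exists>x. \<forall>P\<in>\<D>. \<exists>s'. (\<forall>w\<in>insert v D. s' w = (s(v := x)) w) \<and> P s'"
proof -
  define Q where "Q P = (\<lambda>s. \<exists>s'. (\<forall>w\<in>insert v D. s' w = s w) \<and> P s')" for P :: "('v \<Rightarrow> 'm) \<Rightarrow> bool"
  define \<rho> :: "'v \<Rightarrow> unit + 'm" where "\<rho> = (\<lambda>w. if w = v then Inl () else Inr (s w))"
  define F where "F = formulas S ((UNIV :: unit set) <+> s ` D)"
  have "\<exists>\<phi>\<in>F. \<forall>x. holds S (case_sum (\<lambda>_. Some x) Some) \<phi> = Q P (s(v := x))" if "P \<in> \<D>" for P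
  proof -
    have "definable S (V \<inter> insert v D) (Q P)"
      unfolding Q_def by (rule definable_proj[OF def[OF that]])
    then have "definable S (insert v D) (Q P)" by (rule definable_mono) simp
    then obtain \<phi> where \<phi>: "\<phi> \<in> formulas S (\<rho> ` insert v D)"
      "\<And>a. holds S a \<phi> = Q P (\<lambda>w. the (a (\<rho> w)))"
      by (rule definable_formula[where \<rho> = \<rho>]) blast
    have "\<rho> ` insert v D \<subseteq> UNIV <+> s ` D" by (auto simp: \<rho>_def)
    then have "\<phi> \<in> F" using \<phi>(1) unfolding F_def formulas_def by blast
    moreover have "holds S (case_sum (\<lambda>_. Some x) Some) \<phi> = Q P (s(v := x))" for x
    proof -
      have "(\<lambda>w. the (case_sum (\<lambda>_. Some x) Some (\<rho> w))) = s(v := x)"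
        by (auto simp: \<rho>_def fun_eq_iff)
      then show ?thesis by (simp only: \<phi>(2))
    qed
    ultimately show ?thesis by blast
  qed
  then obtain \<Phi> where \<Phi>: "\<And>P. P \<in> \<D> \<Longrightarrow> \<Phi> P \<in> F"
    "\<And>P x. P \<in> \<D> \<Longrightarrow> holds S (case_sum (\<lambda>_. Some x) Some) (\<Phi> P) = Q P (s(v := x))"
    by metis
  have "\<exists>x. \<forall>\<phi>\<in>q. holds S (case_sum (\<lambda>_. Some x) Some) \<phi>" if q: "q \<subseteq> \<Phi> ` \<D>" "finite q" for q
  proof -
    obtain G where G: "G \<subseteq> \<D>" "finite G" "q = \<Phi> ` G"
      using finite_subset_image[OF q(2,1)] by auto
    obtain R where R: "R \<in> \<D>" "\<forall>P\<in>G. \<forall>s. R s \<longrightarrow> P s"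
      using lower_bound_finite[OF ne dir G(2,1)] by blast
    obtain s' where s': "\<forall>w\<in>D. s' w = s w" "R s'" using sat[OF R(1)] by blast
    have "Q P (s(v := s' v))" if "P \<in> G" for P
      unfolding Q_def using s' R(2) that by (intro exI[of _ s']) (use D(2) in auto)
    then show ?thesis using \<Phi>(2) G by blast
  qed
  moreover have "small \<kappa> (s ` D)" using D(1) by (rule Small_image)
  moreover have "\<Phi> ` \<D> \<subseteq> formulas S ((UNIV :: unit set) <+> s ` D)"
    using \<Phi>(1) by (auto simp: F_def)
  ultimately obtain x where "\<forall>\<phi>\<in>\<Phi> ` \<D>. holds S (case_sum (\<lambda>_. Some x) Some) \<phi>"
    using monster unfolding monster_def saturated_def by metis
  then have "Q P (s(v := x))" if "P \<in> \<D>" for P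
    using \<Phi>(2)[OF that] that by blast
  then show ?thesis unfolding Q_def by blast
qed

text \<open>
  Saturation for types in a small set \<open>V\<close> of variables, those in \<open>V\<^sub>0\<close> being given values. Zorn's lemma is
  applied to the partial assignments that are compatible with every formula of the type. They are closed under unions of chains
  because each formula has finitely many variables, and a maximal one is total by the previous lemma.
\<close>

lemma saturation:
  fixes V :: "'v set" and s :: "'v \<Rightarrow> 'm"
  assumes V: "Small V" "V0 \<subseteq> V" and ne: "\<D> \<noteq> {}"
    and def: "\<And>P. P \<in> \<D> \<Longrightarrow> definable S V P"
    and dir: "\<And>P Q. P \<in> \<D> \<Longrightarrow> Q \<in> \<D> \<Longrightarrow> \<exists>R\<in>\<D>. \<forall>s. R s \<longrightarrow> P s \<and> Q s"
    and sat: "\<And>P. P \<in> \<D> \<Longrightarrow> \<exists>s'. (\<forall>w\<in>V0. s' w = s w) \<and> P s'"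
  obtains s' where "\<And>w. w \<in> V0 \<Longrightarrow> s' w = s w" "\<And>P. P \<in> \<D> \<Longrightarrow> P s'"
proof -
  define good where "good \<Gamma> \<longleftrightarrow> (\<lambda>w. (w, s w)) ` V0 \<subseteq> \<Gamma> \<and> \<Gamma> \<subseteq> V \<times> UNIV \<and>
    (\<forall>P\<in>\<D>. \<exists>s'. (\<forall>w x. (w, x) \<in> \<Gamma> \<longrightarrow> s' w = x) \<and> P s')" for \<Gamma> :: "('v \<times> 'm) set"
  have goodD: "\<exists>s'. (\<forall>w x. (w, x) \<in> \<Gamma> \<longrightarrow> s' w = x) \<and> P s'" if "good \<Gamma>" "P \<in> \<D>" for \<Gamma> P
    using that by (simp add: good_def)
  have sv: "x = y" if "good \<Gamma>" "(w, x) \<in> \<Gamma>" "(w, y) \<in> \<Gamma>" for \<Gamma> w x y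
  proof -
    obtain P where "P \<in> \<D>" using ne by blast
    then obtain s' where "\<forall>w x. (w, x) \<in> \<Gamma> \<longrightarrow> s' w = x"
      using goodD[OF \<open>good \<Gamma>\<close>] by blast
    then have "s' w = x" "s' w = y" using that(2,3) by blast+
    then show ?thesis by simp
  qed
  have "\<exists>M\<in>{\<Gamma>. good \<Gamma>}. \<forall>X\<in>{\<Gamma>. good \<Gamma>}. M \<subseteq> X \<longrightarrow> X = M"
  proof (rule subset_Zorn_nonempty)
    have "good ((\<lambda>w. (w, s w)) ` V0)"
      unfolding good_def
    proof (intro conjI ballI)
      fix P assume "P \<in> \<D>"
      then obtain s' where "\<forall>w\<in>V0. s' w = s w" "P s'" using sat by blast
      then show "\<exists>s'. (\<forall>w x. (w, x) \<in> (\<lambda>w. (w, s w)) ` V0 \<longrightarrow> s' w = x) \<and> P s'"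
        by (intro exI[of _ s']) auto
    qed (use V(2) in auto)
    then show "{\<Gamma>. good \<Gamma>} \<noteq> {}" by blast
  next
    fix \<C> assume ne': "\<C> \<noteq> {}" and ch: "subset.chain {\<Gamma>. good \<Gamma>} \<C>"
    then have g: "good \<Gamma>" if "\<Gamma> \<in> \<C>" for \<Gamma> using that by (auto simp: subset.chain_def)
    have svU: "x = y" if xy: "(w, x) \<in> \<Union>\<C>" "(w, y) \<in> \<Union>\<C>" for w x y
    proof -
      have "{(w, x), (w, y)} \<subseteq> \<Union>\<C>" using xy by simp
      then obtain \<Gamma> where \<Gamma>: "\<Gamma> \<in> \<C>" "{(w, x), (w, y)} \<subseteq> \<Gamma>"
        using finite_subset_Union_chain[OF _ _ ne' ch, of "{(w, x), (w, y)}"] by blast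
      then have "(w, x) \<in> \<Gamma>" "(w, y) \<in> \<Gamma>" by simp_all
      then show ?thesis by (rule sv[OF g[OF \<Gamma>(1)]])
    qed
    have "\<exists>s'. (\<forall>w x. (w, x) \<in> \<Union>\<C> \<longrightarrow> s' w = x) \<and> P s'" if P: "P \<in> \<D>" for P
    proof -
      obtain W where W: "finite W" "W \<subseteq> V" "definable S W P"
        using definable_finite_support[OF def[OF P]] .
      have "inj_on fst (\<Union>\<C> \<inter> W \<times> UNIV)"
      proof (rule inj_onI)
        fix p q
        assume p: "p \<in> \<Union>\<C> \<inter> W \<times> UNIV" "q \<in> \<Union>\<C> \<inter> W \<times> UNIV" and eq: "fst p = fst q"
        from p have "(fst p, snd p) \<in> \<Union>\<C>" "(fst q, snd q) \<in> \<Union>\<C>" by (simp_all only: prod.collapse Int_iff)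
        then have "snd p = snd q" unfolding eq by (rule svU)
        with eq show "p = q" by (rule prod_eqI)
      qed
      moreover have "fst ` (\<Union>\<C> \<inter> W \<times> UNIV) \<subseteq> W" by auto
      ultimately have "finite (\<Union>\<C> \<inter> W \<times> UNIV)"
        using W(1) by (meson finite_imageD finite_subset)
      then obtain \<Gamma> where \<Gamma>: "\<Gamma> \<in> \<C>" "\<Union>\<C> \<inter> W \<times> UNIV \<subseteq> \<Gamma>"
        using finite_subset_Union_chain[OF _ _ ne' ch, of "\<Union>\<C> \<inter> W \<times> UNIV"] by blast
      then obtain s' where s': "\<forall>w x. (w, x) \<in> \<Gamma> \<longrightarrow> s' w = x" "P s'"
        using goodD[OF g P] by blast
      define s'' where "s'' = (\<lambda>w. if \<exists>x. (w, x) \<in> \<Union>\<C> then THE x. (w, x) \<in> \<Union>\<C> else s' w)"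
      have s'': "s'' w = x" if "(w, x) \<in> \<Union>\<C>" for w x
      proof -
        have "(THE x. (w, x) \<in> \<Union>\<C>) = x" by (rule the_equality, rule that, rule svU, assumption, rule that)
        moreover have "\<exists>x. (w, x) \<in> \<Union>\<C>" using that ..
        ultimately show ?thesis unfolding s''_def by (simp only: if_True)
      qed
      have "s'' w = s' w" if w: "w \<in> W" for w
      proof (cases "\<exists>x. (w, x) \<in> \<Union>\<C>")
        case True
        then obtain x where x: "(w, x) \<in> \<Union>\<C>" by blast
        then have "(w, x) \<in> \<Gamma>" using \<Gamma>(2) w by blast
        then have "s' w = x" using s'(1) by blast
        then show ?thesis using s''[OF x] by simp
      next
        case False
        then show ?thesis unfolding s''_def by (simp only: if_False)
      qed
      then have "P s''" using definable_cong[OF W(3), of s'' s'] s'(2) by simp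
      then show ?thesis using s'' by blast
    qed
    moreover have "(\<lambda>w. (w, s w)) ` V0 \<subseteq> \<Union>\<C>" "\<Union>\<C> \<subseteq> V \<times> UNIV"
      using g ne' unfolding good_def by blast+
    ultimately show "\<Union>\<C> \<in> {\<Gamma>. good \<Gamma>}" by (simp add: good_def)
  qed
  then obtain \<Gamma> where \<Gamma>: "good \<Gamma>" and max: "\<And>X. good X \<Longrightarrow> \<Gamma> \<subseteq> X \<Longrightarrow> X = \<Gamma>" by blast
  define D where "D = fst ` \<Gamma>"
  define t where "t w = (THE x. (w, x) \<in> \<Gamma>)" for w
  have t: "t w = x" if "(w, x) \<in> \<Gamma>" for w x
    unfolding t_def by (rule the_equality, rule that, rule sv[OF \<Gamma>], assumption, rule that)
  have DV: "D \<subseteq> V" using \<Gamma> by (auto simp: good_def D_def)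
  have tD: "(w, t w) \<in> \<Gamma>" if "w \<in> D" for w
    using that t by (auto simp: D_def)
  have ext: "\<exists>s'. (\<forall>w\<in>D. s' w = t w) \<and> P s'" if "P \<in> \<D>" for P
  proof -
    obtain s' where "\<forall>w x. (w, x) \<in> \<Gamma> \<longrightarrow> s' w = x" "P s'"
      using goodD[OF \<Gamma> \<open>P \<in> \<D>\<close>] by blast
    then show ?thesis using tD by (intro exI[of _ s']) auto
  qed
  have "D = V"
  proof (rule ccontr)
    assume "D \<noteq> V"
    then obtain v where v: "v \<in> V" "v \<notin> D" using DV by blast
    obtain x where x: "\<forall>P\<in>\<D>. \<exists>s'. (\<forall>w\<in>insert v D. s' w = (t(v := x)) w) \<and> P s'"
      using saturation_step[OF Small_subset[OF V(1) DV] v(2) ne def dir ext] by blast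
    have "good (insert (v, x) \<Gamma>)"
      unfolding good_def
    proof (intro conjI ballI)
      fix P assume "P \<in> \<D>"
      then obtain s' where s': "\<forall>w\<in>insert v D. s' w = (t(v := x)) w" "P s'" using x by blast
      have "s' w = y" if "(w, y) \<in> insert (v, x) \<Gamma>" for w y
      proof (cases "w = v")
        case True
        have "(w, y) \<notin> \<Gamma>"
        proof
          assume "(w, y) \<in> \<Gamma>"
          then have "fst (w, y) \<in> D" unfolding D_def by (rule imageI)
          then show False using True v(2) by simp
        qed
        then show ?thesis using that s'(1) True by auto
      next
        case False
        then have "(w, y) \<in> \<Gamma>" using that by auto
        moreover from this have "fst (w, y) \<in> D" unfolding D_def by (rule imageI)
        ultimately show ?thesis using t[of w y] s'(1) False by auto
      qed
      then show "\<exists>s'. (\<forall>w y. (w, y) \<in> insert (v, x) \<Gamma> \<longrightarrow> s' w = y) \<and> P s'" using s'(2) by blast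
    qed (use \<Gamma> v in \<open>auto simp: good_def\<close>)
    then have "insert (v, x) \<Gamma> = \<Gamma>" using max by blast
    then have "(v, x) \<in> \<Gamma>" by blast
    then have "fst (v, x) \<in> D" unfolding D_def by (rule imageI)
    then show False using v(2) by simp
  qed
  show thesis
  proof (rule that)
    show "t w = s w" if "w \<in> V0" for w
      using \<Gamma> that t by (auto simp: good_def)
    show "P t" if P: "P \<in> \<D>" for P
    proof -
      obtain s' where "\<forall>w\<in>D. s' w = t w" "P s'" using ext[OF P] by blast
      moreover from this have "P s' = P t"
        by (intro definable_cong[OF def[OF P]]) (simp add: \<open>D = V\<close>)
      ultimately show ?thesis by simp
    qed
  qed
qed

text \<open>
  A sequence \<open>H\<close> of maps is read as the assignment \<^term>\<open>case_prod H\<close>, in which the variable \<open>(n, x)\<close> has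
  the value \<open>H n x\<close>. The formulas in the variables \<open>V\<^sub>1\<close> that hold throughout some member of the family are consistent
  with the values of \<open>H\<close> on \<open>V\<^sub>0\<close>: otherwise the formula in the variables \<open>V\<^sub>0\<close> that expresses the
  inconsistency would hold at \<open>H\<close> but nowhere in that member. A solution of all these formulas comes from automorphisms
  since it satisfies the type of the identity.
\<close>

lemma limit_extension:
  fixes H :: "nat \<Rightarrow> 'm \<Rightarrow> 'm"
  assumes V: "V0 \<subseteq> V1" "Small V1" and ne: "\<R> \<noteq> {}"
    and dir: "\<And>R R'. R \<in> \<R> \<Longrightarrow> R' \<in> \<R> \<Longrightarrow> \<exists>R''\<in>\<R>. R'' \<subseteq> R \<inter> R'"
    and aut: "\<And>R G n. R \<in> \<R> \<Longrightarrow> G \<in> R \<Longrightarrow> G n \<in> aut S"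
    and lim: "\<And>R P. R \<in> \<R> \<Longrightarrow> definable S V0 P \<Longrightarrow> P (case_prod H) \<Longrightarrow> \<exists>G\<in>R. P (case_prod G)"
  obtains H' where "\<And>n. H' n \<in> aut S" "\<And>n x. (n, x) \<in> V0 \<Longrightarrow> H' n x = H n x"
    "\<And>R P. R \<in> \<R> \<Longrightarrow> definable S V1 P \<Longrightarrow> P (case_prod H') \<Longrightarrow> \<exists>G\<in>R. P (case_prod G)"
proof -
  define \<D> where "\<D> = {P. definable S V1 P \<and> (\<exists>R\<in>\<R>. \<forall>G\<in>R. P (case_prod G))}"
  obtain s where s: "\<And>w. w \<in> V0 \<Longrightarrow> s w = case_prod H w" "\<And>P. P \<in> \<D> \<Longrightarrow> P s"
  proof (rule saturation[of V1 V0 \<D> "case_prod H"])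
    show "\<D> \<noteq> {}" using ne by (auto simp: \<D>_def intro: definable_True)
    show "definable S V1 P" if "P \<in> \<D>" for P using that by (simp add: \<D>_def)
    show "\<exists>R\<in>\<D>. \<forall>s. R s \<longrightarrow> P s \<and> Q s" if P: "P \<in> \<D>" and Q: "Q \<in> \<D>" for P Q
    proof -
      obtain R R' where "R \<in> \<R>" "\<forall>G\<in>R. P (case_prod G)" "R' \<in> \<R>" "\<forall>G\<in>R'. Q (case_prod G)"
        using P Q by (auto simp: \<D>_def)
      moreover obtain R'' where "R'' \<in> \<R>" "R'' \<subseteq> R \<inter> R'"
        using dir[OF \<open>R \<in> \<R>\<close> \<open>R' \<in> \<R>\<close>] by blast
      ultimately have "R'' \<in> \<R> \<and> (\<forall>G\<in>R''. P (case_prod G) \<and> Q (case_prod G))"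
        by (simp add: subset_iff)
      moreover have "definable S V1 (\<lambda>s. P s \<and> Q s)"
        by (rule definable_conj) (use P Q in \<open>simp_all add: \<D>_def\<close>)
      ultimately have "(\<lambda>s. P s \<and> Q s) \<in> \<D>"
        unfolding \<D>_def mem_Collect_eq by (intro conjI bexI[of _ R'']) simp_all
      then show ?thesis by (rule rev_bexI) simp
    qed
    show "\<exists>s'. (\<forall>w\<in>V0. s' w = case_prod H w) \<and> P s'" if P: "P \<in> \<D>" for P
    proof (rule ccontr)
      assume *: "\<not> ?thesis"
      obtain R where R: "R \<in> \<R>" "\<forall>G\<in>R. P (case_prod G)" using P by (auto simp: \<D>_def)
      have "definable S (V1 \<inter> V0) (\<lambda>s. \<exists>s'. (\<forall>w\<in>V0. s' w = s w) \<and> P s')"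
        using P by (intro definable_proj) (simp add: \<D>_def)
      then have "definable S V0 (\<lambda>s. \<not> (\<exists>s'. (\<forall>w\<in>V0. s' w = s w) \<and> P s'))"
        by (intro definable_not) (rule definable_mono, auto)
      from lim[OF R(1) this *] R(2) show False by blast
    qed
  qed (use V in auto)
  have "\<exists>f\<in>aut S. \<forall>x. (n, x) \<in> V1 \<longrightarrow> f x = s (n, x)" for n
  proof -
    define W where "W = V1 \<inter> {n} \<times> UNIV"
    have sub: "P s" if P: "definable S W P" "P snd" for P :: "(nat \<times> 'm \<Rightarrow> 'm) \<Rightarrow> bool"
    proof (rule s(2))
      have "P (case_prod G)" if "G \<in> R" "R \<in> \<R>" for G R
      proof -
        have "P (\<lambda>w. G n (snd w))" using definable_aut[OF aut[OF that(2,1)] P(1)] P(2) by simp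
        then show ?thesis
          using definable_cong[OF P(1), of "case_prod G" "\<lambda>w. G n (snd w)"] by (auto simp: W_def)
      qed
      moreover have "definable S V1 P" using P(1) by (rule definable_mono) (simp add: W_def)
      moreover obtain R where "R \<in> \<R>" using ne by blast
      ultimately show "P \<in> \<D>"
        unfolding \<D>_def mem_Collect_eq by (intro conjI bexI[of _ R] ballI) simp_all
    qed
    have inf: "infinite (UNIV :: (nat \<times> 'm) set)" by (simp add: finite_prod)
    obtain f where f: "f \<in> aut S" "\<And>w. w \<in> W \<Longrightarrow> f (snd w) = s w"
    proof -
      have "Small W" by (rule Small_subset[OF V(2)]) (simp add: W_def)
      then show thesis
      proof (rule homogeneous[OF inf, of _ snd s])
        fix P assume P: "definable S W P" "P (snd :: nat \<times> 'm \<Rightarrow> 'm)"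
        show "P s" using P by (rule sub)
      next
        fix f assume "f \<in> aut S" "\<And>w. w \<in> W \<Longrightarrow> f (snd w) = s w"
        then show thesis by (rule that)
      qed
    qed
    have "f x = s (n, x)" if "(n, x) \<in> V1" for x
      using f(2)[of "(n, x)"] that by (simp add: W_def)
    with f(1) show ?thesis by blast
  qed
  then obtain H' where H': "\<And>n. H' n \<in> aut S" "\<And>n x. (n, x) \<in> V1 \<Longrightarrow> H' n x = s (n, x)"
    by metis
  show thesis
  proof (rule that[OF H'(1)])
    show "H' n x = H n x" if "(n, x) \<in> V0" for n x using that H'(2) s(1) V(1) by auto
    show "\<exists>G\<in>R. P (case_prod G)" if "R \<in> \<R>" "definable S V1 P" "P (case_prod H')" for R P
    proof (rule ccontr)
      assume "\<not> ?thesis"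
      then have "(\<lambda>s. \<not> P s) \<in> \<D>"
        unfolding \<D>_def mem_Collect_eq
        by (intro conjI bexI[of _ R] definable_not that(1,2)) simp
      then have "\<not> P s" by (rule s(2))
      moreover have "P s \<longleftrightarrow> P (case_prod H')"
        by (rule definable_cong[OF that(2)]) (use H'(2) in auto)
      ultimately show False using that(3) by simp
    qed
  qed
qed

end


section \<open>Closed sets of automorphisms\<close>

text \<open>
  A formula about several automorphisms has variables \<open>(n, x)\<close> for the value at \<open>x\<close> of the automorphism with
  number \<open>n\<close>; number 0 is usually the identity, whose values are the parameters. The numbers are natural numbers in order
  that there are infinitely many variables even if the monster model is finite.
\<close>

definition seq2 :: "'x \<Rightarrow> 'x \<Rightarrow> nat \<Rightarrow> 'x" where
  "seq2 g h = (\<lambda>n. if n = 0 then g else h)"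

definition seq3 :: "'x \<Rightarrow> 'x \<Rightarrow> 'x \<Rightarrow> nat \<Rightarrow> 'x" where
  "seq3 g h k = (\<lambda>n. if n = 0 then g else if n = 1 then h else k)"

lemma infinite_vars: "infinite (UNIV :: (nat \<times> 'm) set)"
  by (simp add: finite_prod)

lemma definable_rename_vars:
  fixes \<rho> :: "'v \<Rightarrow> nat \<times> 'm" and S :: "('f, 'r, 'm) struct"
  assumes "definable S V P" "\<rho> ` V \<subseteq> W"
  shows "definable S W (\<lambda>s. P (\<lambda>w. s (\<rho> w)))"
  using definable_rename[OF assms(1) infinite_vars, of \<rho>] assms(2) by (rule definable_mono)

lemma definable_seq_cong:
  assumes "definable S V P" "\<And>n x. (n, x) \<in> V \<Longrightarrow> G n x = H n x"
  shows "P (case_prod G) = P (case_prod H)"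
  using assms(1) by (rule definable_cong) (auto simp: assms(2))

lemma definable_seq2_aut:
  assumes "k \<in> aut S" "definable S V P"
  shows "P (case_prod (seq2 (k \<circ> g) (k \<circ> h))) = P (case_prod (seq2 g h))"
proof -
  have "case_prod (seq2 (k \<circ> g) (k \<circ> h)) = (\<lambda>w. k (case_prod (seq2 g h) w))"
    by (auto simp: seq2_def fun_eq_iff)
  then show ?thesis using definable_aut[OF assms] by simp
qed

text \<open>
  The closure of \<open>X\<close> in the topology whose basic open sets are given by the formulas in
  variables for the values of an automorphism on \<open>B\<close>, with parameters from \<open>B\<close>.
\<close>

definition limit_points :: "('f, 'r, 'm) struct \<Rightarrow> 'm set \<Rightarrow> ('m \<Rightarrow> 'm) set \<Rightarrow> ('m \<Rightarrow> 'm) set" where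
  "limit_points S B X = {g \<in> aut S. \<forall>P. definable S ({0, 1} \<times> B) P \<longrightarrow>
    P (case_prod (seq2 id g)) \<longrightarrow> (\<exists>x\<in>X. P (case_prod (seq2 id x)))}"

lemma limit_pointsI:
  assumes "g \<in> aut S" "\<And>P. definable S ({0, 1} \<times> B) P \<Longrightarrow> P (case_prod (seq2 id g)) \<Longrightarrow>
    \<exists>x\<in>X. P (case_prod (seq2 id x))"
  shows "g \<in> limit_points S B X"
  using assms unfolding limit_points_def by simp

lemma limit_pointsD:
  assumes "g \<in> limit_points S B X" "definable S ({0, 1} \<times> B) P" "P (case_prod (seq2 id g))"
  shows "\<exists>x\<in>X. P (case_prod (seq2 id x))"
  using assms unfolding limit_points_def by simp

lemma limit_points_aut: "g \<in> limit_points S B X \<Longrightarrow> g \<in> aut S"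
  by (simp add: limit_points_def)

lemma limit_points_mono:
  assumes "X \<subseteq> Y" "A \<subseteq> B" shows "limit_points S B X \<subseteq> limit_points S A Y"
proof
  fix g assume g: "g \<in> limit_points S B X"
  show "g \<in> limit_points S A Y"
  proof (rule limit_pointsI[OF limit_points_aut[OF g]])
    fix P assume P: "definable S ({0, 1} \<times> A) P" "P (case_prod (seq2 id g))"
    have "definable S ({0, 1} \<times> B) P" using P(1) by (rule definable_mono) (use assms(2) in auto)
    from limit_pointsD[OF g this P(2)] show "\<exists>x\<in>Y. P (case_prod (seq2 id x))"
      using assms(1) by auto
  qed
qed

definition closed_on :: "('f, 'r, 'm) struct \<Rightarrow> 'm set \<Rightarrow> ('m \<Rightarrow> 'm) set \<Rightarrow> bool" where
  "closed_on S B X \<longleftrightarrow> X \<subseteq> aut S \<and> limit_points S B X \<subseteq> X"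

lemma closed_on_aut: "closed_on S B X \<Longrightarrow> X \<subseteq> aut S"
  by (simp add: closed_on_def)

lemma closed_onD: "closed_on S B X \<Longrightarrow> g \<in> limit_points S B X \<Longrightarrow> g \<in> X"
  by (auto simp: closed_on_def)

lemma closed_on_mono: "closed_on S A X \<Longrightarrow> A \<subseteq> B \<Longrightarrow> closed_on S B X"
  using limit_points_mono[of X X A B] unfolding closed_on_def by blast

lemma closed_on_Inter:
  assumes "\<X> \<noteq> {}" "\<And>X. X \<in> \<X> \<Longrightarrow> closed_on S B X"
  shows "closed_on S B (\<Inter>\<X>)"
  unfolding closed_on_def
proof
  show "\<Inter>\<X> \<subseteq> aut S" using assms closed_on_aut by blast
  have "limit_points S B (\<Inter>\<X>) \<subseteq> X" if "X \<in> \<X>" for X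
    using limit_points_mono[of "\<Inter>\<X>" X B B] closed_onD[OF assms(2)[OF that]] that by blast
  then show "limit_points S B (\<Inter>\<X>) \<subseteq> \<Inter>\<X>" by blast
qed

lemma closed_on_Int: "closed_on S B X \<Longrightarrow> closed_on S B Y \<Longrightarrow> closed_on S B (X \<inter> Y)"
  using closed_on_Inter[of "{X, Y}"] by auto

lemma closed_on_Un:
  assumes "closed_on S B X" "closed_on S B Y"
  shows "closed_on S B (X \<union> Y)"
  unfolding closed_on_def
proof (intro conjI subsetI)
  fix g assume g: "g \<in> limit_points S B (X \<union> Y)"
  show "g \<in> X \<union> Y"
  proof (rule ccontr)
    assume "g \<notin> X \<union> Y"
    then have "g \<notin> limit_points S B X" "g \<notin> limit_points S B Y"
      using assms closed_onD by blast+
    then obtain P Q where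
      P: "definable S ({0, 1} \<times> B) P" "P (case_prod (seq2 id g))"
        "\<not> (\<exists>x\<in>X. P (case_prod (seq2 id x)))" and
      Q: "definable S ({0, 1} \<times> B) Q" "Q (case_prod (seq2 id g))"
        "\<not> (\<exists>x\<in>Y. Q (case_prod (seq2 id x)))"
      using limit_points_aut[OF g] unfolding limit_points_def by auto
    have "\<exists>x\<in>X \<union> Y. P (case_prod (seq2 id x)) \<and> Q (case_prod (seq2 id x))"
      using limit_pointsD[OF g definable_conj[OF P(1) Q(1)]] P(2) Q(2) by simp
    then show False using P(3) Q(3) by auto
  qed
qed (use assms closed_on_aut in blast)

lemma closed_on_Union_finite:
  assumes "finite \<X>" "\<And>X. X \<in> \<X> \<Longrightarrow> closed_on S B X"
  shows "closed_on S B (\<Union>\<X>)"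
  using assms
proof (induction \<X> rule: finite_induct)
  case empty
  have "limit_points S B {} = {}"
    by (auto simp: limit_points_def intro!: exI[of _ "\<lambda>s. True"] definable_True)
  then show ?case by (simp add: closed_on_def)
next
  case (insert X \<X>)
  then show ?case using closed_on_Un[of S B X "\<Union>\<X>"] by simp
qed

lemma closed_on_definable:
  assumes "definable S ({0, 1} \<times> B) P"
  shows "closed_on S B {g \<in> aut S. P (case_prod (seq2 id g))}"
  unfolding closed_on_def
proof (intro conjI subsetI CollectI)
  fix g assume g: "g \<in> limit_points S B {g \<in> aut S. P (case_prod (seq2 id g))}"
  show "g \<in> aut S" using g by (rule limit_points_aut)
  show "P (case_prod (seq2 id g))"
  proof (rule ccontr)
    assume "\<not> P (case_prod (seq2 id g))"
    from limit_pointsD[OF g definable_not[OF assms] this] show False by simp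
  qed
qed simp

lemma closed_on_agree:
  assumes "A \<subseteq> B" "f ` A \<subseteq> B"
  shows "closed_on S B {g \<in> aut S. \<forall>x\<in>A. g x = f x}"
proof -
  define Y where "Y x = {g \<in> aut S. case_prod (seq2 id g) (1 :: nat, x) = case_prod (seq2 id g) (0, f x)}" for x
  have "closed_on S B (Y x)" if "x \<in> A" for x
    unfolding Y_def by (rule closed_on_definable, rule definable_eq) (use assms that in auto)
  moreover have "closed_on S B (aut S)"
    by (auto simp: closed_on_def limit_points_aut)
  ultimately have "closed_on S B (\<Inter> (insert (aut S) (Y ` A)))"
    by (intro closed_on_Inter) auto
  moreover have "\<Inter> (insert (aut S) (Y ` A)) = {g \<in> aut S. \<forall>x\<in>A. g x = f x}"
    by (auto simp: Y_def seq2_def)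
  ultimately show ?thesis by simp
qed

text \<open>
  As \<open>h\<close> fixes \<open>B\<close>, the tuples \<open>g(B) = h(x(B))\<close> and \<open>x(B)\<close> have the same type over \<open>B\<close>.
\<close>

lemma closed_on_same_type:
  assumes X: "closed_on S B X" and x: "x \<in> X" and h: "h \<in> aut S" "\<And>y. y \<in> B \<Longrightarrow> h y = y"
    and g: "g \<in> aut S" "\<And>y. y \<in> B \<Longrightarrow> g y = h (x y)"
  shows "g \<in> X"
proof (rule closed_onD[OF X], rule limit_pointsI[OF g(1)])
  fix P assume P: "definable S ({0, 1} \<times> B) P" "P (case_prod (seq2 id g))"
  have "P (case_prod (seq2 id g)) = P (case_prod (seq2 (h \<circ> id) (h \<circ> x)))"
    by (rule definable_seq_cong[OF P(1)]) (use h g in \<open>auto simp: seq2_def\<close>)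
  also have "\<dots> = P (case_prod (seq2 id x))" by (rule definable_seq2_aut[OF h(1) P(1)])
  finally show "\<exists>x\<in>X. P (case_prod (seq2 id x))" using P(2) x by blast
qed

text \<open>
  The condition \<open>\<Phi>(id, k\<inverse> \<circ> g)\<close> is equivalent to \<open>\<Phi>(k, g)\<close>, so that the images of \<open>B\<close> under
  \<open>k\<close> become parameters.
\<close>

lemma closed_on_ltrans:
  assumes X: "closed_on S B X" and k: "k \<in> aut S"
  shows "closed_on S (B \<union> k ` B) ((\<lambda>x. k \<circ> x) ` X)"
  unfolding closed_on_def
proof (intro conjI subsetI)
  fix g assume g: "g \<in> limit_points S (B \<union> k ` B) ((\<lambda>x. k \<circ> x) ` X)"
  have g': "g \<in> aut S" using g by (rule limit_points_aut)
  have eq: "(\<lambda>w. case_prod (seq2 id (k \<circ> h)) (fst w, if fst w = 0 then k (snd w) else snd w)) =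
      case_prod (seq2 (k \<circ> id) (k \<circ> h))" for h :: "'c \<Rightarrow> 'c"
    by (auto simp: seq2_def fun_eq_iff)
  have "ginv k \<circ> g \<in> limit_points S B X"
  proof (rule limit_pointsI)
    show "ginv k \<circ> g \<in> aut S" using inv_aut[OF k] g' by (rule comp_aut)
  next
    fix P assume P: "definable S ({0, 1} \<times> B) P" "P (case_prod (seq2 id (ginv k \<circ> g)))"
    define Q where "Q = (\<lambda>s. P (\<lambda>w. s (fst w, if fst w = 0 then k (snd w) else snd w)))"
    have dQ: "definable S ({0, 1} \<times> (B \<union> k ` B)) Q"
      unfolding Q_def by (rule definable_rename_vars[OF P(1)]) auto
    have Q: "Q (case_prod (seq2 id (k \<circ> h))) = P (case_prod (seq2 id h))" for h
      unfolding Q_def eq by (rule definable_seq2_aut[OF k P(1)])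
    have "k \<circ> (ginv k \<circ> g) = g" by (simp add: o_assoc aut_comp_ginv[OF k])
    then have "Q (case_prod (seq2 id g))" using Q[of "ginv k \<circ> g"] P(2) by simp
    from limit_pointsD[OF g dQ this] show "\<exists>x\<in>X. P (case_prod (seq2 id x))"
      using Q by auto
  qed
  then have "ginv k \<circ> g \<in> X" by (rule closed_onD[OF X])
  moreover have "k \<circ> (ginv k \<circ> g) = g" by (simp add: o_assoc aut_comp_ginv[OF k])
  ultimately show "g \<in> (\<lambda>x. k \<circ> x) ` X" by (metis imageI)
qed (use closed_on_aut[OF X] comp_aut[OF k] in blast)

text \<open>
  Here \<open>\<Phi>(id, g\<inverse>)\<close> is equivalent to \<open>\<Phi>(g, id)\<close>.
\<close>

lemma closed_on_ginv:
  assumes X: "closed_on S B X"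
  shows "closed_on S B (ginv ` X)"
  unfolding closed_on_def
proof (intro conjI subsetI)
  fix g assume g: "g \<in> limit_points S B (ginv ` X)"
  have g': "g \<in> aut S" using g by (rule limit_points_aut)
  have swap: "(\<lambda>w. case_prod (seq2 id h) (1 - fst w, snd w)) w = case_prod (seq2 h id) w"
    if "w \<in> {0, 1} \<times> B" for h :: "'c \<Rightarrow> 'c" and w
    using that by (auto simp: seq2_def)
  have "ginv g \<in> limit_points S B X"
  proof (rule limit_pointsI[OF inv_aut[OF g']])
    fix P assume P: "definable S ({0, 1} \<times> B) P" "P (case_prod (seq2 id (ginv g)))"
    define Q where "Q = (\<lambda>s. P (\<lambda>w. s (1 - fst w, snd w)))"
    have dQ: "definable S ({0, 1} \<times> B) Q"
      unfolding Q_def by (rule definable_rename_vars[OF P(1)]) auto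
    have Q: "Q (case_prod (seq2 id h)) = P (case_prod (seq2 id (ginv h)))" if h: "h \<in> aut S" for h
    proof -
      have "Q (case_prod (seq2 id h)) = P (case_prod (seq2 h id))"
        unfolding Q_def using P(1) swap by (rule definable_cong)
      also have "seq2 h id = seq2 (h \<circ> id) (h \<circ> ginv h)" by (simp add: aut_comp_ginv[OF h])
      also have "P (case_prod \<dots>) = P (case_prod (seq2 id (ginv h)))"
        by (rule definable_seq2_aut[OF h P(1)])
      finally show ?thesis .
    qed
    obtain y where y: "y \<in> ginv ` X" "Q (case_prod (seq2 id y))"
      using limit_pointsD[OF g dQ] Q[OF g'] P(2) by blast
    then obtain x where x: "x \<in> X" "y = ginv x" by blast
    have xa: "x \<in> aut S" using x closed_on_aut[OF X] by blast
    have "P (case_prod (seq2 id x))"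
      using Q[OF inv_aut[OF xa]] y(2) x(2) ginv_ginv[OF xa] by simp
    then show "\<exists>x\<in>X. P (case_prod (seq2 id x))" using x(1) by blast
  qed
  then have "ginv g \<in> X" by (rule closed_onD[OF X])
  moreover have "g = ginv (ginv g)" by (simp add: ginv_ginv[OF g'])
  ultimately show "g \<in> ginv ` X" by blast
qed (use closed_on_aut[OF X] inv_aut in blast)

context monster_model
begin

text \<open>
  Compactness extends \<open>g\<close> and the parameters from \<open>A\<close> to \<open>B\<close>, but moves the parameters in \<open>B\<close> outside
  \<open>A\<close>. The automorphism \<open>h\<close> is this movement, and undoing it turns the result into a limit \<open>(x, y)\<close> of \<open>R\<close> with
  parameters from \<open>B\<close>.
\<close>

lemma limit_lift:
  assumes A: "A \<subseteq> B" "Small B" and R: "R \<subseteq> aut S \<times> aut S" and g: "g \<in> limit_points S A (fst ` R)"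
  obtains h x y where "h \<in> aut S" "\<And>z. z \<in> A \<Longrightarrow> h z = z" "x \<in> aut S" "y \<in> aut S"
    "\<And>z. z \<in> A \<Longrightarrow> h (x z) = g z"
    "\<And>P. definable S ({0, 1, 2} \<times> B) P \<Longrightarrow> P (case_prod (seq3 id x y)) \<Longrightarrow>
      \<exists>(x', y')\<in>R. P (case_prod (seq3 id x' y'))"
proof -
  define \<R> where "\<R> = {(\<lambda>(x, y). seq3 id x y) ` R}"
  have s3: "P (case_prod (seq3 id x y)) = P (case_prod (seq2 id x))"
    if "definable S ({0, 1} \<times> A) P" for P x y
    using that by (rule definable_seq_cong) (auto simp: seq3_def seq2_def)
  have lim: "\<exists>G\<in>R'. P (case_prod G)"
    if "R' \<in> \<R>" and P: "definable S ({0, 1} \<times> A) P" "P (case_prod (seq3 id g id))" for R' P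
  proof -
    have "P (case_prod (seq2 id g))" using P s3[OF P(1)] by simp
    from limit_pointsD[OF g P(1) this] obtain p where "p \<in> R" "P (case_prod (seq2 id (fst p)))" by blast
    then have "P (case_prod ((\<lambda>(x, y). seq3 id x y) p))" using s3[OF P(1)] by (simp add: case_prod_beta)
    then show ?thesis using \<open>R' \<in> \<R>\<close> \<open>p \<in> R\<close> by (auto simp: \<R>_def)
  qed
  have auts: "G n \<in> aut S" if "R' \<in> \<R>" "G \<in> R'" for R' G n
    using that R by (auto simp: \<R>_def seq3_def id_aut)
  have VV: "{0, 1} \<times> A \<subseteq> {0, 1, 2 :: nat} \<times> B" "Small ({0, 1, 2 :: nat} \<times> B)"
    using A by (auto intro: Small_Times Small_finite)
  obtain H where H: "\<And>n. H n \<in> aut S" "\<And>n z. (n, z) \<in> {0, 1} \<times> A \<Longrightarrow> H n z = seq3 id g id n z"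
    "\<And>R' P. R' \<in> \<R> \<Longrightarrow> definable S ({0, 1, 2} \<times> B) P \<Longrightarrow> P (case_prod H) \<Longrightarrow> \<exists>G\<in>R'. P (case_prod G)"
  proof (rule limit_extension[OF VV, of \<R> "seq3 id g id"])
    show "\<exists>R''\<in>\<R>. R'' \<subseteq> R \<inter> R'" if "R \<in> \<R>" "R' \<in> \<R>" for R R'
      using that by (auto simp: \<R>_def)
  qed (use lim auts in \<open>auto simp: \<R>_def\<close>)
  have H0: "ginv (H 0) \<in> aut S" by (rule inv_aut[OF H(1)])
  show thesis
  proof (rule that[of "H 0" "ginv (H 0) \<circ> H 1" "ginv (H 0) \<circ> H 2"])
    show "H 0 \<in> aut S" "ginv (H 0) \<circ> H 1 \<in> aut S" "ginv (H 0) \<circ> H 2 \<in> aut S"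
      using H(1) H0 comp_aut by blast+
    show "H 0 z = z" if "z \<in> A" for z using H(2)[of 0 z] that by (simp add: seq3_def)
    show "H 0 ((ginv (H 0) \<circ> H 1) z) = g z" if "z \<in> A" for z
      using H(2)[of 1 z] that by (simp add: seq3_def aut_ginv[OF H(1)])
  next
    fix P assume P: "definable S ({0, 1, 2} \<times> B) P"
      "P (case_prod (seq3 id (ginv (H 0) \<circ> H 1) (ginv (H 0) \<circ> H 2)))"
    have "P (case_prod H) = P (\<lambda>w. H 0 (case_prod (seq3 id (ginv (H 0) \<circ> H 1) (ginv (H 0) \<circ> H 2)) w))"
      using P(1) by (rule definable_cong) (auto simp: seq3_def aut_ginv[OF H(1)])
    also have "\<dots> = P (case_prod (seq3 id (ginv (H 0) \<circ> H 1) (ginv (H 0) \<circ> H 2)))"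
      by (rule definable_aut[OF H(1) P(1)])
    finally have "P (case_prod H)" using P(2) by simp
    from H(3)[OF _ P(1) this] show "\<exists>(x', y')\<in>R. P (case_prod (seq3 id x' y'))"
      by (auto simp: \<R>_def)
  qed
qed

text \<open>
  A limit point on \<open>A\<close> agrees on \<open>A\<close> with a limit point on \<open>B\<close> up to an automorphism that fixes
  \<open>A\<close>, and the assumption on \<open>X\<close> absorbs such automorphisms.
\<close>

lemma closed_on_support:
  assumes A: "A \<subseteq> B" "Small B" and X: "closed_on S B X"
    and inv: "\<And>x h. x \<in> X \<Longrightarrow> h \<in> aut S \<Longrightarrow> (\<And>z. z \<in> A \<Longrightarrow> h z = z) \<Longrightarrow> h \<circ> x \<in> X \<and> x \<circ> h \<in> X"
  shows "closed_on S A X"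
  unfolding closed_on_def
proof (intro conjI subsetI)
  fix g assume g: "g \<in> limit_points S A X"
  have "fst ` (\<lambda>x. (x, x)) ` X = X" by force
  then have g': "g \<in> limit_points S A (fst ` (\<lambda>x. (x, x)) ` X)" using g by simp
  have R: "(\<lambda>x. (x, x)) ` X \<subseteq> aut S \<times> aut S" using closed_on_aut[OF X] by auto
  obtain h x y where
    h: "h \<in> aut S" "\<And>z. z \<in> A \<Longrightarrow> h z = z" and x: "x \<in> aut S" "\<And>z. z \<in> A \<Longrightarrow> h (x z) = g z"
    and lim: "\<And>P. definable S ({0, 1, 2} \<times> B) P \<Longrightarrow> P (case_prod (seq3 id x y)) \<Longrightarrow>
      \<exists>(x', y')\<in>(\<lambda>x. (x, x)) ` X. P (case_prod (seq3 id x' y'))"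
    by (rule limit_lift[OF A R g'], rule that)
  have "x \<in> limit_points S B X"
  proof (rule limit_pointsI[OF x(1)])
    fix P assume P: "definable S ({0, 1} \<times> B) P" "P (case_prod (seq2 id x))"
    have s3: "P (case_prod (seq3 id x y)) = P (case_prod (seq2 id x))" for x y
      using P(1) by (rule definable_seq_cong) (auto simp: seq3_def seq2_def)
    have "definable S ({0, 1, 2} \<times> B) P" using P(1) by (rule definable_mono) auto
    from lim[OF this] P(2) s3 show "\<exists>x\<in>X. P (case_prod (seq2 id x))" by auto
  qed
  then have "x \<in> X" by (rule closed_onD[OF X])
  then have hx: "h \<circ> x \<in> X" using inv h by blast
  have hx': "h \<circ> x \<in> aut S" using hx closed_on_aut[OF X] by blast
  define k where "k = ginv (h \<circ> x) \<circ> g"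
  have "k \<in> aut S" unfolding k_def using inv_aut[OF hx'] limit_points_aut[OF g] by (rule comp_aut)
  moreover have "k z = z" if "z \<in> A" for z
    using x(2)[OF that] ginv_aut[OF hx', of z] by (simp add: k_def)
  ultimately have "(h \<circ> x) \<circ> k \<in> X" using inv[OF hx] by blast
  then show "g \<in> X" unfolding k_def by (simp only: o_assoc aut_comp_ginv[OF hx'] id_o)
qed (use closed_on_aut[OF X] in blast)

text \<open>
  If \<open>g\<close> is a limit of products \<open>x \<circ> y\<close>, compactness provides simultaneous limits of the factors.
\<close>

lemma closed_on_mult:
  assumes B: "Small B" and X: "closed_on S B X" and Y: "closed_on S B Y"
  shows "closed_on S B {x \<circ> y | x y. x \<in> X \<and> y \<in> Y}"
  unfolding closed_on_def
proof (intro conjI subsetI)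
  fix g assume g: "g \<in> limit_points S B {x \<circ> y | x y. x \<in> X \<and> y \<in> Y}"
  define R where "R = {(x \<circ> y, x) | x y. x \<in> X \<and> y \<in> Y}"
  have "fst ` R = {x \<circ> y | x y. x \<in> X \<and> y \<in> Y}" by (force simp: R_def)
  then have g': "g \<in> limit_points S B (fst ` R)" using g by simp
  have RS: "R \<subseteq> aut S \<times> aut S"
  proof
    fix p assume "p \<in> R"
    then obtain x y where "p = (x \<circ> y, x)" "x \<in> X" "y \<in> Y" by (auto simp: R_def)
    then show "p \<in> aut S \<times> aut S"
      using closed_on_aut[OF X] closed_on_aut[OF Y] comp_aut[of x S y] by (simp add: subset_iff)
  qed
  obtain h x y where
    h: "h \<in> aut S" "\<And>z. z \<in> B \<Longrightarrow> h z = z" and x: "x \<in> aut S" "\<And>z. z \<in> B \<Longrightarrow> h (x z) = g z"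
    and y: "y \<in> aut S"
    and lim: "\<And>P. definable S ({0, 1, 2} \<times> B) P \<Longrightarrow> P (case_prod (seq3 id x y)) \<Longrightarrow>
      \<exists>(x', y')\<in>R. P (case_prod (seq3 id x' y'))"
    by (rule limit_lift[OF order_refl B RS g'], rule that)
  have "y \<in> limit_points S B X"
  proof (rule limit_pointsI[OF y])
    fix P assume P: "definable S ({0, 1} \<times> B) P" "P (case_prod (seq2 id y))"
    define Q where "Q = (\<lambda>s. P (\<lambda>w. s (2 * fst w, snd w)))"
    have dQ: "definable S ({0, 1, 2} \<times> B) Q"
      unfolding Q_def by (rule definable_rename_vars[OF P(1)]) auto
    have Q: "Q (case_prod (seq3 id x y)) = P (case_prod (seq2 id y))" for x y
      unfolding Q_def using P(1) by (rule definable_cong) (auto simp: seq3_def seq2_def)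
    from lim[OF dQ] P(2) Q show "\<exists>x\<in>X. P (case_prod (seq2 id x))" by (auto simp: R_def)
  qed
  then have yX: "y \<in> X" by (rule closed_onD[OF X])
  have "ginv y \<circ> x \<in> limit_points S B Y"
  proof (rule limit_pointsI)
    show "ginv y \<circ> x \<in> aut S" using inv_aut[OF y] x(1) by (rule comp_aut)
    fix P assume P: "definable S ({0, 1} \<times> B) P" "P (case_prod (seq2 id (ginv y \<circ> x)))"
    define Q where "Q = (\<lambda>s. P (\<lambda>w. s (2 - fst w, snd w)))"
    have dQ: "definable S ({0, 1, 2} \<times> B) Q"
      unfolding Q_def by (rule definable_rename_vars[OF P(1)]) auto
    have Q: "Q (case_prod (seq3 id (x \<circ> y) x)) = P (case_prod (seq2 id y))" if x: "x \<in> aut S" for x y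
    proof -
      have "Q (case_prod (seq3 id (x \<circ> y) x)) = P (case_prod (seq2 (x \<circ> id) (x \<circ> y)))"
        unfolding Q_def using P(1) by (rule definable_cong) (auto simp: seq3_def seq2_def)
      also have "\<dots> = P (case_prod (seq2 id y))" by (rule definable_seq2_aut[OF x P(1)])
      finally show ?thesis .
    qed
    have "y \<circ> (ginv y \<circ> x) = x" by (simp add: o_assoc aut_comp_ginv[OF y])
    then have "Q (case_prod (seq3 id x y))" using Q[OF y, of "ginv y \<circ> x"] P(2) by simp
    from lim[OF dQ this] show "\<exists>x\<in>Y. P (case_prod (seq2 id x))"
      using Q closed_on_aut[OF X] by (auto simp: R_def)
  qed
  then have zY: "ginv y \<circ> x \<in> Y" by (rule closed_onD[OF Y])
  have hy: "h \<circ> y \<in> aut S" using h(1) y by (rule comp_aut)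
  have "h \<circ> y \<in> X" by (rule closed_on_same_type[OF X yX h hy]) simp_all
  moreover have "ginv (h \<circ> y) \<circ> g \<in> Y"
  proof (rule closed_on_same_type[OF Y zY id_aut])
    show "ginv (h \<circ> y) \<circ> g \<in> aut S" using inv_aut[OF hy] limit_points_aut[OF g] by (rule comp_aut)
    show "(ginv (h \<circ> y) \<circ> g) z = id ((ginv y \<circ> x) z)" if "z \<in> B" for z
    proof -
      have "(h \<circ> y) (ginv y (x z)) = g z" using x(2)[OF that] by (simp add: aut_ginv[OF y])
      then show ?thesis using ginv_aut[OF hy, of "ginv y (x z)"] by simp
    qed
  qed simp
  moreover have "g = (h \<circ> y) \<circ> (ginv (h \<circ> y) \<circ> g)"
    by (simp only: o_assoc aut_comp_ginv[OF hy] id_o)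
  ultimately show "g \<in> {x \<circ> y | x y. x \<in> X \<and> y \<in> Y}" by blast
qed (use closed_on_aut[OF X] closed_on_aut[OF Y] comp_aut in blast)

text \<open>
  The limit given by compactness is a pair of automorphisms \<open>(H 0, H 1)\<close> in which \<open>H 0\<close>, a limit of the identity,
  fixes \<open>B\<close>. Undoing \<open>H 0\<close> yields the common element.
\<close>

lemma closed_on_compact:
  assumes B: "Small B" and ne: "\<X> \<noteq> {}"
    and X: "\<And>X. X \<in> \<X> \<Longrightarrow> closed_on S B X" "\<And>X. X \<in> \<X> \<Longrightarrow> X \<noteq> {}"
    and dir: "\<And>X Y. X \<in> \<X> \<Longrightarrow> Y \<in> \<X> \<Longrightarrow> \<exists>Z\<in>\<X>. Z \<subseteq> X \<inter> Y"
  shows "\<Inter>\<X> \<noteq> {}"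
proof -
  define \<R> where "\<R> = (\<lambda>X. seq2 id ` X) ` \<X>"
  have VV: "{0} \<times> B \<subseteq> {0, 1 :: nat} \<times> B" "Small ({0, 1 :: nat} \<times> B)"
    using B by (auto intro: Small_Times Small_finite)
  have lim: "\<exists>G\<in>R. P (case_prod G)"
    if R: "R \<in> \<R>" and P: "definable S ({0} \<times> B) P" "P (case_prod (\<lambda>_. id))" for R P
  proof -
    obtain Y y where y: "R = seq2 id ` Y" "y \<in> Y" using R X(2) by (fastforce simp: \<R>_def)
    have "P (case_prod (seq2 id y)) = P (case_prod (\<lambda>_. id))"
      using P(1) by (rule definable_seq_cong) (auto simp: seq2_def)
    then show ?thesis using P(2) y by auto
  qed
  have auts: "G n \<in> aut S" if "R \<in> \<R>" "G \<in> R" for R G n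
    using that X(1) closed_on_aut by (fastforce simp: \<R>_def seq2_def id_aut)
  have dir': "\<exists>R''\<in>\<R>. R'' \<subseteq> R \<inter> R'" if RR: "R \<in> \<R>" "R' \<in> \<R>" for R R'
  proof -
    obtain Y Y' where Y: "Y \<in> \<X>" "Y' \<in> \<X>" "R = seq2 id ` Y" "R' = seq2 id ` Y'"
      using RR by (auto simp: \<R>_def)
    obtain Z where "Z \<in> \<X>" "Z \<subseteq> Y \<inter> Y'" using dir[OF Y(1,2)] by blast
    then show ?thesis using Y by (intro bexI[of _ "seq2 id ` Z"]) (auto simp: \<R>_def)
  qed
  obtain H where H: "\<And>n. H n \<in> aut S" "\<And>n z. (n, z) \<in> {0} \<times> B \<Longrightarrow> H n z = id z"
    "\<And>R P. R \<in> \<R> \<Longrightarrow> definable S ({0, 1} \<times> B) P \<Longrightarrow> P (case_prod H) \<Longrightarrow> \<exists>G\<in>R. P (case_prod G)"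
  proof (rule limit_extension[OF VV, of \<R> "\<lambda>_. id"])
    show "\<R> \<noteq> {}" using ne by (simp add: \<R>_def)
  qed (erule (1) dir', erule (1) auts, erule (2) lim, rule that)
  define g where "g = ginv (H 0) \<circ> H 1"
  have g: "g \<in> aut S" unfolding g_def using inv_aut[OF H(1)] H(1) by (rule comp_aut)
  have "g \<in> Y" if Y: "Y \<in> \<X>" for Y
  proof (rule closed_onD[OF X(1)[OF Y]], rule limit_pointsI[OF g])
    fix P assume P: "definable S ({0, 1} \<times> B) P" "P (case_prod (seq2 id g))"
    have "P (case_prod H) = P (case_prod (seq2 (H 0 \<circ> id) (H 0 \<circ> g)))"
      using P(1) by (rule definable_seq_cong) (auto simp: seq2_def g_def aut_ginv[OF H(1)])
    also have "\<dots> = P (case_prod (seq2 id g))" by (rule definable_seq2_aut[OF H(1) P(1)])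
    finally have "P (case_prod H)" using P(2) by simp
    from H(3)[OF _ P(1) this, of "seq2 id ` Y"] Y
    show "\<exists>x\<in>Y. P (case_prod (seq2 id x))" by (auto simp: \<R>_def)
  qed
  then show ?thesis by blast
qed

text \<open>
  Otherwise every formula that holds on \<open>X\<close> would hold somewhere on \<open>Y\<close>, and by compactness some element of
  \<open>Y\<close> would satisfy all of them, so that it would be a limit point of \<open>X\<close>.
\<close>

lemma closed_on_separate:
  assumes B: "Small B" and X: "closed_on S B X" and Y: "closed_on S B Y" and disj: "X \<inter> Y = {}"
  obtains P where "definable S ({0, 1} \<times> B) P" "\<And>x. x \<in> X \<Longrightarrow> P (case_prod (seq2 id x))"
    "\<And>y. y \<in> Y \<Longrightarrow> \<not> P (case_prod (seq2 id y))"
proof (rule ccontr)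
  assume no: "\<not> thesis"
  define D where "D P = {g \<in> aut S. P (case_prod (seq2 id g))}" for P
  define \<P> where "\<P> = {P. definable S ({0, 1} \<times> B) P \<and> X \<subseteq> D P}"
  have "\<Inter> ((\<lambda>P. D P \<inter> Y) ` \<P>) \<noteq> {}"
  proof (rule closed_on_compact[OF B])
    have "(\<lambda>s. True) \<in> \<P>" using closed_on_aut[OF X] by (auto simp: \<P>_def D_def definable_True)
    then show "(\<lambda>P. D P \<inter> Y) ` \<P> \<noteq> {}" by blast
  next
    fix Z assume "Z \<in> (\<lambda>P. D P \<inter> Y) ` \<P>"
    then obtain P where P: "P \<in> \<P>" "Z = D P \<inter> Y" by (elim imageE)
    have dP: "definable S ({0, 1} \<times> B) P" "X \<subseteq> D P"
      using P(1) unfolding \<P>_def by blast+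
    show "closed_on S B Z"
      unfolding P(2) D_def by (rule closed_on_Int[OF closed_on_definable[OF dP(1)] Y])
    show "Z \<noteq> {}"
    proof
      assume Z: "Z = {}"
      have thesis
      proof (rule that[OF dP(1)])
        show "P (case_prod (seq2 id x))" if "x \<in> X" for x
          using that dP(2) unfolding D_def by blast
        show "\<not> P (case_prod (seq2 id y))" if "y \<in> Y" for y
          using that Z P(2) closed_on_aut[OF Y] unfolding D_def by blast
      qed
      then show False using no by contradiction
    qed
  next
    fix Z Z' assume "Z \<in> (\<lambda>P. D P \<inter> Y) ` \<P>" "Z' \<in> (\<lambda>P. D P \<inter> Y) ` \<P>"
    then obtain P P' where P: "P \<in> \<P>" "Z = D P \<inter> Y" "P' \<in> \<P>" "Z' = D P' \<inter> Y"
      by (elim imageE)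
    define Q where "Q = (\<lambda>s. P s \<and> P' s)"
    have "definable S ({0, 1} \<times> B) P" "definable S ({0, 1} \<times> B) P'"
      using P(1,3) unfolding \<P>_def by blast+
    then have "definable S ({0, 1} \<times> B) Q"
      unfolding Q_def by (rule definable_conj)
    moreover have DQ: "D Q = D P \<inter> D P'" unfolding D_def Q_def by blast
    moreover have "X \<subseteq> D P" "X \<subseteq> D P'" using P(1,3) unfolding \<P>_def by blast+
    ultimately have "Q \<in> \<P>" unfolding \<P>_def by blast
    then show "\<exists>W\<in>(\<lambda>P. D P \<inter> Y) ` \<P>. W \<subseteq> Z \<inter> Z'"
      using P DQ by (intro bexI[of _ "D Q \<inter> Y"] imageI) auto
  qed
  then obtain g where g: "\<And>P. P \<in> \<P> \<Longrightarrow> g \<in> D P \<inter> Y" by blast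
  have "(\<lambda>s. True) \<in> \<P>" using closed_on_aut[OF X] by (auto simp: \<P>_def D_def definable_True)
  from g[OF this] have gY: "g \<in> Y" "g \<in> aut S" unfolding D_def by blast+
  have "g \<in> limit_points S B X"
  proof (rule limit_pointsI[OF gY(2)], rule ccontr)
    fix P assume P: "definable S ({0, 1} \<times> B) P" "P (case_prod (seq2 id g))"
      "\<not> (\<exists>x\<in>X. P (case_prod (seq2 id x)))"
    have "(\<lambda>s. \<not> P s) \<in> \<P>"
      unfolding \<P>_def mem_Collect_eq D_def
      using definable_not[OF P(1)] P(3) closed_on_aut[OF X] by blast
    from g[OF this] P(2) show False unfolding D_def by blast
  qed
  then show False using closed_onD[OF X] gY(1) disj by blast
qed

end


section \<open>Topological quotients of groups of automorphisms\<close>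

lemma
  assumes "f \<in> aut S"
  shows aut_ginv_cancel: "f \<circ> (ginv f \<circ> g) = g" and ginv_aut_cancel: "ginv f \<circ> (f \<circ> g) = g"
  by (simp_all add: o_assoc aut_comp_ginv[OF assms] ginv_comp_aut[OF assms])

lemma ginv_comp:
  assumes "f \<in> aut S" "g \<in> aut S"
  shows "ginv (f \<circ> g) = ginv g \<circ> ginv f"
  using assms by (simp add: aut_def o_inv_distrib)

definition aut_subgroup :: "('f, 'r, 'm) struct \<Rightarrow> ('m \<Rightarrow> 'm) set \<Rightarrow> bool" where
  "aut_subgroup S Y \<longleftrightarrow> Y \<subseteq> aut S \<and> id \<in> Y \<and> (\<forall>f\<in>Y. \<forall>g\<in>Y. f \<circ> g \<in> Y) \<and> (\<forall>f\<in>Y. ginv f \<in> Y)"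

lemma
  assumes "aut_subgroup S Y"
  shows aut_subgroup_aut: "f \<in> Y \<Longrightarrow> f \<in> aut S" and aut_subgroup_id: "id \<in> Y"
    and aut_subgroup_comp: "f \<in> Y \<Longrightarrow> g \<in> Y \<Longrightarrow> f \<circ> g \<in> Y"
    and aut_subgroup_ginv: "f \<in> Y \<Longrightarrow> ginv f \<in> Y"
  using assms by (auto simp: aut_subgroup_def)

text \<open>
  The automorphism \<open>k\<close> exists if \<open>f(B)\<close> and \<open>g(B)\<close> have the same type over \<open>B\<close>. It is in \<open>K\<close>, and
  \<open>k \<circ> f\<close> differs from \<open>g\<close> by an automorphism that fixes \<open>B\<close>, which normality brings to the other side.
\<close>

lemma coset_of_agreement:
  assumes G: "aut_subgroup S G" and K: "aut_subgroup S K"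
    and normal: "\<And>k g. k \<in> K \<Longrightarrow> g \<in> G \<Longrightarrow> g \<circ> (k \<circ> ginv g) \<in> K"
    and fixing: "\<And>h. h \<in> aut S \<Longrightarrow> (\<And>z. z \<in> B \<Longrightarrow> h z = z) \<Longrightarrow> h \<in> K"
    and f: "f \<in> G" and g: "g \<in> G" and k: "k \<in> aut S" "\<And>z. z \<in> B \<Longrightarrow> k z = z"
      "\<And>z. z \<in> B \<Longrightarrow> k (f z) = g z"
  shows "\<exists>n\<in>K. g = n \<circ> f"
proof -
  have kK: "k \<in> K" by (rule fixing[OF k(1,2)])
  have ga: "g \<in> aut S" and fa: "f \<in> aut S" using aut_subgroup_aut[OF G] f g by blast+
  define n where "n = ginv g \<circ> (k \<circ> f)"
  have "n \<in> K"
  proof (rule fixing)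
    show "n \<in> aut S" unfolding n_def by (intro comp_aut inv_aut ga k(1) fa)
    show "n z = z" if "z \<in> B" for z using k(3)[OF that] ginv_aut[OF ga, of z] by (simp add: n_def)
  qed
  then have "g \<circ> (n \<circ> ginv g) \<in> K" using g by (rule normal)
  then have "ginv (g \<circ> (n \<circ> ginv g)) \<circ> k \<in> K"
    by (rule aut_subgroup_comp[OF K aut_subgroup_ginv[OF K] kK])
  moreover have "g = (ginv (g \<circ> (n \<circ> ginv g)) \<circ> k) \<circ> f"
  proof -
    have kf: "k \<circ> f \<in> aut S" by (rule comp_aut[OF k(1) fa])
    have "g \<circ> (n \<circ> ginv g) = (k \<circ> f) \<circ> ginv g"
      by (simp add: n_def comp_assoc aut_ginv_cancel[OF ga])
    then have "ginv (g \<circ> (n \<circ> ginv g)) = g \<circ> ginv (k \<circ> f)"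
      using ginv_comp[OF kf inv_aut[OF ga]] by (simp add: ginv_ginv[OF ga])
    then show ?thesis by (simp add: comp_assoc ginv_comp_aut[OF kf])
  qed
  ultimately show ?thesis by blast
qed

text \<open>
  \<open>X\<close> is the quotient of \<open>G\<close> by a normal subgroup \<open>K\<close> containing the pointwise stabilizer of
  the small set \<open>B\<close>, with the topology in which a set is closed if its preimage in \<open>G\<close> is closed on \<open>B\<close>.
\<close>

locale galois_quotient = monster_model T S \<kappa>
  for T :: "('f, 'r, nat) fm set" and S :: "('f, 'r, 'm) struct" and \<kappa> :: "'k rel" +
  fixes G K :: "('m \<Rightarrow> 'm) set" and B :: "'m set" and \<pi> :: "('m \<Rightarrow> 'm) \<Rightarrow> 'q" and X :: "'q topology"
  assumes G: "aut_subgroup S G" and K: "aut_subgroup S K" and KG: "K \<subseteq> G"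
    and closed_G: "closed_on S B G"
    and normal: "k \<in> K \<Longrightarrow> g \<in> G \<Longrightarrow> g \<circ> (k \<circ> ginv g) \<in> K"
    and Small_B: "Small B" and fixing: "h \<in> aut S \<Longrightarrow> (\<And>z. z \<in> B \<Longrightarrow> h z = z) \<Longrightarrow> h \<in> K"
    and \<pi>: "f \<in> G \<Longrightarrow> g \<in> G \<Longrightarrow> \<pi> f = \<pi> g \<longleftrightarrow> (\<exists>k\<in>K. g = k \<circ> f)"
    and closedin_iff: "closedin X C \<longleftrightarrow> C \<subseteq> \<pi> ` G \<and> closed_on S B {g \<in> G. \<pi> g \<in> C}"
begin

lemmas G_aut = aut_subgroup_aut[OF G] and id_G = aut_subgroup_id[OF G]
  and comp_G = aut_subgroup_comp[OF G] and ginv_G = aut_subgroup_ginv[OF G]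

lemmas K_aut = aut_subgroup_aut[OF K] and id_K = aut_subgroup_id[OF K]
  and comp_K = aut_subgroup_comp[OF K] and ginv_K = aut_subgroup_ginv[OF K]

lemma K_G: "k \<in> K \<Longrightarrow> k \<in> G"
  using KG by blast

definition saturated_set :: "('m \<Rightarrow> 'm) set \<Rightarrow> bool" where
  "saturated_set Y \<longleftrightarrow> Y \<subseteq> G \<and> (\<forall>y\<in>Y. \<forall>k\<in>K. k \<circ> y \<in> Y)"

lemma saturated_setI: "Y \<subseteq> G \<Longrightarrow> (\<And>y k. y \<in> Y \<Longrightarrow> k \<in> K \<Longrightarrow> k \<circ> y \<in> Y) \<Longrightarrow> saturated_set Y"
  by (simp add: saturated_set_def)

lemma saturated_set_G: "saturated_set Y \<Longrightarrow> y \<in> Y \<Longrightarrow> y \<in> G"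
  by (auto simp: saturated_set_def)

lemma saturated_set_left: "saturated_set Y \<Longrightarrow> y \<in> Y \<Longrightarrow> k \<in> K \<Longrightarrow> k \<circ> y \<in> Y"
  by (auto simp: saturated_set_def)

lemma saturated_set_right:
  assumes "saturated_set Y" "y \<in> Y" "k \<in> K"
  shows "y \<circ> k \<in> Y"
proof -
  have y: "y \<in> G" by (rule saturated_set_G[OF assms(1,2)])
  have "(y \<circ> (k \<circ> ginv y)) \<circ> y \<in> Y"
    by (rule saturated_set_left[OF assms(1,2) normal[OF assms(3) y]])
  then show ?thesis by (simp add: comp_assoc ginv_comp_aut[OF G_aut[OF y]])
qed

text \<open>
  Closedness of a union of cosets of \<open>K\<close> does not depend on the small set on which it is tested.
\<close>

lemma saturated_set_closed_on:
  assumes "saturated_set Y" "closed_on S A Y" "Small A"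
  shows "closed_on S B Y"
proof (rule closed_on_support)
  show "B \<subseteq> A \<union> B" "Small (A \<union> B)" using assms(3) Small_B by (auto intro: Small_Un)
  show "closed_on S (A \<union> B) Y" using assms(2) by (rule closed_on_mono) simp
  show "h \<circ> x \<in> Y \<and> x \<circ> h \<in> Y" if "x \<in> Y" "h \<in> aut S" "\<And>z. z \<in> B \<Longrightarrow> h z = z" for x h
    using saturated_set_left[OF assms(1) that(1)] saturated_set_right[OF assms(1) that(1)]
      fixing[OF that(2,3)] by blast
qed

lemma \<pi>_mem_image:
  assumes "saturated_set Y" "g \<in> G"
  shows "\<pi> g \<in> \<pi> ` Y \<longleftrightarrow> g \<in> Y"
proof
  assume "\<pi> g \<in> \<pi> ` Y"
  then obtain y where y: "y \<in> Y" "\<pi> y = \<pi> g" by auto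
  have "y \<in> G" by (rule saturated_set_G[OF assms(1) y(1)])
  then obtain k where "k \<in> K" "g = k \<circ> y" using \<pi>[OF _ assms(2)] y(2) by blast
  then show "g \<in> Y" using saturated_set_left[OF assms(1) y(1)] by simp
qed simp

lemma saturated_preimage: "saturated_set {g \<in> G. \<pi> g \<in> C}"
proof (rule saturated_setI)
  fix y k assume y: "y \<in> {g \<in> G. \<pi> g \<in> C}" and k: "k \<in> K"
  have "k \<circ> y \<in> G" using y comp_G[OF K_G[OF k]] by blast
  moreover from this have "\<pi> y = \<pi> (k \<circ> y)" using \<pi> y k by blast
  ultimately show "k \<circ> y \<in> {g \<in> G. \<pi> g \<in> C}" using y by simp
qed auto

lemma closedin_image:
  assumes "saturated_set Y"
  shows "closedin X (\<pi> ` Y) \<longleftrightarrow> closed_on S B Y"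
proof -
  have "{g \<in> G. \<pi> g \<in> \<pi> ` Y} = Y"
    using \<pi>_mem_image[OF assms] saturated_set_G[OF assms] by blast
  moreover have "\<pi> ` Y \<subseteq> \<pi> ` G" using saturated_set_G[OF assms] by blast
  ultimately show ?thesis unfolding closedin_iff by simp
qed

lemma topspace_X: "topspace X = \<pi> ` G"
proof
  show "topspace X \<subseteq> \<pi> ` G" using closedin_iff[of "topspace X"] by simp
  have "saturated_set G" by (rule saturated_setI) (use comp_G K_G in blast)+
  then have "closedin X (\<pi> ` G)" using closedin_image closed_G by blast
  then show "\<pi> ` G \<subseteq> topspace X" by (rule closedin_subset)
qed

lemma
  assumes Y: "saturated_set Y" and g: "g \<in> G"
  shows saturated_translate: "saturated_set ((\<circ>) g ` Y)"
    and closed_translate: "closed_on S B Y \<Longrightarrow> closed_on S B ((\<circ>) g ` Y)"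
proof -
  show sat: "saturated_set ((\<circ>) g ` Y)"
  proof (rule saturated_setI)
    show "(\<circ>) g ` Y \<subseteq> G" using saturated_set_G[OF Y] comp_G[OF g] by blast
    fix y k assume "y \<in> (\<circ>) g ` Y" and k: "k \<in> K"
    then obtain y' where y': "y' \<in> Y" "y = g \<circ> y'" by blast
    have "ginv g \<circ> (k \<circ> g) \<in> K"
      using normal[OF k ginv_G[OF g]] by (simp only: ginv_ginv[OF G_aut[OF g]])
    then have "(ginv g \<circ> (k \<circ> g)) \<circ> y' \<in> Y" by (rule saturated_set_left[OF Y y'(1)])
    moreover have "k \<circ> y = g \<circ> ((ginv g \<circ> (k \<circ> g)) \<circ> y')"
      by (simp only: y'(2) comp_assoc aut_ginv_cancel[OF G_aut[OF g]])
    ultimately show "k \<circ> y \<in> (\<circ>) g ` Y" by blast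
  qed
  show "closed_on S B ((\<circ>) g ` Y)" if "closed_on S B Y"
    by (rule saturated_set_closed_on[OF sat closed_on_ltrans[OF that G_aut[OF g]]])
      (intro Small_Un Small_image Small_B)
qed

lemma saturated_ginv:
  assumes Y: "saturated_set Y"
  shows "saturated_set (ginv ` Y)"
proof (rule saturated_setI)
  show "ginv ` Y \<subseteq> G" using saturated_set_G[OF Y] ginv_G by blast
  fix y k assume "y \<in> ginv ` Y" and k: "k \<in> K"
  then obtain y' where y': "y' \<in> Y" "y = ginv y'" by blast
  have "y' \<circ> ginv k \<in> Y" by (rule saturated_set_right[OF Y y'(1) ginv_K[OF k]])
  moreover have "k \<circ> y = ginv (y' \<circ> ginv k)"
    using ginv_comp[OF G_aut[OF saturated_set_G[OF Y y'(1)]] inv_aut[OF K_aut[OF k]]]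
    by (simp only: y'(2) ginv_ginv[OF K_aut[OF k]])
  ultimately show "k \<circ> y \<in> ginv ` Y" by blast
qed

lemma saturated_diff:
  assumes Y: "saturated_set Y"
  shows "saturated_set (G - Y)"
proof (rule saturated_setI)
  fix y k assume y: "y \<in> G - Y" and k: "k \<in> K"
  have "k \<circ> y \<notin> Y"
  proof
    assume "k \<circ> y \<in> Y"
    then have "ginv k \<circ> (k \<circ> y) \<in> Y" by (rule saturated_set_left[OF Y _ ginv_K[OF k]])
    then show False using y by (simp only: ginv_aut_cancel[OF K_aut[OF k]]) blast
  qed
  then show "k \<circ> y \<in> G - Y" using y comp_G[OF K_G[OF k]] by blast
qed auto

lemma saturated_Int: "saturated_set Y \<Longrightarrow> saturated_set Z \<Longrightarrow> saturated_set (Y \<inter> Z)"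
  unfolding saturated_set_def by blast


subsection \<open>The closure of the trivial subgroup\<close>

definition closed_kernel :: "('m \<Rightarrow> 'm) set" where
  "closed_kernel = {f \<in> G. \<pi> f \<in> X closure_of {\<pi> id}}"

lemma closed_closed_kernel: "closed_on S B closed_kernel"
  using closedin_iff[of "X closure_of {\<pi> id}"] unfolding closed_kernel_def by simp

lemma saturated_closed_kernel: "saturated_set closed_kernel"
  unfolding closed_kernel_def by (rule saturated_preimage)

lemma id_closed_kernel: "id \<in> closed_kernel"
  using closure_of_subset[of "{\<pi> id}" X] id_G unfolding closed_kernel_def topspace_X by blast

lemma closed_kernel_minimal:
  assumes "saturated_set Y" "closed_on S B Y" "id \<in> Y"
  shows "closed_kernel \<subseteq> Y"
proof
  fix f assume f: "f \<in> closed_kernel"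
  have "X closure_of {\<pi> id} \<subseteq> \<pi> ` Y"
    by (rule closure_of_minimal) (use closedin_image[OF assms(1)] assms(2,3) in auto)
  then show "f \<in> Y" using f \<pi>_mem_image[OF assms(1)] unfolding closed_kernel_def by blast
qed

text \<open>
  The set of all \<open>h\<close> with \<open>y \<circ> h \<in> Y\<close> is a translate of \<open>Y\<close>, thus closed, and it contains the identity.
\<close>

lemma closed_kernel_right:
  assumes Y: "saturated_set Y" "closed_on S B Y" and y: "y \<in> Y" and h: "h \<in> closed_kernel"
  shows "y \<circ> h \<in> Y"
proof -
  have g: "y \<in> G" by (rule saturated_set_G[OF Y(1) y])
  have "id \<in> (\<circ>) (ginv y) ` Y" using y ginv_comp_aut[OF G_aut[OF g]] by (metis imageI)
  then have "closed_kernel \<subseteq> (\<circ>) (ginv y) ` Y"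
    by (intro closed_kernel_minimal saturated_translate closed_translate Y ginv_G g)
  then obtain y' where "y' \<in> Y" "h = ginv y \<circ> y'" using h by blast
  then show ?thesis by (simp add: aut_ginv_cancel[OF G_aut[OF g]])
qed

lemma aut_subgroup_closed_kernel: "aut_subgroup S closed_kernel"
  unfolding aut_subgroup_def
proof (intro conjI ballI)
  show "closed_kernel \<subseteq> aut S" by (rule closed_on_aut[OF closed_closed_kernel])
  show "id \<in> closed_kernel" by (rule id_closed_kernel)
  show "f \<circ> g \<in> closed_kernel" if "f \<in> closed_kernel" "g \<in> closed_kernel" for f g
    using saturated_closed_kernel closed_closed_kernel that by (rule closed_kernel_right)
  show "ginv f \<in> closed_kernel" if f: "f \<in> closed_kernel" for f
  proof -
    have "ginv id = id" using ginv_comp_aut[OF id_aut] by simp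
    then have "id \<in> ginv ` closed_kernel" using id_closed_kernel by (metis imageI)
    then have "closed_kernel \<subseteq> ginv ` closed_kernel"
      by (intro closed_kernel_minimal saturated_ginv closed_on_ginv saturated_closed_kernel
          closed_closed_kernel)
    then obtain g where g: "g \<in> closed_kernel" "f = ginv g" using f by blast
    then have "g \<in> aut S" using closed_on_aut[OF closed_closed_kernel] by blast
    with g show ?thesis by (simp add: ginv_ginv)
  qed
qed


subsection \<open>The connected component\<close>

definition component_kernel :: "('m \<Rightarrow> 'm) set" where
  "component_kernel = {f \<in> G. \<pi> f \<in> connected_component_of_set X (\<pi> id)}"

lemma saturated_component_kernel: "saturated_set component_kernel"
  unfolding component_kernel_def by (rule saturated_preimage)

lemma id_component_kernel: "id \<in> component_kernel"
  using id_G connected_component_of_refl[of X "\<pi> id"] by (simp add: component_kernel_def topspace_X)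

text \<open>
  This and the next lemma express connectedness in the quotient by closed unions of cosets in \<open>G\<close>, in order that
  quotients by different subgroups can be compared.
\<close>

lemma component_kernel_split:
  assumes E: "saturated_set E1" "closed_on S B E1" "saturated_set E2" "closed_on S B E2"
    and cover: "component_kernel \<subseteq> E1 \<union> E2" and disj: "E1 \<inter> E2 \<inter> component_kernel = {}"
  shows "E1 \<inter> component_kernel = {} \<or> E2 \<inter> component_kernel = {}"
proof (rule ccontr)
  assume ne: "\<not> ?thesis"
  define C where "C = connected_component_of_set X (\<pi> id)"
  have C: "f \<in> component_kernel \<longleftrightarrow> \<pi> f \<in> C" if "f \<in> G" for f
    using that by (simp add: component_kernel_def C_def)
  have CG: "C \<subseteq> \<pi> ` G"
    using connectedin_subset_topspace[OF connectedin_connected_component_of[of X "\<pi> id"]]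
    by (simp add: C_def topspace_X)
  have "C \<subseteq> \<pi> ` E1 \<union> \<pi> ` E2" using CG C cover by blast
  moreover have "\<pi> ` E1 \<inter> \<pi> ` E2 \<inter> C = {}"
  proof (rule ccontr)
    assume "\<pi> ` E1 \<inter> \<pi> ` E2 \<inter> C \<noteq> {}"
    then obtain c where c: "c \<in> C" "c \<in> \<pi> ` E1" "c \<in> \<pi> ` E2" by auto
    then obtain f where f: "f \<in> G" "c = \<pi> f" using CG by auto
    have "f \<in> E1" "f \<in> E2" using c(2,3) unfolding f(2) \<pi>_mem_image[OF E(1) f(1)] \<pi>_mem_image[OF E(3) f(1)] by simp_all
    moreover have "f \<in> component_kernel" using C[OF f(1)] c(1) f(2) by simp
    ultimately have "f \<in> E1 \<inter> E2 \<inter> component_kernel" by simp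
    then show False using disj by blast
  qed
  moreover have "\<pi> ` E1 \<inter> C \<noteq> {}" "\<pi> ` E2 \<inter> C \<noteq> {}"
    using ne unfolding component_kernel_def C_def by blast+
  moreover have "closedin X (\<pi> ` E1)" "closedin X (\<pi> ` E2)" using E closedin_image by blast+
  moreover have "connectedin X C" unfolding C_def by (rule connectedin_connected_component_of)
  ultimately show False unfolding connectedin_closedin by blast
qed

lemma subset_component_kernel:
  assumes Y: "Y \<subseteq> G" "id \<in> Y"
    and split: "\<And>E1 E2. saturated_set E1 \<Longrightarrow> closed_on S B E1 \<Longrightarrow> saturated_set E2 \<Longrightarrow>
      closed_on S B E2 \<Longrightarrow> Y \<subseteq> E1 \<union> E2 \<Longrightarrow> E1 \<inter> E2 \<inter> Y = {} \<Longrightarrow> E1 \<inter> Y = {} \<or> E2 \<inter> Y = {}"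
  shows "Y \<subseteq> component_kernel"
proof -
  have "connectedin X (\<pi> ` Y)"
    unfolding connectedin_closedin
  proof (intro conjI notI)
    show "\<pi> ` Y \<subseteq> topspace X" using Y(1) by (auto simp: topspace_X)
    assume "\<exists>E1 E2. closedin X E1 \<and> closedin X E2 \<and> \<pi> ` Y \<subseteq> E1 \<union> E2 \<and> E1 \<inter> E2 \<inter> \<pi> ` Y = {} \<and>
      E1 \<inter> \<pi> ` Y \<noteq> {} \<and> E2 \<inter> \<pi> ` Y \<noteq> {}"
    then obtain E1 E2 where E: "closedin X E1" "closedin X E2" "\<pi> ` Y \<subseteq> E1 \<union> E2"
      "E1 \<inter> E2 \<inter> \<pi> ` Y = {}" "E1 \<inter> \<pi> ` Y \<noteq> {}" "E2 \<inter> \<pi> ` Y \<noteq> {}" by blast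
    have "{g \<in> G. \<pi> g \<in> E1} \<inter> Y = {} \<or> {g \<in> G. \<pi> g \<in> E2} \<inter> Y = {}"
    proof (rule split)
      show "closed_on S B {g \<in> G. \<pi> g \<in> E1}" "closed_on S B {g \<in> G. \<pi> g \<in> E2}"
        using E(1,2) closedin_iff by blast+
    qed (use E(3,4) Y(1) in \<open>auto intro: saturated_preimage\<close>)
    then show False using E(5,6) Y(1) by blast
  qed
  moreover have "\<pi> id \<in> \<pi> ` Y" using Y(2) by blast
  ultimately have "\<pi> ` Y \<subseteq> connected_component_of_set X (\<pi> id)"
    by (rule connected_component_of_maximal)
  then show ?thesis using Y(1) unfolding component_kernel_def by blast
qed

lemma component_kernel_subset_clopen:
  assumes "saturated_set Y" "closed_on S B Y" "closed_on S B (G - Y)" "id \<in> Y"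
  shows "component_kernel \<subseteq> Y"
proof -
  have sub: "component_kernel \<subseteq> Y \<union> (G - Y)" unfolding component_kernel_def by blast
  have disj: "Y \<inter> (G - Y) \<inter> component_kernel = {}" by blast
  have "Y \<inter> component_kernel \<noteq> {}" using assms(4) id_component_kernel by blast
  then have "(G - Y) \<inter> component_kernel = {}"
    using component_kernel_split[OF assms(1,2) saturated_diff[OF assms(1)] assms(3) sub disj] by blast
  then show ?thesis using sub by blast
qed


subsection \<open>Open subgroups\<close>

definition open_subgroup :: "('m \<Rightarrow> 'm) set \<Rightarrow> bool" where
  "open_subgroup U \<longleftrightarrow> aut_subgroup S U \<and> saturated_set U \<and> closed_on S B U \<and> closed_on S B (G - U)"

lemma open_subgroup_G: "open_subgroup G"
proof -
  have "closed_on S B {}" using closed_on_Union_finite[of "{}" S B] by simp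
  moreover have "saturated_set G" by (rule saturated_setI) (use comp_G K_G in blast)+
  ultimately show ?thesis using G closed_G by (simp add: open_subgroup_def)
qed

lemma open_subgroup_Int:
  assumes "open_subgroup U" "open_subgroup V"
  shows "open_subgroup (U \<inter> V)"
proof -
  have "G - U \<inter> V = (G - U) \<union> (G - V)" by blast
  then have "closed_on S B (G - U \<inter> V)"
    using assms unfolding open_subgroup_def by (simp add: closed_on_Un)
  moreover have "aut_subgroup S (U \<inter> V)"
    using assms unfolding open_subgroup_def aut_subgroup_def by blast
  ultimately show ?thesis
    using assms saturated_Int closed_on_Int unfolding open_subgroup_def by blast
qed

text \<open>
  Cosets of an open subgroup are open, hence finitely many cover the group by compactness.
\<close>

lemma open_subgroup_finite_index:
  assumes U: "open_subgroup U"
  shows "finite ((\<lambda>g. (\<circ>) g ` U) ` G)"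
proof (rule ccontr)
  assume inf: "\<not> ?thesis"
  define \<C> where "\<C> = (\<lambda>g. (\<circ>) g ` U) ` G"
  define \<X> where "\<X> = {G - \<Union>F | F. finite F \<and> F \<subseteq> \<C>}"
  have sat: "saturated_set U" and cl: "closed_on S B (G - U)" and id: "id \<in> U"
    using U by (auto simp: open_subgroup_def aut_subgroup_def)
  have compl: "closed_on S B (G - Y)" if Y: "Y \<in> \<C>" for Y
  proof -
    obtain g where g: "g \<in> G" "Y = (\<circ>) g ` U" using Y unfolding \<C>_def by blast
    have "G - Y = (\<circ>) g ` (G - U)"
    proof (intro equalityI subsetI)
      fix f assume f: "f \<in> G - Y"
      have fg: "f = g \<circ> (ginv g \<circ> f)" by (simp add: aut_ginv_cancel[OF G_aut[OF g(1)]])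
      then have "ginv g \<circ> f \<notin> U" using f g(2) by blast
      moreover have "ginv g \<circ> f \<in> G" using f ginv_G[OF g(1)] comp_G by blast
      ultimately show "f \<in> (\<circ>) g ` (G - U)" using fg by blast
    next
      fix f assume "f \<in> (\<circ>) g ` (G - U)"
      then obtain u where u: "u \<in> G - U" "f = g \<circ> u" by blast
      have "f \<notin> Y"
      proof
        assume "f \<in> Y"
        then obtain v where "v \<in> U" "g \<circ> v = g \<circ> u" using g(2) u(2) by blast
        then have "u \<in> U" using ginv_aut_cancel[OF G_aut[OF g(1)]] by metis
        then show False using u(1) by blast
      qed
      then show "f \<in> G - Y" using u comp_G[OF g(1)] by blast
    qed
    then show ?thesis using closed_translate[OF saturated_diff[OF sat] g(1) cl] by simp
  qed
  have "\<Inter>\<X> \<noteq> {}"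
  proof (rule closed_on_compact[OF Small_B])
    show "\<X> \<noteq> {}" by (auto simp: \<X>_def)
  next
    fix Z assume "Z \<in> \<X>"
    then obtain F where F: "finite F" "F \<subseteq> \<C>" "Z = G - \<Union>F" unfolding \<X>_def by blast
    show "Z \<noteq> {}"
    proof
      assume "Z = {}"
      have "\<C> \<subseteq> F"
      proof
        fix Y assume Y: "Y \<in> \<C>"
        then obtain g where g: "g \<in> G" "Y = (\<circ>) g ` U" unfolding \<C>_def by blast
        then obtain Y' where Y': "g \<in> Y'" "Y' \<in> F" using F(3) \<open>Z = {}\<close> by blast
        then obtain g' where g': "g' \<in> G" "Y' = (\<circ>) g' ` U" using F(2) unfolding \<C>_def by blast
        then obtain u where u: "u \<in> U" "g = g' \<circ> u" using Y' by blast
        have ua: "u \<in> aut S" using G_aut saturated_set_G[OF sat u(1)] by blast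
        have "Y = Y'"
        proof (intro equalityI subsetI)
          fix f assume "f \<in> Y"
          then obtain v where v: "v \<in> U" "f = g \<circ> v" using g(2) by blast
          then have "f = g' \<circ> (u \<circ> v)" using u(2) by (simp add: comp_assoc)
          moreover have "u \<circ> v \<in> U" using U u(1) v(1) by (auto simp: open_subgroup_def aut_subgroup_def)
          ultimately show "f \<in> Y'" using g'(2) by blast
        next
          fix f assume "f \<in> Y'"
          then obtain v where v: "v \<in> U" "f = g' \<circ> v" using g'(2) by blast
          then have "f = g \<circ> (ginv u \<circ> v)" using u(2) by (simp add: comp_assoc aut_ginv_cancel[OF ua])
          moreover have "ginv u \<circ> v \<in> U"
            using U u(1) v(1) by (auto simp: open_subgroup_def aut_subgroup_def)
          ultimately show "f \<in> Y" using g(2) by blast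
        qed
        then show "Y \<in> F" using Y' by simp
      qed
      then show False using F(1) inf finite_subset unfolding \<C>_def by blast
    qed
    have "closed_on S B (\<Inter> (insert G ((\<lambda>Y. G - Y) ` F)))"
      by (rule closed_on_Inter) (use compl F(2) closed_G in auto)
    moreover have "\<Inter> (insert G ((\<lambda>Y. G - Y) ` F)) = Z" using F(3) by blast
    ultimately show "closed_on S B Z" by simp
  next
    fix Z Z' assume "Z \<in> \<X>" "Z' \<in> \<X>"
    then obtain F F' where F: "finite F" "F \<subseteq> \<C>" "Z = G - \<Union>F" "finite F'" "F' \<subseteq> \<C>" "Z' = G - \<Union>F'"
      unfolding \<X>_def by blast
    then have "G - \<Union>(F \<union> F') \<in> \<X>" unfolding \<X>_def by blast
    moreover have "G - \<Union>(F \<union> F') \<subseteq> Z \<inter> Z'" using F by blast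
    ultimately show "\<exists>W\<in>\<X>. W \<subseteq> Z \<inter> Z'" by blast
  qed
  then obtain g where g: "\<And>Z. Z \<in> \<X> \<Longrightarrow> g \<in> Z" by blast
  have "G - \<Union>{} \<in> \<X>" unfolding \<X>_def by blast
  then have gG: "g \<in> G" using g by blast
  then have "G - \<Union>{(\<circ>) g ` U} \<in> \<X>" unfolding \<X>_def \<C>_def by blast
  from g[OF this] have "g \<notin> (\<circ>) g ` U" by blast
  moreover have "g \<in> (\<circ>) g ` U" using id by (auto intro!: image_eqI[of _ _ id])
  ultimately show False by contradiction
qed

text \<open>
  The complement is a finite union of cosets, which are closed.
\<close>

lemma finite_index_open:
  assumes Y: "aut_subgroup S Y" "saturated_set Y" "closed_on S B Y"
    and fin: "finite ((\<lambda>g. (\<circ>) g ` Y) ` G)"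
  shows "closed_on S B (G - Y)"
proof -
  define F where "F = (\<lambda>g. (\<circ>) g ` Y) ` (G - Y)"
  have "F \<subseteq> (\<lambda>g. (\<circ>) g ` Y) ` G" unfolding F_def by blast
  then have "finite F" using fin by (rule finite_subset)
  then have "closed_on S B (\<Union>F)"
    by (rule closed_on_Union_finite) (use closed_translate[OF Y(2) _ Y(3)] in \<open>auto simp: F_def\<close>)
  moreover have "\<Union>F = G - Y"
  proof (intro equalityI subsetI)
    fix f assume "f \<in> \<Union>F"
    then obtain g y where g: "g \<in> G - Y" "y \<in> Y" "f = g \<circ> y" unfolding F_def by blast
    have "f \<notin> Y"
    proof
      assume "f \<in> Y"
      then have "f \<circ> ginv y \<in> Y" by (intro aut_subgroup_comp[OF Y(1)] aut_subgroup_ginv[OF Y(1)] g(2))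
      then show False
        using g by (simp add: comp_assoc aut_comp_ginv[OF aut_subgroup_aut[OF Y(1) g(2)]])
    qed
    then show "f \<in> G - Y" using g comp_G saturated_set_G[OF Y(2)] by blast
  next
    fix f assume "f \<in> G - Y"
    moreover have "f \<in> (\<circ>) f ` Y" using aut_subgroup_id[OF Y(1)] by (auto intro!: image_eqI[of _ _ id])
    ultimately show "f \<in> \<Union>F" unfolding F_def by blast
  qed
  ultimately show ?thesis by simp
qed

end


context galois_quotient
begin

text \<open>
  The open subgroup is the stabilizer of \<open>W\<^sub>1\<close> under left multiplication. It is open because an
  element \<open>p\<close> of \<open>U\<close> moves a point of \<open>W\<^sub>1\<close> out of \<open>W\<^sub>1\<close> only if it is in the
  product of \<open>W\<^sub>2\<close> with the inverses of \<open>W\<^sub>1\<close>, which is closed.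
\<close>

lemma open_subgroup_in_clopen:
  assumes U: "open_subgroup U" and sat1: "saturated_set W1" and cl1: "closed_on S B W1"
    and cl2: "closed_on S B W2" and W: "W1 \<union> W2 = U" "W1 \<inter> W2 = {}" "id \<in> W1"
  obtains U' where "open_subgroup U'" "U' \<subseteq> W1"
proof -
  have Ug: "aut_subgroup S U" and Usat: "saturated_set U" and Ucl: "closed_on S B U" "closed_on S B (G - U)"
    using U by (auto simp: open_subgroup_def)
  have Ua: "p \<in> aut S" if "p \<in> U" for p using aut_subgroup_aut[OF Ug that] .
  have WU: "w \<in> U" if "w \<in> W1" for w using that W(1) by blast
  define U' where "U' = {p \<in> U. (\<forall>w\<in>W1. p \<circ> w \<in> W1) \<and> (\<forall>w\<in>W1. ginv p \<circ> w \<in> W1)}"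
  \<comment> \<open>\<open>D\<close> consists of all \<open>p\<close> whose inverse maps \<open>W\<^sub>1\<close> into itself: \<open>p\<inverse> \<circ> w = v\<close> means \<open>p = w \<circ> v\<inverse>\<close>.\<close>
  define D where "D = \<Inter> ((\<lambda>w. (\<circ>) w ` ginv ` W1) ` W1)"
  define Q where "Q = {x \<circ> y | x y. x \<in> W2 \<and> y \<in> ginv ` W1}"
  have D: "p \<in> D \<longleftrightarrow> (\<forall>w\<in>W1. ginv p \<circ> w \<in> W1)" if p: "p \<in> aut S" for p
  proof -
    have "p \<in> (\<circ>) w ` ginv ` W1 \<longleftrightarrow> ginv p \<circ> w \<in> W1" if w: "w \<in> W1" for w
    proof
      assume "p \<in> (\<circ>) w ` ginv ` W1"
      then obtain v where v: "v \<in> W1" "p = w \<circ> ginv v" by blast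
      have "ginv p = v \<circ> ginv w"
        unfolding v(2) using ginv_comp[OF Ua[OF WU[OF w]] inv_aut[OF Ua[OF WU[OF v(1)]]]]
        by (simp add: ginv_ginv[OF Ua[OF WU[OF v(1)]]])
      then show "ginv p \<circ> w \<in> W1" using v(1) by (simp add: comp_assoc ginv_comp_aut[OF Ua[OF WU[OF w]]])
    next
      assume v: "ginv p \<circ> w \<in> W1"
      have "ginv (ginv p \<circ> w) = ginv w \<circ> p"
        using ginv_comp[OF inv_aut[OF p] Ua[OF WU[OF w]]] by (simp add: ginv_ginv[OF p])
      then have "p = w \<circ> ginv (ginv p \<circ> w)" by (simp add: aut_ginv_cancel[OF Ua[OF WU[OF w]]])
      then show "p \<in> (\<circ>) w ` ginv ` W1" using v by blast
    qed
    then show ?thesis unfolding D_def by blast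
  qed
  have clD: "closed_on S B D"
    unfolding D_def
  proof (rule closed_on_Inter)
    show "(\<lambda>w. (\<circ>) w ` ginv ` W1) ` W1 \<noteq> {}" using W(3) by blast
    fix Y assume "Y \<in> (\<lambda>w. (\<circ>) w ` ginv ` W1) ` W1"
    then obtain w where w: "w \<in> W1" "Y = (\<circ>) w ` ginv ` W1" by blast
    show "closed_on S B Y"
      unfolding w(2) by (intro closed_translate saturated_ginv closed_on_ginv sat1 cl1
          saturated_set_G[OF sat1 w(1)])
  qed
  have mem_ginv: "p \<in> ginv ` Y \<longleftrightarrow> ginv p \<in> Y" if "p \<in> aut S" "Y \<subseteq> aut S" for p Y
  proof
    assume "p \<in> ginv ` Y"
    then obtain y where "y \<in> Y" "p = ginv y" by blast
    then show "ginv p \<in> Y" using ginv_ginv[of y S] that(2) by auto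
  next
    assume "ginv p \<in> Y"
    moreover have "p = ginv (ginv p)" by (simp add: ginv_ginv[OF that(1)])
    ultimately show "p \<in> ginv ` Y" by (metis imageI)
  qed
  have "U' = U \<inter> (D \<inter> ginv ` D)"
  proof -
    have "p \<in> ginv ` D \<longleftrightarrow> (\<forall>w\<in>W1. p \<circ> w \<in> W1)" if p: "p \<in> U" for p
      using mem_ginv[OF Ua[OF p] closed_on_aut[OF clD]] D[OF inv_aut[OF Ua[OF p]]]
      by (simp add: ginv_ginv[OF Ua[OF p]])
    then show ?thesis using D Ua unfolding U'_def by blast
  qed
  then have cl': "closed_on S B U'" using Ucl(1) clD by (simp add: closed_on_Int closed_on_ginv)
  have W2U: "w \<in> U" if "w \<in> W2" for w using that W(1) by blast
  have clQ: "closed_on S B Q" unfolding Q_def by (intro closed_on_mult Small_B cl2 closed_on_ginv cl1)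
  have Q: "p \<in> Q \<longleftrightarrow> (\<exists>w\<in>W1. p \<circ> w \<notin> W1)" if p: "p \<in> U" for p
  proof
    assume "p \<in> Q"
    then obtain x w where x: "x \<in> W2" "w \<in> W1" "p = x \<circ> ginv w" unfolding Q_def by blast
    then have "p \<circ> w = x" by (simp add: comp_assoc ginv_comp_aut[OF Ua[OF WU[OF x(2)]]])
    then show "\<exists>w\<in>W1. p \<circ> w \<notin> W1" using x W(2) by blast
  next
    assume "\<exists>w\<in>W1. p \<circ> w \<notin> W1"
    then obtain w where w: "w \<in> W1" "p \<circ> w \<notin> W1" by blast
    then have "p \<circ> w \<in> W2" using aut_subgroup_comp[OF Ug p WU[OF w(1)]] W(1) by blast
    moreover have "p = (p \<circ> w) \<circ> ginv w" by (simp add: comp_assoc aut_comp_ginv[OF Ua[OF WU[OF w(1)]]])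
    ultimately show "p \<in> Q" unfolding Q_def using w(1) by blast
  qed
  have "G - U' = (G - U) \<union> (U \<inter> (Q \<union> ginv ` Q))"
  proof -
    have "p \<in> ginv ` Q \<longleftrightarrow> (\<exists>w\<in>W1. ginv p \<circ> w \<notin> W1)" if p: "p \<in> U" for p
      using mem_ginv[OF Ua[OF p] closed_on_aut[OF clQ]] Q[OF aut_subgroup_ginv[OF Ug p]] by simp
    then show ?thesis using Q saturated_set_G[OF Usat] unfolding U'_def by blast
  qed
  then have cl'': "closed_on S B (G - U')"
    using Ucl clQ by (simp add: closed_on_Int closed_on_Un closed_on_ginv)
  have "aut_subgroup S U'"
    unfolding aut_subgroup_def
  proof (intro conjI ballI)
    show "U' \<subseteq> aut S" by (rule closed_on_aut[OF cl'])
    have "ginv id = id" using ginv_comp_aut[OF id_aut] by simp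
    then show "id \<in> U'" using aut_subgroup_id[OF Ug] by (simp add: U'_def)
    show "f \<circ> g \<in> U'" if "f \<in> U'" "g \<in> U'" for f g
      using that aut_subgroup_comp[OF Ug] ginv_comp[OF Ua Ua] by (simp add: U'_def comp_assoc)
    show "ginv f \<in> U'" if "f \<in> U'" for f
      using that aut_subgroup_ginv[OF Ug] ginv_ginv[OF Ua] by (simp add: U'_def)
  qed
  moreover have "saturated_set U'"
  proof (rule saturated_setI)
    show "U' \<subseteq> G" using saturated_set_G[OF Usat] unfolding U'_def by blast
    fix p k assume p: "p \<in> U'" and k: "k \<in> K"
    have "k \<in> U" using saturated_set_left[OF Usat aut_subgroup_id[OF Ug] k] by simp
    then have "k \<in> U'"
      unfolding U'_def using saturated_set_left[OF sat1 _ k] saturated_set_left[OF sat1 _ ginv_K[OF k]] by blast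
    then show "k \<circ> p \<in> U'" using aut_subgroup_comp[OF \<open>aut_subgroup S U'\<close> _ p] by blast
  qed
  ultimately have "open_subgroup U'" using cl' cl'' by (simp add: open_subgroup_def)
  moreover have "U' \<subseteq> W1"
  proof
    fix p assume "p \<in> U'"
    then have "p \<circ> id \<in> W1" using W(3) unfolding U'_def by blast
    then show "p \<in> W1" by simp
  qed
  ultimately show thesis by (rule that)
qed

text \<open>
  In a compact group the component of the identity is the intersection of the open subgroups. The proof of this is carried out
  in \<open>G\<close>: if closed sets \<open>E\<^sub>1\<close> and \<open>E\<^sub>2\<close> split the intersection \<open>P\<close> of the open
  subgroups, a formula separates the two parts. The products of the formula and of its negation with the closure of
  the trivial subgroup are closed in the quotient, cover it, and do not meet within \<open>P\<close>; by compactness they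
  do not meet within some open subgroup \<open>U\<close> already. So \<open>U\<close> is split into
  clopen sets, and the one with the identity contains an open subgroup, hence \<open>P\<close>, so that the other part of \<open>P\<close> is empty.
\<close>

lemma Inter_open_subgroups: "\<Inter>{U. open_subgroup U} \<subseteq> component_kernel"
proof (rule subset_component_kernel)
  define P where "P = \<Inter>{U. open_subgroup U}"
  have PU: "P \<subseteq> U" if "open_subgroup U" for U using that unfolding P_def by blast
  have clP: "closed_on S B P"
    unfolding P_def by (rule closed_on_Inter) (use open_subgroup_G in \<open>auto simp: open_subgroup_def\<close>)
  have satP: "saturated_set P"
    using PU[OF open_subgroup_G] unfolding saturated_set_def P_def open_subgroup_def by blast
  have id_P: "id \<in> P" unfolding P_def open_subgroup_def aut_subgroup_def by blast
  show "\<Inter>{U. open_subgroup U} \<subseteq> G" using PU[OF open_subgroup_G] unfolding P_def .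
  show "id \<in> \<Inter>{U. open_subgroup U}" using id_P unfolding P_def .
  have main: "E2 \<inter> P = {}"
    if E: "saturated_set E1" "closed_on S B E1" "saturated_set E2" "closed_on S B E2"
      and cover: "P \<subseteq> E1 \<union> E2" and disj: "E1 \<inter> E2 \<inter> P = {}" and id1: "id \<in> E1" for E1 E2
  proof (rule ccontr)
    assume ne: "E2 \<inter> P \<noteq> {}"
    define P1 where "P1 = E1 \<inter> P"
    define P2 where "P2 = E2 \<inter> P"
    have P12: "saturated_set P1" "closed_on S B P1" "saturated_set P2" "closed_on S B P2"
      unfolding P1_def P2_def using E clP satP by (simp_all add: saturated_Int closed_on_Int)
    have "P1 \<inter> P2 = {}" using disj unfolding P1_def P2_def by blast
    then obtain \<Phi> where \<Phi>: "definable S ({0, 1} \<times> B) \<Phi>" "\<And>x. x \<in> P1 \<Longrightarrow> \<Phi> (case_prod (seq2 id x))"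
      "\<And>y. y \<in> P2 \<Longrightarrow> \<not> \<Phi> (case_prod (seq2 id y))"
      by (rule closed_on_separate[OF Small_B P12(2,4)]) (rule that)
    define D1 where "D1 = {g \<in> aut S. \<Phi> (case_prod (seq2 id g))}"
    define D2 where "D2 = {g \<in> aut S. \<not> \<Phi> (case_prod (seq2 id g))}"
    define C1 where "C1 = {x \<circ> h | x h. x \<in> D1 \<and> h \<in> closed_kernel}"
    define C2 where "C2 = {x \<circ> h | x h. x \<in> D2 \<and> h \<in> closed_kernel}"
    have clC: "closed_on S B C1" "closed_on S B C2"
      unfolding C1_def C2_def D1_def D2_def
      by (intro closed_on_mult Small_B closed_closed_kernel closed_on_definable definable_not \<Phi>(1))+
    have G_C: "G \<subseteq> C1 \<union> C2"
    proof
      fix g assume g: "g \<in> G"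
      have "g = g \<circ> id" by simp
      moreover have "g \<in> D1 \<or> g \<in> D2" unfolding D1_def D2_def using G_aut[OF g] by blast
      ultimately show "g \<in> C1 \<union> C2" unfolding C1_def C2_def using id_closed_kernel by blast
    qed
    have factor: "x \<in> Y" if Y: "saturated_set Y" "closed_on S B Y" and h: "h \<in> closed_kernel"
      and xh: "x \<circ> h \<in> Y" for Y x h
    proof -
      have "(x \<circ> h) \<circ> ginv h \<in> Y"
        using Y xh aut_subgroup_ginv[OF aut_subgroup_closed_kernel h] by (rule closed_kernel_right)
      then show ?thesis
        by (simp add: comp_assoc aut_comp_ginv[OF aut_subgroup_aut[OF aut_subgroup_closed_kernel h]])
    qed
    have C1P2: "C1 \<inter> P2 = {}"
    proof (rule ccontr)
      assume "C1 \<inter> P2 \<noteq> {}"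
      then obtain x h where "x \<in> D1" "h \<in> closed_kernel" "x \<circ> h \<in> P2" unfolding C1_def by blast
      then have "x \<in> P2" "x \<in> D1" using factor[OF P12(3,4)] by blast+
      then show False using \<Phi>(3)[of x] unfolding D1_def by blast
    qed
    have C2P1: "C2 \<inter> P1 = {}"
    proof (rule ccontr)
      assume "C2 \<inter> P1 \<noteq> {}"
      then obtain x h where "x \<in> D2" "h \<in> closed_kernel" "x \<circ> h \<in> P1" unfolding C2_def by blast
      then have "x \<in> P1" "x \<in> D2" using factor[OF P12(1,2)] by blast+
      then show False using \<Phi>(2)[of x] unfolding D2_def by blast
    qed
    have "\<exists>U. open_subgroup U \<and> U \<inter> (C1 \<inter> C2) = {}"
    proof (rule ccontr)
      assume no: "\<not> ?thesis"
      have "\<Inter> ((\<lambda>U. U \<inter> (C1 \<inter> C2)) ` {U. open_subgroup U}) \<noteq> {}"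
      proof (rule closed_on_compact[OF Small_B])
        show "(\<lambda>U. U \<inter> (C1 \<inter> C2)) ` {U. open_subgroup U} \<noteq> {}" using open_subgroup_G by blast
        show "closed_on S B Z" if "Z \<in> (\<lambda>U. U \<inter> (C1 \<inter> C2)) ` {U. open_subgroup U}" for Z
          using that clC by (auto simp: open_subgroup_def intro!: closed_on_Int)
        show "Z \<noteq> {}" if "Z \<in> (\<lambda>U. U \<inter> (C1 \<inter> C2)) ` {U. open_subgroup U}" for Z
          using that no by blast
        fix Z Z' assume "Z \<in> (\<lambda>U. U \<inter> (C1 \<inter> C2)) ` {U. open_subgroup U}"
          "Z' \<in> (\<lambda>U. U \<inter> (C1 \<inter> C2)) ` {U. open_subgroup U}"
        then obtain U U' where "open_subgroup U" "Z = U \<inter> (C1 \<inter> C2)" "open_subgroup U'" "Z' = U' \<inter> (C1 \<inter> C2)"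
          by blast
        then show "\<exists>W\<in>(\<lambda>U. U \<inter> (C1 \<inter> C2)) ` {U. open_subgroup U}. W \<subseteq> Z \<inter> Z'"
          using open_subgroup_Int[of U U'] by (intro bexI[of _ "(U \<inter> U') \<inter> (C1 \<inter> C2)"]) auto
      qed
      then obtain g where "g \<in> P" "g \<in> C1" "g \<in> C2" using open_subgroup_G unfolding P_def by blast
      moreover have "g \<in> P1 \<or> g \<in> P2" using \<open>g \<in> P\<close> cover unfolding P1_def P2_def by blast
      ultimately show False using C1P2 C2P1 by blast
    qed
    then obtain U where U: "open_subgroup U" "U \<inter> (C1 \<inter> C2) = {}" by blast
    have Usat: "saturated_set U" and Ucl: "closed_on S B U" using U(1) by (auto simp: open_subgroup_def)
    have satW: "saturated_set (U \<inter> C1)"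
    proof (rule saturated_setI)
      show "U \<inter> C1 \<subseteq> G" using saturated_set_G[OF Usat] by blast
      fix y k assume y: "y \<in> U \<inter> C1" and k: "k \<in> K"
      then obtain x h where xh: "y = x \<circ> h" "x \<in> D1" "h \<in> closed_kernel" unfolding C1_def by blast
      have yG: "y \<in> G" using saturated_set_G[OF Usat] y by blast
      define k' where "k' = ginv y \<circ> (k \<circ> y)"
      have "k' \<in> K"
        using normal[OF k ginv_G[OF yG]] by (simp add: k'_def ginv_ginv[OF G_aut[OF yG]])
      then have "h \<circ> k' \<in> closed_kernel" by (rule saturated_set_right[OF saturated_closed_kernel xh(3)])
      moreover have "k \<circ> y = x \<circ> (h \<circ> k')"
        unfolding k'_def o_assoc xh(1)[symmetric] aut_comp_ginv[OF G_aut[OF yG]] id_o ..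
      ultimately have "k \<circ> y \<in> C1" using xh(2) unfolding C1_def by blast
      then show "k \<circ> y \<in> U \<inter> C1" using saturated_set_left[OF Usat _ k] y by blast
    qed
    have "id \<in> C1"
    proof -
      have "id \<in> P1" using id1 id_P unfolding P1_def by blast
      then show ?thesis using G_C id_G C2P1 by blast
    qed
    moreover have "id \<in> U" using U(1) by (simp add: open_subgroup_def aut_subgroup_def)
    moreover have "U \<inter> C1 \<union> U \<inter> C2 = U" "(U \<inter> C1) \<inter> (U \<inter> C2) = {}"
      using G_C U(2) saturated_set_G[OF Usat] by blast+
    ultimately obtain U' where "open_subgroup U'" "U' \<subseteq> U \<inter> C1"
      using open_subgroup_in_clopen[OF U(1) satW closed_on_Int[OF Ucl clC(1)] closed_on_Int[OF Ucl clC(2)]]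
      by blast
    then have "P \<subseteq> C1" using PU by blast
    then show False using C1P2 ne unfolding P2_def by blast
  qed
  show "E1 \<inter> \<Inter>{U. open_subgroup U} = {} \<or> E2 \<inter> \<Inter>{U. open_subgroup U} = {}"
    if E: "saturated_set E1" "closed_on S B E1" "saturated_set E2" "closed_on S B E2"
      "\<Inter>{U. open_subgroup U} \<subseteq> E1 \<union> E2" "E1 \<inter> E2 \<inter> \<Inter>{U. open_subgroup U} = {}" for E1 E2
  proof -
    note E' = E[folded P_def]
    have "id \<in> E1 \<or> id \<in> E2" using E'(5) id_P by blast
    then show ?thesis
    proof
      assume "id \<in> E1"
      then show ?thesis using main[OF E'] unfolding P_def by blast
    next
      assume id2: "id \<in> E2"
      have "P \<subseteq> E2 \<union> E1" "E2 \<inter> E1 \<inter> P = {}" using E'(5,6) by blast+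
      from main[OF E'(3,4,1,2) this id2] show ?thesis unfolding P_def by blast
    qed
  qed
qed

end


section \<open>Hyperimaginaries and their stabilizers\<close>

lemma act_comp: "act (f \<circ> g) a = act f (act g a)"
  by (simp add: act_def option.map_comp)

lemma act_id: "act id a = a"
  by (simp add: act_def option.map_id)

lemma dom_act: "dom (act f a) = dom a"
  by (auto simp: act_def dom_def)

lemma act_eq_iff: "act f a = act g a \<longleftrightarrow> (\<forall>x\<in>ran a. f x = g x)"
proof
  assume eq: "act f a = act g a"
  show "\<forall>x\<in>ran a. f x = g x"
  proof
    fix x assume "x \<in> ran a"
    then obtain i where "a i = Some x" by (auto simp: ran_def)
    then show "f x = g x" using fun_cong[OF eq, of i] by (simp add: act_def)
  qed
next
  assume eq: "\<forall>x\<in>ran a. f x = g x"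
  have "map_option f (a i) = map_option g (a i)" for i
    using eq by (cases "a i") (auto simp: ran_def)
  then show "act f a = act g a" by (simp add: act_def)
qed

lemma holds_act:
  assumes "f \<in> aut S" "\<phi> \<in> formulas S (I <+> J)" "dom a = I" "dom b = J"
  shows "holds S (case_sum (act f a) (act f b)) \<phi> = holds S (case_sum a b) \<phi>"
proof -
  define s where "s = case_sum (\<lambda>n :: nat. undefined) (\<lambda>i. the (case_sum a b i))"
  have wf: "wf_fm S \<phi>" and fv: "fv \<phi> \<subseteq> Inr ` (I <+> J)"
    using assms(2) by (auto simp: formulas_def)
  have "holds S (case_sum (act f a) (act f b)) \<phi> = sat S UNIV (\<lambda>w. f (s w)) \<phi>"
    unfolding holds_def
  proof (rule sat_cong)
    fix v assume "v \<in> fv \<phi>"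
    then obtain i where i: "v = Inr i" "i \<in> I <+> J" using fv by blast
    then show "case_sum (\<lambda>n. undefined) (\<lambda>i. the (case_sum (act f a) (act f b) i)) v = f (s v)"
      using assms(3,4) by (auto simp: s_def act_def)
  qed
  also have "\<dots> = sat S UNIV s \<phi>"
    by (rule definable_aut[OF assms(1) definableI[of S \<phi> UNIV]]) (simp_all add: wf)
  finally show ?thesis by (simp add: holds_def s_def)
qed

lemma definable_holds_pair:
  fixes S :: "('f, 'r, 'm) struct" and a :: "'i \<rightharpoonup> 'm"
  assumes \<phi>: "\<phi> \<in> formulas S (I <+> I)" and a: "dom a = I"
  shows "\<exists>P. definable S ({0, 1} \<times> ran a) P \<and>
    (\<forall>f g. P (case_prod (seq2 f g)) = holds S (case_sum (act f a) (act g a)) \<phi>)"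
proof -
  define \<rho> where "\<rho> = case_sum (\<lambda>i. (0 :: nat, the (a i))) (\<lambda>i. (1, the (a i)))"
  define P where "P = (\<lambda>s :: nat \<times> 'm \<Rightarrow> 'm. holds S (\<lambda>i. Some (s (\<rho> i))) \<phi>)"
  have "definable S (\<rho> ` (I <+> I)) P"
    unfolding P_def using \<phi> infinite_vars by (rule definable_holds)
  moreover have "\<rho> ` (I <+> I) \<subseteq> {0, 1} \<times> ran a"
    using a by (auto simp: \<rho>_def ran_def dom_def)
  ultimately have "definable S ({0, 1} \<times> ran a) P" by (rule definable_mono)
  moreover have "P (case_prod (seq2 f g)) = holds S (case_sum (act f a) (act g a)) \<phi>" for f g
    unfolding P_def using \<phi> by (rule holds_cong) (use a in \<open>auto simp: \<rho>_def seq2_def act_def\<close>)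
  ultimately show ?thesis by blast
qed

lemma type_definable_equiv_act:
  assumes E: "type_definable_equiv S I E" and f: "f \<in> aut S"
  shows "(act f a, act f b) \<in> E \<longleftrightarrow> (a, b) \<in> E"
proof -
  obtain \<Phi> where \<Phi>: "\<Phi> \<subseteq> formulas S (I <+> I)"
    "E = {(a, b). dom a = I \<and> dom b = I \<and> (\<forall>\<phi>\<in>\<Phi>. holds S (case_sum a b) \<phi>)}"
    using E unfolding type_definable_equiv_def by blast
  have "holds S (case_sum (act f a) (act f b)) \<phi> = holds S (case_sum a b) \<phi>"
    if "\<phi> \<in> \<Phi>" "dom a = I" "dom b = I" for \<phi>
    using that \<Phi>(1) by (intro holds_act[OF f]) blast+
  then show ?thesis unfolding \<Phi>(2) by (auto simp: dom_act)
qed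

text \<open>
  An automorphism maps the class of \<open>a\<close> to the class of its image.
\<close>

lemma fixes_hyp_iff:
  assumes E: "type_definable_equiv S I E" and a: "dom a = I" and f: "f \<in> aut S"
  shows "fixes_hyp f (E `` {a}) \<longleftrightarrow> (a, act f a) \<in> E"
proof -
  have eqv: "equiv {a. dom a = I} E" using E by (simp add: type_definable_equiv_def)
  have "act f ` (E `` {a}) = E `` {act f a}"
  proof (intro equalityI subsetI)
    fix b assume "b \<in> act f ` (E `` {a})"
    then show "b \<in> E `` {act f a}" using type_definable_equiv_act[OF E f] by auto
  next
    fix b assume b: "b \<in> E `` {act f a}"
    have "b = act f (act (ginv f) b)" by (simp flip: act_comp add: aut_comp_ginv[OF f] act_id)
    moreover from this have "(a, act (ginv f) b) \<in> E"
      using b type_definable_equiv_act[OF E f, of a "act (ginv f) b"] by simp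
    ultimately show "b \<in> act f ` (E `` {a})" by blast
  qed
  moreover have "E `` {a} = E `` {act f a} \<longleftrightarrow> (a, act f a) \<in> E"
    using eq_equiv_class_iff[OF eqv, of a "act f a"] a by (simp add: dom_act)
  ultimately show ?thesis unfolding fixes_hyp_def by auto
qed

lemma fixes_hyp_subgroup: "aut_subgroup S {f \<in> aut S. fixes_hyp f h}"
proof -
  have "act (ginv f) ` h = h" if f: "f \<in> aut S" "act f ` h = h" for f
  proof -
    have "act (ginv f) ` h = act (ginv f) ` act f ` h" using f(2) by simp
    also have "\<dots> = h" by (simp add: image_image flip: act_comp) (simp add: ginv_comp_aut[OF f(1)] act_id)
    finally show ?thesis .
  qed
  moreover have "act (f \<circ> g) ` h = h" if "act f ` h = h" "act g ` h = h" for f g :: "'c \<Rightarrow> 'c"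
  proof -
    have "act (f \<circ> g) ` h = act f ` act g ` h" by (simp add: image_image act_comp)
    then show ?thesis using that by simp
  qed
  moreover have "act id ` h = h" by (simp add: act_id)
  ultimately show ?thesis
    unfolding aut_subgroup_def fixes_hyp_def by (auto intro: id_aut comp_aut inv_aut)
qed

context monster_model
begin

text \<open>
  An automorphism fixes the class of \<open>a\<close> if the image of \<open>a\<close> is equivalent to \<open>a\<close>, which is a
  condition on the type of this image over \<open>a\<close>.
\<close>

lemma hyperimaginary_stabilizer:
  assumes h: "hyperimaginary S \<kappa> I h" and a: "a \<in> h"
  shows "dom a = I" "Small (ran a)" "closed_on S (ran a) {f \<in> aut S. fixes_hyp f h}"
proof -
  obtain E a0 where E: "type_definable_equiv S I E" "dom a0 = I" "h = E `` {a0}" and I: "Small I"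
    using h unfolding hyperimaginary_def by blast
  have eqv: "equiv {a. dom a = I} E" using E by (simp add: type_definable_equiv_def)
  then have "E \<subseteq> {a. dom a = I} \<times> {a. dom a = I}" by (simp add: equiv_type)
  then show dom: "dom a = I" using a E(3) by blast
  have h_a: "h = E `` {a}" using equiv_class_eq[OF eqv, of a0 a] a E(3) by simp
  have "ran a = (\<lambda>i. the (a i)) ` dom a" by (force simp: ran_def dom_def)
  then show "Small (ran a)" using I dom by (simp add: Small_image)
  obtain \<Phi> where \<Phi>: "\<Phi> \<subseteq> formulas S (I <+> I)"
    "E = {(a, b). dom a = I \<and> dom b = I \<and> (\<forall>\<phi>\<in>\<Phi>. holds S (case_sum a b) \<phi>)}"
    using E unfolding type_definable_equiv_def by blast
  have "\<exists>P. definable S ({0, 1} \<times> ran a) P \<and>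
      (\<forall>f. P (case_prod (seq2 id f)) = holds S (case_sum (act id a) (act f a)) \<phi>)" if "\<phi> \<in> \<Phi>" for \<phi>
  proof -
    have "\<phi> \<in> formulas S (I <+> I)" using that \<Phi>(1) by blast
    from definable_holds_pair[OF this dom] show ?thesis by metis
  qed
  then obtain P where P: "\<And>\<phi>. \<phi> \<in> \<Phi> \<Longrightarrow> definable S ({0, 1} \<times> ran a) (P \<phi>)"
    "\<And>\<phi> f. \<phi> \<in> \<Phi> \<Longrightarrow> P \<phi> (case_prod (seq2 id f)) = holds S (case_sum (act id a) (act f a)) \<phi>"
    by metis
  define Y where "Y \<phi> = {f \<in> aut S. P \<phi> (case_prod (seq2 id f))}" for \<phi>
  have Y: "closed_on S (ran a) (Y \<phi>)" if "\<phi> \<in> \<Phi>" for \<phi>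
    unfolding Y_def by (rule closed_on_definable) (rule P(1)[OF that])
  have "{f \<in> aut S. fixes_hyp f h} = \<Inter> (insert (aut S) (Y ` \<Phi>))"
  proof -
    have "fixes_hyp f h \<longleftrightarrow> (\<forall>\<phi>\<in>\<Phi>. f \<in> Y \<phi>)" if f: "f \<in> aut S" for f
    proof -
      have "fixes_hyp f h \<longleftrightarrow> (\<forall>\<phi>\<in>\<Phi>. holds S (case_sum a (act f a)) \<phi>)"
        using fixes_hyp_iff[OF E(1) dom f] dom unfolding h_a \<Phi>(2) by (simp add: dom_act)
      then show ?thesis using P(2) f by (simp add: Y_def act_id)
    qed
    then show ?thesis by auto
  qed
  moreover have "closed_on S (ran a) (\<Inter> (insert (aut S) (Y ` \<Phi>)))"
    by (rule closed_on_Inter) (use Y in \<open>auto simp: closed_on_def limit_points_aut\<close>)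
  ultimately show "closed_on S (ran a) {f \<in> aut S. fixes_hyp f h}" by simp
qed

end


context monster_model
begin

text \<open>
  The hyperimaginary is the class of \<open>\<beta>\<close> under the relation that connects \<open>p(\<beta>)\<close> to \<open>p(g(\<beta>))\<close>
  for all automorphisms \<open>p\<close> and all \<open>g \<in> Y\<close>. Equality has to be added to have an equivalence relation on all
  tuples. A pair of distinct tuples that satisfies all formulas true throughout the
  relation has the type of a limit of pairs \<open>(p(\<beta>), p(g(\<beta>)))\<close>: if a formula failed at all
  of these pairs, then the disjunction of its negation with the equality of two entries would be true throughout
  the relation.
\<close>

lemma hyperimaginary_of_closed_subgroup:
  fixes \<beta> :: "'i \<rightharpoonup> 'm"
  assumes small: "Small (dom \<beta>)" and Y: "aut_subgroup S Y" and cl: "closed_on S (ran \<beta>) Y"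
    and fixing: "\<And>h. h \<in> aut S \<Longrightarrow> (\<And>x. x \<in> ran \<beta> \<Longrightarrow> h x = x) \<Longrightarrow> h \<in> Y"
  obtains h where "hyperimaginary S \<kappa> (dom \<beta>) h" "\<beta> \<in> h"
    "\<And>f. f \<in> aut S \<Longrightarrow> fixes_hyp f h \<longleftrightarrow> f \<in> Y"
proof -
  define I where "I = dom \<beta>"
  note Ya = aut_subgroup_aut[OF Y]
  have fixY: "f \<in> Y" if "f \<in> aut S" "act f \<beta> = \<beta>" for f
  proof (rule fixing[OF that(1)])
    show "f x = x" if "x \<in> ran \<beta>" for x
      using that \<open>act f \<beta> = \<beta>\<close> act_eq_iff[of f \<beta> id] by (simp add: act_id)
  qed
  define F where "F = {(x, y). dom x = I \<and> dom y = I \<and>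
    (x = y \<or> (\<exists>p\<in>aut S. \<exists>g\<in>Y. x = act p \<beta> \<and> y = act (p \<circ> g) \<beta>))}"
  have FI: "(act p \<beta>, act (p \<circ> g) \<beta>) \<in> F" if "p \<in> aut S" "g \<in> Y" for p g
    using that unfolding F_def by (auto simp: dom_act I_def)
  have eqv: "equiv {a. dom a = I} F"
  proof (rule equivI)
    show "F \<subseteq> {a. dom a = I} \<times> {a. dom a = I}" by (auto simp: F_def)
    show "refl_on {a. dom a = I} F" by (auto simp: refl_on_def F_def)
    show "sym F"
    proof (rule symI)
      fix x y assume xy: "(x, y) \<in> F"
      show "(y, x) \<in> F"
      proof (cases "x = y")
        case False
        then obtain p g where pg: "p \<in> aut S" "g \<in> Y" "x = act p \<beta>" "y = act (p \<circ> g) \<beta>"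
          using xy unfolding F_def by blast
        have "(p \<circ> g) \<circ> ginv g = p" by (simp add: comp_assoc aut_comp_ginv[OF Ya[OF pg(2)]])
        then show ?thesis
          using FI[OF comp_aut[OF pg(1) Ya[OF pg(2)]] aut_subgroup_ginv[OF Y pg(2)]] pg by simp
      qed (use xy in simp)
    qed
    show "trans F"
    proof (rule transI)
      fix x y z assume xy: "(x, y) \<in> F" and yz: "(y, z) \<in> F"
      show "(x, z) \<in> F"
      proof (cases "x = y \<or> y = z")
        case False
        then obtain p g q k where pg: "p \<in> aut S" "g \<in> Y" "x = act p \<beta>" "y = act (p \<circ> g) \<beta>"
          and qk: "q \<in> aut S" "k \<in> Y" "y = act q \<beta>" "z = act (q \<circ> k) \<beta>"
          using xy yz unfolding F_def by blast
        define s where "s = ginv (p \<circ> g) \<circ> q"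
        have pga: "p \<circ> g \<in> aut S" using comp_aut[OF pg(1) Ya[OF pg(2)]] .
        have "act s \<beta> = act (ginv (p \<circ> g)) (act (p \<circ> g) \<beta>)" using pg(4) qk(3) by (simp add: s_def act_comp)
        also have "\<dots> = \<beta>" by (simp flip: act_comp add: ginv_comp_aut[OF pga] act_id)
        finally have "s \<in> Y" unfolding s_def by (intro fixY comp_aut inv_aut pga qk(1))
        then have "g \<circ> (s \<circ> k) \<in> Y" by (intro aut_subgroup_comp[OF Y] pg(2) qk(2))
        moreover have "p \<circ> (g \<circ> (s \<circ> k)) = q \<circ> k"
          using aut_ginv_cancel[OF pga, of "q \<circ> k"] by (simp add: s_def comp_assoc)
        ultimately show ?thesis using FI[OF pg(1), of "g \<circ> (s \<circ> k)"] pg(3) qk(4) by simp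
      qed (use xy yz in auto)
    qed
  qed
  define V where "V = {0, 1 :: nat} \<times> I"
  define asg where "asg x y = (\<lambda>(n, i). if n = (0 :: nat) then the (x i) else the (y i) :: 'm)" for x y :: "'i \<rightharpoonup> 'm"
  have inf: "infinite (UNIV :: (nat \<times> 'i) set)" by (simp add: finite_prod)
  define \<Phi> where "\<Phi> = {\<phi> \<in> formulas S (I <+> I). \<forall>(x, y)\<in>F. holds S (case_sum x y) \<phi>}"
  have closure: "(x, y) \<in> F"
    if dom: "dom x = I" "dom y = I" and hold: "\<forall>\<phi>\<in>\<Phi>. holds S (case_sum x y) \<phi>" for x y
  proof (cases "x = y")
    case False
    then obtain i where i: "x i \<noteq> y i" by blast
    then have iI: "i \<in> I" using dom by (metis domIff)
    have lim: "\<exists>p\<in>aut S. \<exists>g\<in>Y. P (asg (act p \<beta>) (act (p \<circ> g) \<beta>))"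
      if P: "definable S V P" "P (asg x y)" for P
    proof (rule ccontr)
      assume no: "\<not> ?thesis"
      \<comment> \<open>The second disjunct covers the pairs of equal tuples in the relation and fails at \<open>(x, y)\<close>.\<close>
      define Q where "Q = (\<lambda>s. \<not> P s \<or> s (0 :: nat, i) = s (1, i))"
      have dQ: "definable S V Q"
        unfolding Q_def using iI by (intro definable_disj definable_not P(1) definable_eq) (auto simp: V_def)
      define \<rho> where "\<rho> = (\<lambda>(n, i). if n = (0 :: nat) then Inl i else Inr i :: 'i + 'i)"
      obtain \<phi> where \<phi>: "\<phi> \<in> formulas S (\<rho> ` V)" "\<And>a. holds S a \<phi> = Q (\<lambda>v. the (a (\<rho> v)))"
        using definable_formula[OF dQ, of \<rho>] by blast
      have hQ: "holds S (case_sum a b) \<phi> = Q (asg a b)" for a b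
      proof -
        have "(\<lambda>v. the (case_sum a b (\<rho> v))) = asg a b"
          by (auto simp: \<rho>_def asg_def fun_eq_iff)
        then show ?thesis using \<phi>(2)[of "case_sum a b"] by simp
      qed
      have "Q (asg a b)" if "(a, b) \<in> F" for a b
      proof (cases "a = b")
        case True
        then show ?thesis by (simp add: Q_def asg_def)
      next
        case False
        then show ?thesis using that no unfolding F_def Q_def by blast
      qed
      moreover have "\<rho> ` V \<subseteq> I <+> I" by (auto simp: \<rho>_def V_def)
      ultimately have "\<phi> \<in> \<Phi>" using \<phi>(1) hQ unfolding \<Phi>_def formulas_def by blast
      with hold have "holds S (case_sum x y) \<phi>" by (rule bspec)
      then have "Q (asg x y)" unfolding hQ .
      then have "the (x i) = the (y i)" using P(2) by (simp add: Q_def asg_def)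
      moreover obtain u v where "x i = Some u" "y i = Some v" using iI dom by (metis domD)
      ultimately show False using i by simp
    qed
    have type: "P (asg x y)"
      if P: "definable S ({n} \<times> I) P" "P (\<lambda>w. the (\<beta> (snd w)))" and n: "n \<in> {0, 1}" for P n
    proof (rule ccontr)
      assume "\<not> P (asg x y)"
      moreover have "definable S V (\<lambda>s. \<not> P s)"
        by (rule definable_not, rule definable_mono[OF P(1)]) (use n in \<open>auto simp: V_def\<close>)
      ultimately obtain p g where pg: "p \<in> aut S" "g \<in> Y" "\<not> P (asg (act p \<beta>) (act (p \<circ> g) \<beta>))"
        using lim[of "\<lambda>s. \<not> P s"] by blast
      define k where "k = (if n = 0 then p else p \<circ> g)"
      have k: "k \<in> aut S" using pg comp_aut[OF pg(1) Ya[OF pg(2)]] by (simp add: k_def)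
      have "P (asg (act p \<beta>) (act (p \<circ> g) \<beta>)) = P (\<lambda>w. k (the (\<beta> (snd w))))"
        by (rule definable_cong[OF P(1)]) (use n in \<open>auto simp: asg_def k_def I_def act_def\<close>)
      also have "\<dots> = P (\<lambda>w. the (\<beta> (snd w)))" by (rule definable_aut[OF k P(1)])
      finally show False using P(2) pg(3) by simp
    qed
    have img: "\<exists>p\<in>aut S. \<forall>i\<in>I. p (the (\<beta> i)) = asg x y (n, i)" if n: "n \<in> {0, 1}" for n
    proof -
      have "Small ({n} \<times> I)" using small by (auto simp: I_def intro: Small_Times Small_finite)
      then obtain p where p: "p \<in> aut S" "\<And>w. w \<in> {n} \<times> I \<Longrightarrow> p (the (\<beta> (snd w))) = asg x y w"
      proof (rule homogeneous[OF inf, of _ "\<lambda>w. the (\<beta> (snd w))" "asg x y"])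
        fix P assume "definable S ({n} \<times> I) P" "P (\<lambda>w. the (\<beta> (snd w)))"
        then show "P (asg x y)" using n by (rule type)
      qed (rule that)
      then show ?thesis by (intro bexI[of _ p]) auto
    qed
    obtain p where p: "p \<in> aut S" "\<forall>i\<in>I. p (the (\<beta> i)) = the (x i)" using img[of 0] by (auto simp: asg_def)
    obtain q where q: "q \<in> aut S" "\<forall>i\<in>I. q (the (\<beta> i)) = the (y i)" using img[of 1] by (auto simp: asg_def)
    have act: "act r \<beta> = z" if rz: "\<forall>i\<in>I. r (the (\<beta> i)) = the (z i)" "dom z = I" for r :: "'m \<Rightarrow> 'm" and z
    proof
      fix i
      show "act r \<beta> i = z i"
      proof (cases "i \<in> I")
        case True
        then obtain u v where uv: "\<beta> i = Some u" "z i = Some v" using rz(2) unfolding I_def by blast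
        have "r (the (\<beta> i)) = the (z i)" using rz(1) True by (rule bspec)
        then show ?thesis using uv by (simp add: act_def)
      next
        case False
        then have "\<beta> i = None" "z i = None" using rz(2) unfolding I_def by blast+
        then show ?thesis by (simp add: act_def)
      qed
    qed
    have xy: "act p \<beta> = x" "act q \<beta> = y" using act p(2) q(2) dom by blast+
    define g where "g = ginv p \<circ> q"
    have pg: "p \<circ> g = q" by (simp add: g_def aut_ginv_cancel[OF p(1)])
    have ga: "g \<in> aut S" unfolding g_def by (intro comp_aut inv_aut p(1) q(1))
    define sel where "sel m = (SOME i. \<beta> i = Some m)" for m
    have sel: "\<beta> (sel m) = Some m" if "m \<in> ran \<beta>" for m
      using that unfolding sel_def ran_def by (auto intro: someI)
    have "g \<in> Y"
    proof (rule closed_onD[OF cl], rule limit_pointsI[OF ga])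
      fix P assume P: "definable S ({0, 1} \<times> ran \<beta>) P" "P (case_prod (seq2 id g))"
      define Q where "Q = (\<lambda>s. P (\<lambda>w. s (fst w, sel (snd w))))"
      have "definable S ((\<lambda>w. (fst w, sel (snd w))) ` ({0, 1} \<times> ran \<beta>)) Q"
        unfolding Q_def using P(1) inf by (rule definable_rename)
      moreover have "(\<lambda>w. (fst w, sel (snd w))) ` ({0, 1} \<times> ran \<beta>) \<subseteq> V"
        using sel by (fastforce simp: V_def I_def)
      ultimately have dQ: "definable S V Q" by (rule definable_mono)
      have Q: "Q (asg (act u \<beta>) (act v \<beta>)) = P (case_prod (seq2 u v))" for u v
        unfolding Q_def
        by (rule definable_cong[OF P(1)]) (auto simp: asg_def seq2_def act_def sel)
      have Q': "Q (asg (act u \<beta>) (act (u \<circ> v) \<beta>)) = P (case_prod (seq2 id v))" if "u \<in> aut S" for u v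
        using Q[of u "u \<circ> v"] definable_seq2_aut[OF that P(1), of id v] by simp
      have "Q (asg x y)" using Q'[OF p(1), of g] P(2) by (simp only: pg xy)
      then show "\<exists>x\<in>Y. P (case_prod (seq2 id x))" using lim[OF dQ] Q' by blast
    qed
    then show ?thesis using FI[OF p(1)] xy pg by metis
  qed (use dom in \<open>simp add: F_def\<close>)
  have "F = {(a, b). dom a = I \<and> dom b = I \<and> (\<forall>\<phi>\<in>\<Phi>. holds S (case_sum a b) \<phi>)}"
  proof (intro equalityI subsetI)
    fix w assume w: "w \<in> F"
    then obtain a b where ab: "w = (a, b)" "dom a = I" "dom b = I" unfolding F_def by blast
    then show "w \<in> {(a, b). dom a = I \<and> dom b = I \<and> (\<forall>\<phi>\<in>\<Phi>. holds S (case_sum a b) \<phi>)}"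
      using w unfolding \<Phi>_def by auto
  qed (use closure in auto)
  moreover have "\<Phi> \<subseteq> formulas S (I <+> I)" by (auto simp: \<Phi>_def)
  ultimately have td: "type_definable_equiv S I F"
    unfolding type_definable_equiv_def using eqv by blast
  show thesis
  proof (rule that)
    show "hyperimaginary S \<kappa> (dom \<beta>) (F `` {\<beta>})"
      unfolding hyperimaginary_def using td small by (auto simp: I_def)
    show "\<beta> \<in> F `` {\<beta>}" by (simp add: F_def I_def)
    show "fixes_hyp f (F `` {\<beta>}) \<longleftrightarrow> f \<in> Y" if f: "f \<in> aut S" for f
    proof -
      have "f \<in> Y" if F: "(\<beta>, act f \<beta>) \<in> F"
      proof (cases "\<beta> = act f \<beta>")
        case False
        then have "\<exists>p\<in>aut S. \<exists>g\<in>Y. \<beta> = act p \<beta> \<and> act f \<beta> = act (p \<circ> g) \<beta>"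
          using F unfolding F_def by simp
        then obtain p g where pg: "p \<in> aut S" "g \<in> Y" "\<beta> = act p \<beta>" "act f \<beta> = act (p \<circ> g) \<beta>"
          by (elim bexE conjE) (rule that)
        have pgY: "p \<circ> g \<in> Y" using fixY[OF pg(1)] pg(2,3) aut_subgroup_comp[OF Y] by simp
        have "act (ginv (p \<circ> g) \<circ> f) \<beta> = act (ginv (p \<circ> g)) (act (p \<circ> g) \<beta>)"
          using pg(4) by (simp add: act_comp)
        also have "\<dots> = \<beta>" by (simp flip: act_comp add: ginv_comp_aut[OF Ya[OF pgY]] act_id)
        finally have "ginv (p \<circ> g) \<circ> f \<in> Y" by (intro fixY comp_aut inv_aut Ya[OF pgY] f)
        then have "(p \<circ> g) \<circ> (ginv (p \<circ> g) \<circ> f) \<in> Y" by (rule aut_subgroup_comp[OF Y pgY])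
        then show ?thesis by (simp only: aut_ginv_cancel[OF Ya[OF pgY]])
      qed (use fixY[OF f] in simp)
      moreover have "(\<beta>, act f \<beta>) \<in> F" if "f \<in> Y" using FI[OF id_aut that] by (simp add: act_id)
      ultimately show ?thesis using fixes_hyp_iff[OF td _ f, of \<beta>] by (auto simp: I_def)
    qed
  qed
qed

end


section \<open>Elementary submodels\<close>

text \<open>
  The Tarski-Vaught property for several variables at once: the variables outside \<open>W\<close> that occur in the formula are moved into
  \<open>M\<close> one at a time, each by an existential formula with the values of the others as parameters.
\<close>

lemma elementary_sub_witness:
  fixes S :: "('f, 'r, 'm) struct" and s :: "'v \<Rightarrow> 'm"
  assumes M: "elementary_sub S M" and P: "definable S V P" "P s" and W: "\<And>v. v \<in> W \<Longrightarrow> s v \<in> M"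
  obtains s' where "\<And>v. s' v \<in> M" "\<And>v. v \<in> W \<Longrightarrow> s' v = s v" "P s'"
proof -
  obtain F where F: "finite F" "definable S F P" using definable_finite_support[OF P(1)] by blast
  obtain \<iota> :: "'v \<Rightarrow> nat" where \<iota>: "inj_on \<iota> F"
    using finite_imp_inj_to_nat_seg[OF F(1)] by blast
  obtain m0 where m0: "m0 \<in> M" using M by (auto simp: elementary_sub_def)
  have step: "\<exists>s'. (\<forall>w\<in>W. s' w = t w) \<and> s' v \<in> M \<and> P s'"
    if v: "v \<in> F" "v \<notin> W" and W: "W \<subseteq> F" "\<And>w. w \<in> W \<Longrightarrow> t w \<in> M" and "P t" for W v t
  proof -
    define Q where "Q = (\<lambda>s. \<exists>s'. (\<forall>w\<in>insert v W. s' w = s w) \<and> P s')"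
    have "definable S (F \<inter> insert v W) Q" unfolding Q_def by (rule definable_proj[OF F(2)])
    then have "definable S (insert v W) Q" by (rule definable_mono) simp
    then obtain \<psi> :: "('f, 'r, 'v) fm" where \<psi>: "wf_fm S \<psi>" "fv \<psi> \<subseteq> insert v W" "\<And>s. Q s = sat S UNIV s \<psi>"
      by (rule definableE) blast
    obtain \<phi> :: "('f, 'r, nat) fm" where \<phi>: "wf_fm S \<phi>" "fv \<phi> \<subseteq> \<iota> ` fv \<psi>"
      "\<And>D s. sat S D (s :: nat \<Rightarrow> 'm) \<phi> = sat S D (\<lambda>w. s (\<iota> w)) \<psi>"
      using sat_rename[OF infinite_UNIV_nat, of S \<psi> \<iota>] \<psi>(1) by metis
    define r where "r = (\<lambda>k. if k \<in> \<iota> ` W then t (inv_into W \<iota> k) else m0)"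
    have inj: "inj_on \<iota> (insert v W)" using \<iota> v(1) W(1) by (meson inj_on_subset insert_subset)
    have \<iota>W: "inj_on \<iota> W" using inj by (rule inj_on_subset) blast
    have rM: "r k \<in> M" for k using W(2) m0 inv_into_into[of k \<iota> W] by (auto simp: r_def)
    have r: "Q (\<lambda>w. (r(\<iota> v := x)) (\<iota> w)) = Q (t(v := x))" for x
    proof (rule definable_cong[OF \<open>definable S (insert v W) Q\<close>])
      fix w assume w: "w \<in> insert v W"
      show "(r(\<iota> v := x)) (\<iota> w) = (t(v := x)) w"
      proof (cases "w = v")
        case False
        have "\<iota> w \<noteq> \<iota> v" using False inj_on_eq_iff[OF inj w insertI1] by simp
        moreover have "w \<in> W" using w False by blast
        ultimately
        show ?thesis using False inv_into_f_f[OF \<iota>W] by (simp add: r_def)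
      qed simp
    qed
    define \<chi> where "\<chi> = Imp (All (\<iota> v) (Imp \<phi> Bot)) Bot"
    have \<chi>: "sat S D r \<chi> \<longleftrightarrow> (\<exists>x\<in>D. sat S D (r(\<iota> v := x)) \<phi>)" for D by (simp add: \<chi>_def)
    have elem: "sat S M q \<theta> = sat S UNIV q \<theta>"
      if q: "wf_fm S \<theta>" "\<And>k. q k \<in> M" for q and \<theta> :: "('f, 'r, nat) fm"
    proof -
      have "range q \<subseteq> M" using q(2) by blast
      with q(1) M show ?thesis by (simp add: elementary_sub_def)
    qed
    have satQ: "sat S UNIV (r(\<iota> v := x)) \<phi> = Q (t(v := x))" for x
      using r[of x] by (simp only: \<phi>(3) \<psi>(3))
    have "Q (t(v := t v))" unfolding Q_def using \<open>P t\<close> by (intro exI[of _ t]) simp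
    then have "sat S UNIV r \<chi>" unfolding \<chi> satQ by blast
    moreover have "wf_fm S \<chi>" using \<phi>(1) by (simp add: \<chi>_def)
    ultimately have "sat S M r \<chi>" using elem rM by blast
    then obtain x where x: "x \<in> M" "sat S M (r(\<iota> v := x)) \<phi>" unfolding \<chi> by blast
    have "(r(\<iota> v := x)) k \<in> M" for k using rM x(1) by simp
    then have "sat S UNIV (r(\<iota> v := x)) \<phi>" using elem[OF \<phi>(1)] x(2) by blast
    then have "Q (t(v := x))" by (simp only: satQ)
    then obtain s' where s': "\<forall>w\<in>insert v W. s' w = (t(v := x)) w" "P s'" unfolding Q_def by blast
    then have "s' v \<in> M" "\<forall>w\<in>W. s' w = t w" using x(1) v(2) by auto
    then show ?thesis using s'(2) by blast
  qed
  have "\<exists>s'. (\<forall>w\<in>F \<inter> W. s' w = s w) \<and> (\<forall>w\<in>(F \<inter> W) \<union> E. s' w \<in> M) \<and> P s'"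
    if "finite E" "E \<subseteq> F - W" for E
    using that
  proof (induction E rule: finite_induct)
    case empty
    then show ?case using P(2) W by (intro exI[of _ s]) auto
  next
    case (insert v E)
    then obtain t where t: "\<forall>w\<in>F \<inter> W. t w = s w" "\<forall>w\<in>(F \<inter> W) \<union> E. t w \<in> M" "P t" by blast
    have "v \<in> F" "v \<notin> (F \<inter> W) \<union> E" "(F \<inter> W) \<union> E \<subseteq> F" using insert by auto
    then obtain s' where "\<forall>w\<in>(F \<inter> W) \<union> E. s' w = t w" "s' v \<in> M" "P s'"
      using step[of v "(F \<inter> W) \<union> E" t] t by blast
    then show ?case using t by (intro exI[of _ s']) auto
  qed
  from this[of "F - W"] F(1) obtain t where
    t: "\<forall>w\<in>F \<inter> W. t w = s w" "\<forall>w\<in>(F \<inter> W) \<union> (F - W). t w \<in> M" "P t" by auto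
  define s' where "s' = (\<lambda>w. if w \<in> F then t w else if w \<in> W then s w else m0)"
  show thesis
  proof (rule that)
    show "s' v \<in> M" for v using t(2) W m0 by (auto simp: s'_def)
    show "s' v = s v" if "v \<in> W" for v using t(1) that by (auto simp: s'_def)
    have "P s' = P t" by (rule definable_cong[OF F(2)]) (simp add: s'_def)
    then show "P s'" using t(3) by simp
  qed
qed


section \<open>Lascar strong automorphisms\<close>

lemma elementary_sub_image:
  fixes S :: "('f, 'r, 'm) struct"
  assumes g: "g \<in> aut S" and M: "elementary_sub S M"
  shows "elementary_sub S (g ` M)"
  unfolding elementary_sub_def
proof (intro conjI allI impI)
  show "g ` M \<noteq> {}" using M by (simp add: elementary_sub_def)
next
  fix f xs assume f: "farity S f = Some (length xs) \<and> set xs \<subseteq> g ` M"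
  define ys where "ys = map (ginv g) xs"
  have ys: "map g ys = xs" by (simp add: ys_def aut_comp_ginv[OF g])
  have "set ys \<subseteq> M" using f by (auto simp: ys_def ginv_aut[OF g])
  moreover have "farity S f = Some (length ys)" using f by (simp add: ys_def)
  ultimately have "fint S f ys \<in> M" using M by (simp add: elementary_sub_def)
  moreover have "fint S f (map g ys) = g (fint S f ys)"
    using g \<open>farity S f = Some (length ys)\<close> by (simp add: aut_def)
  ultimately show "fint S f xs \<in> g ` M" by (simp add: ys)
next
  fix \<phi> :: "('f, 'r, nat) fm" and s :: "nat \<Rightarrow> 'm"
  assume \<phi>: "wf_fm S \<phi> \<and> range s \<subseteq> g ` M"
  define t where "t = (\<lambda>w. ginv g (s w))"
  have s: "s = (\<lambda>w. g (t w))" by (simp add: t_def aut_ginv[OF g])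
  have "range t \<subseteq> M" using \<phi> by (auto simp: t_def ginv_aut[OF g] dest!: subsetD)
  then have eq: "sat S M t \<phi> = sat S UNIV t \<phi>" using M \<phi> by (simp add: elementary_sub_def)
  have "surj g" using g by (simp add: aut_def bij_def)
  then show "sat S (g ` M) s \<phi> = sat S UNIV s \<phi>"
    using sat_aut[OF g, of \<phi> M t] sat_aut[OF g, of \<phi> UNIV t] eq \<phi> by (simp only: s[symmetric])
qed

locale over_hyperimaginary = monster_model T S \<kappa>
  for T :: "('f, 'r, nat) fm set" and S :: "('f, 'r, 'm) struct" and \<kappa> :: "'k rel" +
  fixes I :: "'i set" and e :: "('i \<rightharpoonup> 'm) set"
  assumes e: "hyperimaginary S \<kappa> I e"
begin

abbreviation "Aut \<equiv> Aut_over S e"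
abbreviation "Autf \<equiv> Autf_L S \<kappa> e"

lemma Aut_subgroup: "aut_subgroup S Aut"
  using fixes_hyp_subgroup[of S e] by (simp add: Aut_over_def)

lemmas Aut_aut = aut_subgroup_aut[OF Aut_subgroup] and id_Aut = aut_subgroup_id[OF Aut_subgroup]
  and comp_Aut = aut_subgroup_comp[OF Aut_subgroup] and ginv_Aut = aut_subgroup_ginv[OF Aut_subgroup]

lemma representative:
  obtains a where "a \<in> e"
proof -
  obtain E a where E: "type_definable_equiv S I E" "dom a = I" "e = E `` {a}"
    using e unfolding hyperimaginary_def by blast
  then have "equiv {a. dom a = I} E" by (simp add: type_definable_equiv_def)
  from equiv_class_self[OF this, of a] have "a \<in> e" using E by simp
  then show thesis by (rule that)
qed

lemma closed_Aut:
  obtains A where "Small A" "closed_on S A Aut"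
proof -
  obtain a where "a \<in> e" by (rule representative)
  from hyperimaginary_stabilizer[OF e this] that show thesis by (simp add: Aut_over_def)
qed

lemma fixing_Aut: "in_dcl S e A \<Longrightarrow> h \<in> aut S \<Longrightarrow> (\<And>z. z \<in> A \<Longrightarrow> h z = z) \<Longrightarrow> h \<in> Aut"
  by (auto simp: in_dcl_def Aut_over_def)

lemma group_Aut: "group (Aut_group S e)"
proof (rule groupI)
  fix f assume "f \<in> carrier (Aut_group S e)"
  then have f: "f \<in> Aut" by (simp add: Aut_group_def)
  show "\<exists>g\<in>carrier (Aut_group S e). g \<otimes>\<^bsub>Aut_group S e\<^esub> f = \<one>\<^bsub>Aut_group S e\<^esub>"
    using ginv_Aut[OF f] ginv_comp_aut[OF Aut_aut[OF f]] by (auto simp: Aut_group_def)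
qed (auto simp: Aut_group_def comp_assoc comp_Aut id_Aut)

lemma inv_Aut_group:
  assumes f: "f \<in> Aut"
  shows "inv\<^bsub>Aut_group S e\<^esub> f = ginv f"
  by (rule group.inv_equality[OF group_Aut])
    (use f ginv_Aut[OF f] ginv_comp_aut[OF Aut_aut[OF f]] in \<open>auto simp: Aut_group_def\<close>)

text \<open>
  The conjugate by \<open>g\<close> of an automorphism fixing the model \<open>M\<close> fixes the model \<open>g(M)\<close>.
\<close>

lemma Autf_normal: "Autf \<lhd> Aut_group S e"
  unfolding Autf_L_def
proof (rule group.normal_generateI[OF group_Aut])
  define H where "H = {f \<in> Aut. \<exists>M. small_model S \<kappa> M \<and> in_dcl S e M \<and> (\<forall>x\<in>M. f x = x)}"
  show "{f \<in> Aut. \<exists>M. small_model S \<kappa> M \<and> in_dcl S e M \<and> (\<forall>x\<in>M. f x = x)} \<subseteq> carrier (Aut_group S e)"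
    by (auto simp: Aut_group_def)
  fix h g
  assume "h \<in> {f \<in> Aut. \<exists>M. small_model S \<kappa> M \<and> in_dcl S e M \<and> (\<forall>x\<in>M. f x = x)}"
    and "g \<in> carrier (Aut_group S e)"
  then obtain M where h: "h \<in> Aut" and M: "small_model S \<kappa> M" "in_dcl S e M" "\<forall>x\<in>M. h x = x"
    and g: "g \<in> Aut" by (auto simp: Aut_group_def)
  note ga = Aut_aut[OF g]
  have "small_model S \<kappa> (g ` M)"
    using M(1) elementary_sub_image[OF ga] by (auto simp: small_model_def intro: Small_image)
  moreover have "in_dcl S e (g ` M)"
    unfolding in_dcl_def
  proof (intro ballI impI)
    fix f assume f: "f \<in> aut S" "\<forall>x\<in>g ` M. f x = x"
    have "ginv g \<circ> (f \<circ> g) \<in> Aut"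
      by (rule fixing_Aut[OF M(2)]) (use f ga in \<open>auto intro!: comp_aut inv_aut simp: ginv_aut\<close>)
    then have "g \<circ> ((ginv g \<circ> (f \<circ> g)) \<circ> ginv g) \<in> Aut"
      by (rule comp_Aut[OF g comp_Aut[OF _ ginv_Aut[OF g]]])
    moreover have "g \<circ> ((ginv g \<circ> (f \<circ> g)) \<circ> ginv g) = f"
      by (simp add: comp_assoc aut_ginv_cancel[OF ga] aut_comp_ginv[OF ga])
    ultimately show "fixes_hyp f e" by (simp add: Aut_over_def)
  qed
  moreover have "\<forall>x\<in>g ` M. (g \<circ> (h \<circ> ginv g)) x = x" using M(3) by (simp add: ginv_aut[OF ga])
  moreover have "g \<circ> (h \<circ> ginv g) \<in> Aut" by (intro comp_Aut ginv_Aut g h)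
  moreover have eq: "g \<otimes>\<^bsub>Aut_group S e\<^esub> h \<otimes>\<^bsub>Aut_group S e\<^esub> inv\<^bsub>Aut_group S e\<^esub> g = g \<circ> (h \<circ> ginv g)"
    unfolding inv_Aut_group[OF g] by (simp add: Aut_group_def comp_assoc)
  ultimately show "g \<otimes>\<^bsub>Aut_group S e\<^esub> h \<otimes>\<^bsub>Aut_group S e\<^esub> inv\<^bsub>Aut_group S e\<^esub> g \<in>
      {f \<in> Aut. \<exists>M. small_model S \<kappa> M \<and> in_dcl S e M \<and> (\<forall>x\<in>M. f x = x)}"
    unfolding eq by blast
qed

lemma Autf_Aut: "n \<in> Autf \<Longrightarrow> n \<in> Aut"
  using normal_imp_subgroup[OF Autf_normal] subgroup.subset by (fastforce simp: Aut_group_def)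

lemma Autf_subgroup: "aut_subgroup S Autf"
proof -
  have sg: "subgroup Autf (Aut_group S e)" using Autf_normal by (rule normal_imp_subgroup)
  show ?thesis
    unfolding aut_subgroup_def
  proof (intro conjI ballI subsetI)
    show "f \<in> aut S" if "f \<in> Autf" for f using Aut_aut[OF Autf_Aut[OF that]] .
    show "id \<in> Autf" using subgroup.one_closed[OF sg] by (simp add: Aut_group_def)
    show "f \<circ> g \<in> Autf" if "f \<in> Autf" "g \<in> Autf" for f g
      using subgroup.m_closed[OF sg that] by (simp add: Aut_group_def)
    show "ginv f \<in> Autf" if "f \<in> Autf" for f
      using subgroup.m_inv_closed[OF sg that] inv_Aut_group[OF Autf_Aut[OF that]] by simp
  qed
qed

lemma Autf_conj:
  assumes "n \<in> Autf" "g \<in> Aut"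
  shows "g \<circ> (n \<circ> ginv g) \<in> Autf"
proof -
  have "g \<in> carrier (Aut_group S e)" using assms(2) by (simp add: Aut_group_def)
  from normal.inv_op_closed2[OF Autf_normal this assms(1)] show ?thesis
    unfolding inv_Aut_group[OF assms(2)] by (simp add: Aut_group_def comp_assoc)
qed

lemma fixing_Autf:
  assumes "small_model S \<kappa> M" "in_dcl S e M" "h \<in> aut S" "\<And>z. z \<in> M \<Longrightarrow> h z = z"
  shows "h \<in> Autf"
  unfolding Autf_L_def using assms fixing_Aut[OF assms(2-4)] by (intro generate.incl) auto

lemma Autf_minimal:
  assumes Y: "aut_subgroup S Y"
    and gen: "\<And>f M. f \<in> Aut \<Longrightarrow> small_model S \<kappa> M \<Longrightarrow> in_dcl S e M \<Longrightarrow> \<forall>x\<in>M. f x = x \<Longrightarrow> f \<in> Y"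
  shows "Autf \<subseteq> Y"
proof
  fix n assume "n \<in> Autf"
  then show "n \<in> Y"
    unfolding Autf_L_def
  proof (induction rule: generate.induct)
    case one
    have "\<one>\<^bsub>Aut_group S e\<^esub> = id" by (simp add: Aut_group_def)
    then show ?case using aut_subgroup_id[OF Y] by metis
  next
    case (incl h)
    then show ?case using gen by blast
  next
    case (inv h)
    then show ?case using gen aut_subgroup_ginv[OF Y] inv_Aut_group by auto
  next
    case (eng h1 h2)
    have "h1 \<otimes>\<^bsub>Aut_group S e\<^esub> h2 = h1 \<circ> h2" by (simp add: Aut_group_def)
    then show ?case using aut_subgroup_comp[OF Y eng.IH] by metis
  qed
qed

lemma proj_L_eq_iff:
  "proj_L S \<kappa> e f = proj_L S \<kappa> e g \<longleftrightarrow> (\<exists>n\<in>Autf. g = n \<circ> f)" if g: "g \<in> Aut"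
proof -
  have proj: "proj_L S \<kappa> e f = {n \<circ> f | n. n \<in> Autf}" for f
    by (auto simp: proj_L_def r_coset_def Aut_group_def)
  show ?thesis
  proof
    assume "proj_L S \<kappa> e f = proj_L S \<kappa> e g"
    moreover have "id \<circ> g \<in> proj_L S \<kappa> e g" unfolding proj using aut_subgroup_id[OF Autf_subgroup] by blast
    ultimately show "\<exists>n\<in>Autf. g = n \<circ> f" unfolding proj by auto
  next
    assume "\<exists>n\<in>Autf. g = n \<circ> f"
    then obtain n where n: "n \<in> Autf" "g = n \<circ> f" by blast
    note na = aut_subgroup_aut[OF Autf_subgroup n(1)]
    have 1: "m \<circ> f \<in> proj_L S \<kappa> e g" if "m \<in> Autf" for m
    proof -
      have "m \<circ> f = (m \<circ> ginv n) \<circ> g" by (simp add: n(2) comp_assoc ginv_aut_cancel[OF na])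
      moreover have "m \<circ> ginv n \<in> Autf"
        by (intro aut_subgroup_comp[OF Autf_subgroup] aut_subgroup_ginv[OF Autf_subgroup] that n(1))
      ultimately show ?thesis unfolding proj by blast
    qed
    have 2: "m \<circ> g \<in> proj_L S \<kappa> e f" if "m \<in> Autf" for m
      unfolding proj n(2) o_assoc using aut_subgroup_comp[OF Autf_subgroup that n(1)] by blast
    show "proj_L S \<kappa> e f = proj_L S \<kappa> e g"
    proof
      show "proj_L S \<kappa> e f \<subseteq> proj_L S \<kappa> e g" using 1 by (subst proj) blast
      show "proj_L S \<kappa> e g \<subseteq> proj_L S \<kappa> e f" using 2 by (subst proj) blast
    qed
  qed
qed


subsection \<open>Bounded hyperimaginaries\<close>

text \<open>
  Let \<open>f\<close> fix \<open>M\<close> pointwise. Representatives of the conjugates of \<open>h\<close> over \<open>M\<close>, of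
  which there are few by assumption, together with \<open>a\<close> and \<open>f(a)\<close> form a small set. Over this set, the type of
  \<open>a\<close> over \<open>M\<close> has an extension that is finitely satisfiable in \<open>M\<close>; let \<open>u(a)\<close> realize it. As \<open>u(a)\<close> is
  equivalent to one of the representatives, and a type finitely satisfiable in \<open>M\<close> does not distinguish
  parameters of the same type over \<open>M\<close>, it is equivalent to all of them, and to \<open>a\<close> and \<open>f(a)\<close> too.
\<close>

lemma fixing_model_fixes_bounded:
  assumes h: "hyperimaginary S \<kappa> I' h" and bdd: "Small (orbit S e h)"
    and f: "f \<in> aut S" and M: "small_model S \<kappa> M" "in_dcl S e M" "\<forall>x\<in>M. f x = x"
  shows "fixes_hyp f h"
proof -
  obtain E a where E: "type_definable_equiv S I' E" "dom a = I'" "h = E `` {a}"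
    using h unfolding hyperimaginary_def by blast
  have eqv: "equiv {a. dom a = I'} E" using E by (simp add: type_definable_equiv_def)
  have ah: "a \<in> h" unfolding E(3) using equiv_class_self[OF eqv, of a] E(2) by simp
  define R where "R = ran a"
  have sR: "Small R" unfolding R_def by (rule hyperimaginary_stabilizer(2)[OF h ah])
  define FM where "FM = {u \<in> aut S. \<forall>x\<in>M. u x = x}"
  have FM_Aut: "u \<in> Aut" if "u \<in> FM" for u using fixing_Aut[OF M(2)] that by (simp add: FM_def)
  define conj where "conj = (\<lambda>u. act u ` h) ` FM"
  have "conj \<subseteq> orbit S e h" using FM_Aut by (auto simp: conj_def orbit_def)
  then have s_conj: "Small conj" by (rule Small_subset[OF bdd])
  define rep where "rep c = (SOME u. u \<in> FM \<and> act u ` h = c)" for c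
  have rep: "rep c \<in> FM \<and> act (rep c) ` h = c" if c: "c \<in> conj" for c
  proof -
    obtain u where "u \<in> FM \<and> act u ` h = c" using c unfolding conj_def by blast
    then show ?thesis unfolding rep_def by (rule someI[where P = "\<lambda>u. u \<in> FM \<and> act u ` h = c"])
  qed
  define A where "A = insert id (insert f (rep ` conj))"
  have sA: "Small A" unfolding A_def by (intro Small_insert Small_image s_conj)
  have AFM: "g \<in> FM" if "g \<in> A" for g
    using that rep f M(3) id_aut by (auto simp: A_def FM_def)
  define C where "C = (\<lambda>(g, x). g x) ` (A \<times> R)"
  have sC: "Small C" unfolding C_def by (intro Small_image Small_Times sA sR)
  have C: "g x \<in> C" if "g \<in> A" "x \<in> R" for g x using that by (force simp: C_def)
  have sM: "Small M" and elM: "elementary_sub S M" using M(1) by (auto simp: small_model_def)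
  define V0 where "V0 = {0 :: nat} \<times> (M \<union> C)"
  define V1 where "V1 = {0 :: nat} \<times> M \<union> {1} \<times> R"
  define V where "V = V0 \<union> {1} \<times> R"
  have sV: "Small V" "Small V1"
    unfolding V_def V0_def V1_def
    by (intro Small_Un Small_Times Small_finite sM sC sR; simp)+
  \<comment> \<open>\<open>\<D>1\<close> is the type of \<open>a\<close> over \<open>M\<close>. The formulas in \<open>\<D>2\<close> are those satisfied by all tuples in \<open>M\<close>; a solution of them is finitely satisfiable in \<open>M\<close>.\<close>
  define \<D>1 where "\<D>1 = {P. definable S V1 P \<and> P snd}"
  define in_M where "in_M s \<longleftrightarrow> (\<forall>c\<in>M \<union> C. s (0 :: nat, c) = c) \<and> (\<forall>x\<in>R. s (1, x) \<in> M)" for s :: "nat \<times> 'm \<Rightarrow> 'm"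
  define \<D>2 where "\<D>2 = {P. definable S V P \<and> (\<forall>s. in_M s \<longrightarrow> P s)}"
  define \<D> where "\<D> = {\<lambda>s. P s \<and> Q s | P Q. P \<in> \<D>1 \<and> Q \<in> \<D>2}"
  have V1V: "V1 \<subseteq> V" by (auto simp: V1_def V_def V0_def)
  have T: "(\<lambda>s. True) \<in> \<D>1" "(\<lambda>s. True) \<in> \<D>2" by (simp_all add: \<D>1_def \<D>2_def definable_True)
  have \<D>I: "(\<lambda>s. P s \<and> Q s) \<in> \<D>" if "P \<in> \<D>1" "Q \<in> \<D>2" for P Q
    unfolding \<D>_def mem_Collect_eq using that by (intro exI[of _ P] exI[of _ Q] conjI refl)
  obtain s where s: "\<And>w. w \<in> V0 \<Longrightarrow> s w = snd w" "\<And>P. P \<in> \<D> \<Longrightarrow> P s"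
  proof (rule saturation[OF sV(1), of V0 \<D> snd])
    show "V0 \<subseteq> V" by (simp add: V_def)
    show "\<D> \<noteq> {}" using \<D>I[OF T] by (metis empty_iff)
  next
    fix P assume "P \<in> \<D>"
    then obtain P1 P2 where P: "P = (\<lambda>s. P1 s \<and> P2 s)" "P1 \<in> \<D>1" "P2 \<in> \<D>2"
      unfolding \<D>_def mem_Collect_eq by (elim exE conjE) (rule that)
    have d1: "definable S V1 P1" "P1 snd" using P(2) by (simp_all add: \<D>1_def)
    have d2: "definable S V P2" "\<And>s. in_M s \<Longrightarrow> P2 s" using P(3) by (simp_all add: \<D>2_def)
    show "definable S V P" unfolding P(1) by (rule definable_conj[OF definable_mono[OF d1(1) V1V] d2(1)])
    show "\<exists>s'. (\<forall>w\<in>V0. s' w = snd w) \<and> P s'"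
    proof -
      obtain t where t: "\<And>w. t w \<in> M" "\<And>w. w \<in> {0} \<times> M \<Longrightarrow> t w = snd w" "P1 t"
        by (rule elementary_sub_witness[OF elM d1, of "{0} \<times> M"]) (auto intro: that)
      define s' where "s' = (\<lambda>w. if w \<in> {1} \<times> R then t w else snd w)"
      have "P1 s' = P1 t"
        by (rule definable_cong[OF d1(1)]) (use t(2) in \<open>auto simp: s'_def V1_def\<close>)
      moreover have "P2 s'" by (rule d2(2)) (use t(1) in \<open>auto simp: in_M_def s'_def\<close>)
      moreover have "\<forall>w\<in>V0. s' w = snd w" by (auto simp: s'_def V0_def)
      ultimately show ?thesis using t(3) unfolding P(1) by blast
    qed
  next
    fix P Q assume PQ: "P \<in> \<D>" "Q \<in> \<D>"
    from PQ(1) obtain P1 P2 where P: "P = (\<lambda>s. P1 s \<and> P2 s)" "P1 \<in> \<D>1" "P2 \<in> \<D>2"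
      unfolding \<D>_def mem_Collect_eq by (elim exE conjE) (rule that)
    from PQ(2) obtain Q1 Q2 where Q: "Q = (\<lambda>s. Q1 s \<and> Q2 s)" "Q1 \<in> \<D>1" "Q2 \<in> \<D>2"
      unfolding \<D>_def mem_Collect_eq by (elim exE conjE) (rule that)
    have "(\<lambda>s. P1 s \<and> Q1 s) \<in> \<D>1" "(\<lambda>s. P2 s \<and> Q2 s) \<in> \<D>2"
      using P(2,3) Q(2,3) by (simp_all add: \<D>1_def \<D>2_def definable_conj)
    then have "(\<lambda>s. (P1 s \<and> Q1 s) \<and> (P2 s \<and> Q2 s)) \<in> \<D>" by (rule \<D>I)
    then show "\<exists>R\<in>\<D>. \<forall>s. R s \<longrightarrow> P s \<and> Q s" by (rule rev_bexI) (simp add: P(1) Q(1))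
  qed (rule that)
  have s1: "P s" if "P \<in> \<D>1" for P
    using s(2)[OF \<D>I[OF that T(2)]] by simp
  have s2: "P s" if "P \<in> \<D>2" for P
    using s(2)[OF \<D>I[OF T(1) that]] by simp
  obtain u where u: "u \<in> aut S" "\<And>w. w \<in> V1 \<Longrightarrow> u (snd w) = s w"
  proof (rule homogeneous[OF infinite_vars sV(2), of snd s])
    fix P assume "definable S V1 P" "P (snd :: nat \<times> 'm \<Rightarrow> 'm)"
    then have "P \<in> \<D>1" by (simp add: \<D>1_def)
    then show "P s" by (rule s1)
  qed (rule that)
  have uR: "s (1, x) = u x" if "x \<in> R" for x using u(2)[of "(1, x)"] that by (simp add: V1_def)
  have "u x = x" if "x \<in> M" for x
    using u(2)[of "(0, x)"] s(1)[of "(0, x)"] that by (simp add: V1_def V0_def)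
  then have uM: "u \<in> FM" using u(1) by (simp add: FM_def)
  have invariant: "P (case_prod (seq2 g2 u))"
    if P: "definable S ({0, 1} \<times> R) P" "P (case_prod (seq2 g1 u))" and g: "g1 \<in> A" "g2 \<in> A" for P g1 g2
  proof (rule ccontr)
    assume no: "\<not> P (case_prod (seq2 g2 u))"
    define \<rho> where "\<rho> g w = (if fst w = (0 :: nat) then (0, g (snd w) :: 'm) else w)" for g w
    \<comment> \<open>No tuple in \<open>M\<close> distinguishes the parameters \<open>g1(a)\<close> and \<open>g2(a)\<close>, which have the same type over \<open>M\<close>.\<close>
    define Q where "Q = (\<lambda>s. P (\<lambda>w. s (\<rho> g1 w)) \<longrightarrow> P (\<lambda>w. s (\<rho> g2 w)))"
    have dQ: "definable S V (\<lambda>s. P (\<lambda>w. s (\<rho> g w)))" if "g \<in> A" for g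
      by (rule definable_rename_vars[OF P(1)]) (use C[OF that] in \<open>auto simp: \<rho>_def V_def V0_def\<close>)
    have "Q t" if t: "in_M t" for t
    proof -
      define v where "v x = t (1, x)" for x
      define k where "k = g2 \<circ> ginv g1"
      have ga: "g1 \<in> aut S" "g2 \<in> aut S" using AFM g by (auto simp: FM_def)
      have k: "k \<in> aut S" unfolding k_def by (intro comp_aut inv_aut ga)
      have kM: "k x = x" if "x \<in> M" for x
      proof -
        have "ginv g1 x = x" using AFM[OF g(1)] that ginv_aut[OF ga(1), of x] by (simp add: FM_def)
        then show ?thesis using AFM[OF g(2)] that by (simp add: k_def FM_def)
      qed
      have tr: "P (\<lambda>w. t (\<rho> g w)) = P (case_prod (seq2 g v))" if "g \<in> A" for g
        by (rule definable_cong[OF P(1)])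
          (use t C[OF that] in \<open>auto simp: \<rho>_def seq2_def in_M_def v_def\<close>)
      have "P (case_prod (seq2 (k \<circ> g1) (k \<circ> v))) = P (case_prod (seq2 g2 v))"
      proof (rule definable_seq_cong[OF P(1)])
        fix n :: nat and x assume nx: "(n, x) \<in> {0, 1} \<times> R"
        then have "k (v x) = v x" using kM t by (auto simp: in_M_def v_def)
        then show "seq2 (k \<circ> g1) (k \<circ> v) n x = seq2 g2 v n x"
          by (simp add: seq2_def k_def ginv_aut[OF ga(1)])
      qed
      then show ?thesis unfolding Q_def tr[OF g(1)] tr[OF g(2)]
        using definable_seq2_aut[OF k P(1), of g1 v] by simp
    qed
    moreover have "definable S V Q" unfolding Q_def by (intro definable_Imp dQ g)
    ultimately have "Q \<in> \<D>2" by (simp add: \<D>2_def)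
    then have "Q s" by (rule s2)
    moreover have "P (\<lambda>w. s (\<rho> g w)) = P (case_prod (seq2 g u))" if "g \<in> A" for g
      by (rule definable_cong[OF P(1)])
        (use s(1) uR C[OF that] in \<open>auto simp: \<rho>_def seq2_def V0_def\<close>)
    ultimately show False using P(2) no g unfolding Q_def by simp
  qed
  obtain \<Phi> where \<Phi>: "\<Phi> \<subseteq> formulas S (I' <+> I')"
    "E = {(a, b). dom a = I' \<and> dom b = I' \<and> (\<forall>\<phi>\<in>\<Phi>. holds S (case_sum a b) \<phi>)}"
    using E(1) unfolding type_definable_equiv_def by blast
  have transfer: "(act g2 a, act u a) \<in> E" if g: "g1 \<in> A" "g2 \<in> A" and E1: "(act g1 a, act u a) \<in> E" for g1 g2
  proof -
    have "holds S (case_sum (act g2 a) (act u a)) \<phi>" if \<phi>: "\<phi> \<in> \<Phi>" for \<phi>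
    proof -
      have "\<phi> \<in> formulas S (I' <+> I')" using \<phi> \<Phi>(1) by blast
      from definable_holds_pair[OF this E(2)] obtain P where
        P: "definable S ({0, 1} \<times> R) P"
          "\<And>f g. P (case_prod (seq2 f g)) = holds S (case_sum (act f a) (act g a)) \<phi>"
        unfolding R_def by blast
      have "P (case_prod (seq2 g1 u))" using E1 \<phi> unfolding P(2) \<Phi>(2) by blast
      then have "P (case_prod (seq2 g2 u))" using g by (rule invariant[OF P(1)])
      then show ?thesis by (simp only: P(2))
    qed
    then show ?thesis unfolding \<Phi>(2) using E(2) by (simp add: dom_act)
  qed
  define r where "r = rep (act u ` h)"
  have r: "r \<in> FM" "act r ` h = act u ` h" using rep[of "act u ` h"] uM by (auto simp: r_def conj_def)
  have rA: "r \<in> A" using uM by (auto simp: A_def r_def conj_def)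
  have rE: "(act r a, act u a) \<in> E"
  proof -
    have "act u a \<in> act r ` h" unfolding r(2) using ah by blast
    then obtain b where "(a, b) \<in> E" "act u a = act r b" unfolding E(3) by blast
    then show ?thesis using type_definable_equiv_act[OF E(1)] r(1) by (simp add: FM_def)
  qed
  have "(act id a, act u a) \<in> E" "(act f a, act u a) \<in> E"
    using transfer[OF rA _ rE] by (simp_all add: A_def)
  then have "(a, act f a) \<in> E"
    using eqv by (metis act_id equivE symD transD)
  then show ?thesis unfolding E(3) using fixes_hyp_iff[OF E(1,2) f] by simp
qed

lemma Autf_fixes_bounded:
  assumes "hyperimaginary S \<kappa> I' h" "Small (orbit S e h)" "n \<in> Autf"
  shows "fixes_hyp n h"
proof -
  have "Autf \<subseteq> {f \<in> aut S. fixes_hyp f h}"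
    by (rule Autf_minimal[OF fixes_hyp_subgroup])
      (use fixing_model_fixes_bounded[OF assms(1,2)] Aut_aut in blast)
  then show ?thesis using assms(3) by blast
qed

end


section \<open>Counting formulas\<close>

text \<open>
  Terms and formulas with symbols of the language and variables in \<open>U\<close>, by depth of nesting. Each stage is an image of
  products and lists over the previous one, which gives its cardinality.
\<close>

primrec term_stage :: "('f, 'r, 'z) language_scheme \<Rightarrow> 'v set \<Rightarrow> nat \<Rightarrow> ('f, 'v) tm set" where
  "term_stage L U 0 = {}"
| "term_stage L U (Suc n) =
    term_stage L U n \<union> (Var ` U \<union> (\<lambda>(f, ts). Fn f ts) ` (dom (farity L) \<times> lists (term_stage L U n)))"

primrec formula_stage :: "('f, 'r, 'z) language_scheme \<Rightarrow> 'v set \<Rightarrow> nat \<Rightarrow> ('f, 'r, 'v) fm set" where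
  "formula_stage L U 0 = (let T = (\<Union>n. term_stage L U n) in
    {Bot} \<union> ((\<lambda>(t, u). Eq t u) ` (T \<times> T) \<union> (\<lambda>(r, ts). Rel r ts) ` (dom (rarity L) \<times> lists T)))"
| "formula_stage L U (Suc n) = formula_stage L U n \<union>
    ((\<lambda>(\<phi>, \<psi>). Imp \<phi> \<psi>) ` (formula_stage L U n \<times> formula_stage L U n) \<union>
     (\<lambda>(v, \<phi>). All v \<phi>) ` (U \<times> formula_stage L U n))"

lemma term_stage_mono: "m \<le> n \<Longrightarrow> term_stage L U m \<subseteq> term_stage L U n"
  by (rule lift_Suc_mono_le[of "term_stage L U"]) auto

lemma formula_stage_mono: "m \<le> n \<Longrightarrow> formula_stage L U m \<subseteq> formula_stage L U n"
  by (rule lift_Suc_mono_le[of "formula_stage L U"]) auto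

lemma finite_in_stage:
  assumes "finite X" "X \<subseteq> (\<Union>n. A n)" "\<And>m n. m \<le> n \<Longrightarrow> A m \<subseteq> A (n :: nat)"
  shows "\<exists>n. X \<subseteq> A n"
  using assms(1,2)
proof (induction X rule: finite_induct)
  case (insert x X)
  then obtain m n where "X \<subseteq> A m" "x \<in> A n" by blast
  then have "insert x X \<subseteq> A (max m n)"
    using assms(3)[of m "max m n"] assms(3)[of n "max m n"] by auto
  then show ?case by blast
qed simp

lemma term_in_stage: "wf_tm L t \<Longrightarrow> set2_tm t \<subseteq> U \<Longrightarrow> t \<in> (\<Union>n. term_stage L U n)"
proof (induction t)
  case (Var v)
  then have "Var v \<in> term_stage L U (Suc 0)" by simp
  then show ?case by blast
next
  case (Fn f ts)
  have "t \<in> (\<Union>n. term_stage L U n)" if "t \<in> set ts" for t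
    using Fn that by (auto simp: list_all_iff)
  then obtain n where "set ts \<subseteq> term_stage L U n"
    using finite_in_stage[of "set ts" "term_stage L U"] term_stage_mono by blast
  then have "ts \<in> lists (term_stage L U n)" by auto
  moreover have "f \<in> dom (farity L)" using Fn.prems(1) by auto
  ultimately have "Fn f ts \<in> term_stage L U (Suc n)" by auto
  then show ?case by blast
qed

lemma formula_in_stage: "wf_fm L \<phi> \<Longrightarrow> set3_fm \<phi> \<subseteq> U \<Longrightarrow> \<phi> \<in> (\<Union>n. formula_stage L U n)"
proof (induction \<phi>)
  case Bot
  then have "Bot \<in> formula_stage L U 0" by (simp add: Let_def)
  then show ?case by blast
next
  case (Eq t u)
  then have "t \<in> (\<Union>n. term_stage L U n)" "u \<in> (\<Union>n. term_stage L U n)"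
    using term_in_stage[of L t U] term_in_stage[of L u U] by simp_all
  then have "Eq t u \<in> formula_stage L U 0" by (auto simp: Let_def)
  then show ?case by blast
next
  case (Rel r ts)
  have "t \<in> (\<Union>n. term_stage L U n)" if "t \<in> set ts" for t
    using Rel that by (intro term_in_stage) auto
  then have "ts \<in> lists (\<Union>n. term_stage L U n)" by auto
  moreover have "r \<in> dom (rarity L)" using Rel.prems(1) by auto
  ultimately have "Rel r ts \<in> formula_stage L U 0" by (auto simp: Let_def)
  then show ?case by blast
next
  case (Imp \<phi> \<psi>)
  then have "{\<phi>, \<psi>} \<subseteq> (\<Union>n. formula_stage L U n)" by simp
  then obtain n where "{\<phi>, \<psi>} \<subseteq> formula_stage L U n"
    using finite_in_stage[of "{\<phi>, \<psi>}" "formula_stage L U"] formula_stage_mono by blast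
  then have "Imp \<phi> \<psi> \<in> formula_stage L U (Suc n)" by auto
  then show ?case by blast
next
  case (All v \<phi>)
  then have "\<phi> \<in> (\<Union>n. formula_stage L U n)" by simp
  then obtain n where "\<phi> \<in> formula_stage L U n" by blast
  moreover have "v \<in> U" using All.prems(2) by simp
  ultimately have "All v \<phi> \<in> formula_stage L U (Suc n)" by auto
  then show ?case by blast
qed

lemma card_of_lists_ordLeq: "infinite C \<Longrightarrow> |A| \<le>o |C| \<Longrightarrow> |lists A| \<le>o |C|"
  using card_of_lists_mono card_of_lists_infinite ordLeq_ordIso_trans by blast

lemma card_of_image_ordLeq: "|A| \<le>o |C| \<Longrightarrow> |f ` A| \<le>o |C|"
  using card_of_image ordLeq_transitive by blast

lemma card_of_UN_nat_ordLeq: "infinite C \<Longrightarrow> (\<And>n :: nat. |A n| \<le>o |C| ) \<Longrightarrow> |\<Union>n. A n| \<le>o |C|"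
  by (rule card_of_UNION_ordLeq_infinite) (auto simp: infinite_iff_card_of_nat)

lemma card_of_formulas:
  assumes inf: "infinite C" and f: "|dom (farity L)| \<le>o |C|" and r: "|dom (rarity L)| \<le>o |C|"
    and U: "|U| \<le>o |C|"
  shows "|{\<phi>. wf_fm L \<phi> \<and> set3_fm \<phi> \<subseteq> U}| \<le>o |C|"
proof -
  have empty: "|{}| \<le>o |C|" by (rule card_of_empty)
  have single: "|{x}| \<le>o |C|" for x using inf by (intro ordLess_imp_ordLeq) (simp add: finite_ordLess_infinite2)
  have "|term_stage L U n| \<le>o |C|" for n
  proof (induction n)
    case 0
    show ?case unfolding term_stage.simps by (rule empty)
  next
    case (Suc n)
    show ?case
      unfolding term_stage.simps
      by (intro card_of_Un_ordLeq_infinite[OF inf] card_of_image_ordLeq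
          card_of_Times_ordLeq_infinite[OF inf] card_of_lists_ordLeq[OF inf] Suc U f)
  qed
  then have T: "|\<Union>n. term_stage L U n| \<le>o |C|" by (rule card_of_UN_nat_ordLeq[OF inf])
  have "|formula_stage L U n| \<le>o |C|" for n
  proof (induction n)
    case 0
    show ?case
      unfolding formula_stage.simps Let_def
      by (intro card_of_Un_ordLeq_infinite[OF inf] card_of_image_ordLeq single
          card_of_Times_ordLeq_infinite[OF inf] card_of_lists_ordLeq[OF inf] T r)
  next
    case (Suc n)
    show ?case
      unfolding formula_stage.simps
      by (intro card_of_Un_ordLeq_infinite[OF inf] card_of_image_ordLeq
          card_of_Times_ordLeq_infinite[OF inf] Suc U)
  qed
  then have "|\<Union>n. formula_stage L U n| \<le>o |C|" by (rule card_of_UN_nat_ordLeq[OF inf])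
  moreover have "{\<phi>. wf_fm L \<phi> \<and> set3_fm \<phi> \<subseteq> U} \<subseteq> (\<Union>n. formula_stage L U n)"
    using formula_in_stage[of L _ U] by blast
  ultimately show ?thesis using card_of_mono1 ordLeq_transitive by blast
qed

lemma card_of_variables:
  assumes "infinite C" "|A| \<le>o |C|"
  shows "|range Inl \<union> (Inr ` A :: (nat + 'x) set)| \<le>o |C|"
  using assms by (intro card_of_Un_ordLeq_infinite card_of_image_ordLeq) (simp_all add: infinite_iff_card_of_nat)


subsection \<open>Small elementary submodels\<close>

definition witness :: "('f, 'r, 'm) struct \<Rightarrow> ('f, 'r, nat + 'm) fm \<Rightarrow> 'm" where
  "witness S \<phi> = (SOME x. sat S UNIV (case_sum (\<lambda>_. x) id) \<phi>)"

text \<open>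
  The variables \<open>Inr x\<close> stand for the parameters \<open>x\<close>. Bound variables are restricted as well, since otherwise there would
  be at least as many formulas as elements of the monster model.
\<close>

definition parameter_formulas :: "('f, 'r, 'm) struct \<Rightarrow> 'm set \<Rightarrow> ('f, 'r, nat + 'm) fm set" where
  "parameter_formulas S A = {\<phi>. wf_fm S \<phi> \<and> set3_fm \<phi> \<subseteq> range Inl \<union> Inr ` A}"

primrec hull_stage :: "('f, 'r, 'm) struct \<Rightarrow> 'm set \<Rightarrow> nat \<Rightarrow> 'm set" where
  "hull_stage S A 0 = A"
| "hull_stage S A (Suc n) = hull_stage S A n \<union> witness S ` parameter_formulas S (hull_stage S A n)"

lemma hull_stage_mono: "m \<le> n \<Longrightarrow> hull_stage S A m \<subseteq> hull_stage S A n"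
  by (rule lift_Suc_mono_le[of "hull_stage S A"]) auto

lemma witness_in_hull:
  fixes S :: "('f, 'r, 'm) struct" and \<phi> :: "('f, 'r, nat + 'm) fm"
  assumes "wf_fm S \<phi>" "set3_fm \<phi> \<subseteq> range Inl \<union> Inr ` X" "finite X" "X \<subseteq> (\<Union>n. hull_stage S A n)"
    and ex: "sat S UNIV (case_sum (\<lambda>_. x) id) \<phi>"
  shows "witness S \<phi> \<in> (\<Union>n. hull_stage S A n)" "sat S UNIV (case_sum (\<lambda>_. witness S \<phi>) id) \<phi>"
proof -
  obtain n where "X \<subseteq> hull_stage S A n"
    using finite_in_stage[OF assms(3,4) hull_stage_mono] by blast
  then have "\<phi> \<in> parameter_formulas S (hull_stage S A n)"
    using assms(1,2) unfolding parameter_formulas_def by blast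
  then have "witness S \<phi> \<in> hull_stage S A (Suc n)" by simp
  then show "witness S \<phi> \<in> (\<Union>n. hull_stage S A n)" by blast
  show "sat S UNIV (case_sum (\<lambda>_. witness S \<phi>) id) \<phi>"
    unfolding witness_def using ex by (rule someI)
qed

text \<open>
  The union of the stages satisfies the Tarski-Vaught criterion, as a formula has finitely many parameters, all in one stage. Closure
  under function symbols is the special case of the formula \<open>x = f(a\<^sub>1, \<dots>, a\<^sub>n)\<close>.
\<close>

lemma elementary_hull:
  fixes S :: "('f, 'r, 'm) struct"
  shows "elementary_sub S (\<Union>n. hull_stage S A n)"
proof -
  define M where "M = (\<Union>n. hull_stage S A n)"
  have M_ne: "M \<noteq> {}"
  proof -
    have "Bot \<in> parameter_formulas S (hull_stage S A 0)" by (simp add: parameter_formulas_def)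
    then have "witness S Bot \<in> hull_stage S A (Suc 0)" by simp
    then show ?thesis unfolding M_def by blast
  qed
  have M_fint: "fint S f xs \<in> M" if f: "farity S f = Some (length xs)" "set xs \<subseteq> M" for f xs
  proof -
    define \<phi> where "\<phi> = (Eq (Var (Inl 0)) (Fn f (map (\<lambda>x. Var (Inr x)) xs)) :: ('f, 'r, nat + 'm) fm)"
    have "wf_fm S \<phi>" using f(1) by (simp add: \<phi>_def list_all_iff)
    moreover have "set3_fm \<phi> \<subseteq> range Inl \<union> Inr ` set xs" by (auto simp: \<phi>_def)
    moreover have sat: "sat S UNIV (case_sum (\<lambda>_. x) id) \<phi> \<longleftrightarrow> x = fint S f xs" for x
      by (simp add: \<phi>_def comp_def)
    ultimately show ?thesis
      using witness_in_hull[of S \<phi> "set xs" A "fint S f xs"] f(2) unfolding M_def by simp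
  qed
  have tarski_vaught: "\<exists>x\<in>M. sat S UNIV (s(v := x)) \<phi>"
    if \<phi>: "wf_fm S \<phi>" and s: "range s \<subseteq> M" and y: "sat S UNIV (s(v := y)) \<phi>"
    for \<phi> :: "('f, 'r, nat) fm" and s v y
  proof -
    define \<rho> :: "nat \<Rightarrow> nat + 'm" where "\<rho> = (\<lambda>w. if w = v then Inl 0 else Inr (s w))"
    have inf: "infinite (range (Inl :: nat \<Rightarrow> nat + 'm))" by (rule range_inj_infinite) simp
    obtain \<psi> :: "('f, 'r, nat + 'm) fm" where \<psi>: "wf_fm S \<psi> = wf_fm S \<phi>"
      "set3_fm \<psi> \<subseteq> \<rho> ` fv \<phi> \<union> range Inl"
      "\<And>D t. sat S D (t :: nat + 'm \<Rightarrow> 'm) \<psi> = sat S D (\<lambda>w. t (\<rho> w)) \<phi>"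
      using sat_rename[OF inf, of S \<phi> \<rho>] by metis
    have sat: "sat S UNIV (case_sum (\<lambda>_. x) id) \<psi> = sat S UNIV (s(v := x)) \<phi>" for x
    proof -
      have "(\<lambda>w. case_sum (\<lambda>_. x) id (\<rho> w)) = s(v := x)" by (auto simp: \<rho>_def fun_eq_iff)
      then show ?thesis by (simp only: \<psi>(3))
    qed
    have "wf_fm S \<psi>" using \<psi>(1) \<phi> by simp
    moreover have "set3_fm \<psi> \<subseteq> range Inl \<union> Inr ` s ` fv \<phi>"
      using \<psi>(2) by (auto simp: \<rho>_def split: if_splits)
    moreover have "finite (s ` fv \<phi>)" by (simp add: finite_fv)
    moreover have "s ` fv \<phi> \<subseteq> (\<Union>n. hull_stage S A n)" using s unfolding M_def by blast
    moreover have "sat S UNIV (case_sum (\<lambda>_. y) id) \<psi>" unfolding sat by (rule y)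
    ultimately have "witness S \<psi> \<in> (\<Union>n. hull_stage S A n)"
      "sat S UNIV (case_sum (\<lambda>_. witness S \<psi>) id) \<psi>" by (rule witness_in_hull)+
    then show ?thesis unfolding sat M_def by blast
  qed
  have elem: "sat S M s \<phi> = sat S UNIV s \<phi>"
    if "wf_fm S \<phi>" "range s \<subseteq> M" for \<phi> :: "('f, 'r, nat) fm" and s
    using that
  proof (induction \<phi> arbitrary: s)
    case (All v \<phi>)
    have "sat S M (s(v := x)) \<phi> = sat S UNIV (s(v := x)) \<phi>" if "x \<in> M" for x
      by (rule All.IH) (use All.prems that in auto)
    then have "sat S M s (All v \<phi>) \<longleftrightarrow> (\<forall>x\<in>M. sat S UNIV (s(v := x)) \<phi>)" by simp
    also have "\<dots> \<longleftrightarrow> (\<forall>x. sat S UNIV (s(v := x)) \<phi>)"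
    proof
      assume all: "\<forall>x\<in>M. sat S UNIV (s(v := x)) \<phi>"
      show "\<forall>x. sat S UNIV (s(v := x)) \<phi>"
      proof (rule allI, rule ccontr)
        fix y assume "\<not> sat S UNIV (s(v := y)) \<phi>"
        then have "sat S UNIV (s(v := y)) (Imp \<phi> Bot)" by simp
        moreover have "wf_fm S (Imp \<phi> Bot)" using All.prems(1) by simp
        ultimately obtain x where "x \<in> M" "sat S UNIV (s(v := x)) (Imp \<phi> Bot)"
          using tarski_vaught All.prems(2) by blast
        then show False using all by simp
      qed
    qed simp
    finally show ?case by simp
  qed simp_all
  show ?thesis
    unfolding M_def[symmetric] elementary_sub_def using M_ne M_fint elem by blast
qed

lemma card_of_hull:
  fixes S :: "('f, 'r, 'm) struct"
  assumes inf: "infinite C" and f: "|dom (farity S)| \<le>o |C|" and r: "|dom (rarity S)| \<le>o |C|"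
    and A: "|A| \<le>o |C|"
  shows "|\<Union>n. hull_stage S A n| \<le>o |C|"
proof (rule card_of_UN_nat_ordLeq[OF inf])
  show "|hull_stage S A n| \<le>o |C|" for n
  proof (induction n)
    case (Suc n)
    have "|parameter_formulas S (hull_stage S A n)| \<le>o |C|"
      unfolding parameter_formulas_def
      by (rule card_of_formulas[OF inf f r card_of_variables[OF inf Suc]])
    then show ?case
      unfolding hull_stage.simps
      by (intro card_of_Un_ordLeq_infinite[OF inf] card_of_image_ordLeq Suc)
  qed (simp add: A)
qed

context over_hyperimaginary
begin

text \<open>
  There is a model of size \<open>|L| + \<aleph>\<^sub>0 + |I|\<close> containing a representative of \<open>e\<close>. A coset is determined by
  the type of the image of this model over the model, and there are at most \<open>2\<close> to the power \<open>|L| + \<aleph>\<^sub>0 + |I|\<close> such types.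
\<close>

lemma Small_Gal_L:
  assumes large: "sufficiently_large S \<kappa> I"
  shows "Small (proj_L S \<kappa> e ` Aut)"
proof -
  define C where "C = dom (farity S) <+> dom (rarity S) <+> (UNIV :: nat set) <+> I"
  have PC: "|Pow C| <o \<kappa>" using large by (simp add: sufficiently_large_def small_def C_def)
  have sC: "Small C" unfolding small_def using card_of_Pow[of C] PC by (rule ordLess_transitive)
  have inf: "infinite C" unfolding C_def by (simp add: finite_Plus_iff)
  have cf: "|dom (farity S)| \<le>o |C|" by (rule card_of_ordLeqI[of Inl]) (auto simp: C_def)
  have cr: "|dom (rarity S)| \<le>o |C|" by (rule card_of_ordLeqI[of "Inr \<circ> Inl"]) (auto simp: C_def inj_on_def)
  have cI: "|I| \<le>o |C|" by (rule card_of_ordLeqI[of "Inr \<circ> Inr \<circ> Inr"]) (auto simp: C_def inj_on_def)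
  obtain a where a: "a \<in> e" by (rule representative)
  have dom: "dom a = I" by (rule hyperimaginary_stabilizer(1)[OF e a])
  have "ran a = (\<lambda>i. the (a i)) ` I" unfolding dom[symmetric] by (force simp: ran_def dom_def)
  then have ca: "|ran a| \<le>o |C|" using card_of_image_ordLeq[OF cI] by simp
  define M where "M = (\<Union>n. hull_stage S (ran a) n)"
  have cM: "|M| \<le>o |C|" unfolding M_def by (rule card_of_hull[OF inf cf cr ca])
  have sM: "Small M" using cM sC unfolding small_def by (rule ordLeq_ordLess_trans)
  have M: "small_model S \<kappa> M"
    unfolding small_model_def using sM elementary_hull[of S "ran a"] by (simp add: M_def)
  have "hull_stage S (ran a) 0 \<subseteq> M" unfolding M_def by blast
  then have aM: "ran a \<subseteq> M" by simp
  have dcl: "in_dcl S e M"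
    unfolding in_dcl_def
  proof (intro ballI impI)
    fix f assume f: "f \<in> aut S" "\<forall>x\<in>M. f x = x"
    then have "act f a = act id a" using aM by (subst act_eq_iff) auto
    moreover obtain E a0 where E: "type_definable_equiv S I E" "dom a0 = I" "e = E `` {a0}"
      using e unfolding hyperimaginary_def by blast
    have eqv: "equiv {a. dom a = I} E" using E(1) by (simp add: type_definable_equiv_def)
    have ea: "e = E `` {a}" using equiv_class_eq[OF eqv, of a0 a] a E(3) by simp
    have "(a, a) \<in> E" using equiv_class_self[OF eqv, of a] dom by simp
    ultimately show "fixes_hyp f e"
      unfolding ea using fixes_hyp_iff[OF E(1) dom f(1)] by (simp add: act_id)
  qed
  define V where "V = {0, 1 :: nat} \<times> M"
  have inf_nat: "infinite (range (Inl :: nat \<Rightarrow> nat + nat \<times> 'm))" by (rule range_inj_infinite) simp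
  have sV: "Small V" unfolding V_def by (intro Small_Times Small_finite sM) simp
  define \<F> where "\<F> = {\<phi> :: ('f, 'r, nat + nat \<times> 'm) fm. wf_fm S \<phi> \<and> set3_fm \<phi> \<subseteq> range Inl \<union> Inr ` V}"
  have cV: "|V| \<le>o |C|"
    unfolding V_def
    by (rule card_of_Times_ordLeq_infinite[OF inf _ cM])
      (use inf in \<open>simp add: ordLess_imp_ordLeq finite_ordLess_infinite2\<close>)
  have "|\<F>| \<le>o |C|"
    unfolding \<F>_def by (rule card_of_formulas[OF inf cf cr card_of_variables[OF inf cV]])
  then have cF: "|Pow \<F>| \<le>o |Pow C|" by (rule card_of_Pow_mono)
  define \<tau> where "\<tau> f = {\<phi> \<in> \<F>. sat S UNIV (case_sum (\<lambda>_. undefined) (case_prod (seq2 id f))) \<phi>}" for f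
  have \<tau>: "proj_L S \<kappa> e f = proj_L S \<kappa> e g" if fg: "f \<in> Aut" "g \<in> Aut" and eq: "\<tau> f = \<tau> g" for f g
  proof -
    have sub: "P (case_prod (seq2 id g))"
      if P: "definable S V P" "P (case_prod (seq2 id f))" for P :: "(nat \<times> 'm \<Rightarrow> 'm) \<Rightarrow> bool"
    proof -
      obtain \<phi> :: "('f, 'r, nat \<times> 'm) fm" where \<phi>: "wf_fm S \<phi>" "fv \<phi> \<subseteq> V" "\<And>s. P s = sat S UNIV s \<phi>"
        using P(1) by (rule definableE) blast
      obtain \<psi> :: "('f, 'r, nat + nat \<times> 'm) fm" where \<psi>: "wf_fm S \<psi> = wf_fm S \<phi>"
        "set3_fm \<psi> \<subseteq> Inr ` fv \<phi> \<union> range Inl"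
        "\<And>D t. sat S D (t :: nat + nat \<times> 'm \<Rightarrow> 'm) \<psi> = sat S D (\<lambda>w. t (Inr w)) \<phi>"
        using sat_rename[OF inf_nat, of S \<phi> Inr] by metis
      have "\<psi> \<in> \<F>" using \<psi>(1,2) \<phi>(1,2) unfolding \<F>_def by blast
      then have "\<psi> \<in> \<tau> h \<longleftrightarrow> P (case_prod (seq2 id h))" for h
        unfolding \<tau>_def \<phi>(3) by (simp add: \<psi>(3))
      then show ?thesis using P(2) eq by blast
    qed
    obtain k where k: "k \<in> aut S" "\<And>w. w \<in> V \<Longrightarrow> k (case_prod (seq2 id f) w) = case_prod (seq2 id g) w"
    proof (rule homogeneous[OF infinite_vars sV, of "case_prod (seq2 id f)" "case_prod (seq2 id g)"])
      fix P :: "(nat \<times> 'm \<Rightarrow> 'm) \<Rightarrow> bool"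
      assume "definable S V P" "P (case_prod (seq2 id f))"
      then show "P (case_prod (seq2 id g))" by (rule sub)
    qed (rule that)
    have k0: "k x = x" if "x \<in> M" for x using k(2)[of "(0, x)"] that by (simp add: V_def seq2_def)
    have k1: "k (f x) = g x" if "x \<in> M" for x using k(2)[of "(1, x)"] that by (simp add: V_def seq2_def)
    have "\<exists>n\<in>Autf. g = n \<circ> f"
      by (rule coset_of_agreement[OF Aut_subgroup Autf_subgroup Autf_conj fixing_Autf[OF M dcl] fg k(1) k0 k1])
    then show ?thesis using proj_L_eq_iff[OF fg(2)] by blast
  qed
  define sel where "sel t = (SOME f. f \<in> Aut \<and> \<tau> f = t)" for t
  have "proj_L S \<kappa> e f = proj_L S \<kappa> e (sel (\<tau> f))" if f: "f \<in> Aut" for f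
  proof -
    have "sel (\<tau> f) \<in> Aut \<and> \<tau> (sel (\<tau> f)) = \<tau> f"
      unfolding sel_def by (rule someI[where P = "\<lambda>g. g \<in> Aut \<and> \<tau> g = \<tau> f" and x = f]) (simp add: f)
    then show ?thesis using \<tau>[of f "sel (\<tau> f)"] f by simp
  qed
  then have "proj_L S \<kappa> e ` Aut \<subseteq> (\<lambda>t. proj_L S \<kappa> e (sel t)) ` Pow \<F>"
    by (auto simp: \<tau>_def)
  moreover have "Small (Pow \<F>)" using cF PC unfolding small_def by (rule ordLeq_ordLess_trans)
  ultimately show ?thesis using Small_subset[OF Small_image] by metis
qed

end


section \<open>Spaces of types as spaces of automorphisms\<close>

text \<open>
  The sets given by one formula are a basis and not only a subbasis because types contain the conjunctions of their formulas.
\<close>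

lemma logic_topology_basis:
  assumes P: "P \<subseteq> {tp S a A | a. dom a = D}" and U: "openin (logic_topology P) U" and p: "p \<in> U"
  obtains \<phi> where "\<phi> \<in> p" "{q \<in> P. \<phi> \<in> q} \<subseteq> U"
proof -
  have top: "topspace (logic_topology P) = P" using P by (intro topspace_logic_topology_tp) blast
  have conj: "\<exists>\<chi>. \<chi> \<in> p \<and> {q \<in> P. \<chi> \<in> q} \<subseteq> {q \<in> P. \<phi> \<in> q} \<inter> {q \<in> P. \<psi> \<in> q}"
    if p: "p \<in> P" "\<phi> \<in> p" "\<psi> \<in> p" for p \<phi> \<psi>
  proof (intro exI conjI)
    define \<chi> where "\<chi> = Imp (Imp \<phi> (Imp \<psi> Bot)) Bot"
    have \<chi>: "\<chi> \<in> q \<longleftrightarrow> \<phi> \<in> q \<and> \<psi> \<in> q" if q: "q \<in> P" for q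
    proof -
      obtain a where "q = tp S a A" using q P by blast
      then show ?thesis by (auto simp: tp_def \<chi>_def formulas_def holds_def)
    qed
    show "\<chi> \<in> p" using \<chi>[OF p(1)] p(2,3) by simp
    show "{q \<in> P. \<chi> \<in> q} \<subseteq> {q \<in> P. \<phi> \<in> q} \<inter> {q \<in> P. \<psi> \<in> q}" using \<chi> by blast
  qed
  have "generate_topology_on {{p \<in> P. \<phi> \<in> p} | \<phi>. True} U"
    using U unfolding logic_topology_def by (rule openin_topology_generated_by)
  then have "\<forall>p\<in>P. p \<in> U \<longrightarrow> (\<exists>\<phi>. \<phi> \<in> p \<and> {q \<in> P. \<phi> \<in> q} \<subseteq> U)"
  proof (induction rule: generate_topology_on.induct)
    case (Int X Y)
    show ?case
    proof (intro ballI impI)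
      fix p assume p: "p \<in> P" "p \<in> X \<inter> Y"
      then obtain \<phi> \<psi> where "\<phi> \<in> p" "{q \<in> P. \<phi> \<in> q} \<subseteq> X" "\<psi> \<in> p" "{q \<in> P. \<psi> \<in> q} \<subseteq> Y"
        using Int.IH by blast
      then show "\<exists>\<phi>. \<phi> \<in> p \<and> {q \<in> P. \<phi> \<in> q} \<subseteq> X \<inter> Y" using conj[OF p(1), of \<phi> \<psi>] by blast
    qed
  next
    case (UN K)
    then show ?case by (meson Union_iff Union_upper subset_trans)
  qed auto
  moreover have "p \<in> P" using openin_subset[OF U] p top by blast
  ultimately show thesis using p that by blast
qed

lemma closedin_logic_topology:
  assumes P: "P \<subseteq> {tp S a A | a. dom a = D}"
  shows "closedin (logic_topology P) Y \<longleftrightarrow>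
    Y \<subseteq> P \<and> (\<forall>p\<in>P. (\<forall>\<phi>\<in>p. \<exists>q\<in>Y. \<phi> \<in> q) \<longrightarrow> p \<in> Y)"
proof -
  have top: "topspace (logic_topology P) = P" using P by (intro topspace_logic_topology_tp) blast
  show ?thesis
    unfolding closedin_def top
  proof (rule conj_cong[OF refl])
    assume YP: "Y \<subseteq> P"
    show "openin (logic_topology P) (P - Y) \<longleftrightarrow> (\<forall>p\<in>P. (\<forall>\<phi>\<in>p. \<exists>q\<in>Y. \<phi> \<in> q) \<longrightarrow> p \<in> Y)"
    proof
      assume op: "openin (logic_topology P) (P - Y)"
      show "\<forall>p\<in>P. (\<forall>\<phi>\<in>p. \<exists>q\<in>Y. \<phi> \<in> q) \<longrightarrow> p \<in> Y"
      proof (intro ballI impI, rule ccontr)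
        fix p assume p: "p \<in> P" "\<forall>\<phi>\<in>p. \<exists>q\<in>Y. \<phi> \<in> q" "p \<notin> Y"
        then obtain \<phi> where "\<phi> \<in> p" "{q \<in> P. \<phi> \<in> q} \<subseteq> P - Y"
          using logic_topology_basis[OF P op, of p] by blast
        then show False using p(2) YP by blast
      qed
    next
      assume lim: "\<forall>p\<in>P. (\<forall>\<phi>\<in>p. \<exists>q\<in>Y. \<phi> \<in> q) \<longrightarrow> p \<in> Y"
      have "P - Y = \<Union>{{p \<in> P. \<phi> \<in> p} | \<phi>. {p \<in> P. \<phi> \<in> p} \<inter> Y = {}}"
      proof (intro equalityI subsetI)
        fix p assume p: "p \<in> P - Y"
        then obtain \<phi> where \<phi>: "\<phi> \<in> p" "\<forall>q\<in>Y. \<phi> \<notin> q" using lim by blast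
        then have "{p \<in> P. \<phi> \<in> p} \<inter> Y = {}" by blast
        moreover have "p \<in> {p \<in> P. \<phi> \<in> p}" using p \<phi>(1) by blast
        ultimately show "p \<in> \<Union>{{p \<in> P. \<phi> \<in> p} | \<phi>. {p \<in> P. \<phi> \<in> p} \<inter> Y = {}}" by blast
      qed blast
      moreover have "openin (logic_topology P) {p \<in> P. \<phi> \<in> p}" for \<phi>
        unfolding logic_topology_def by (rule topology_generated_by_Basis) blast
      ultimately show "openin (logic_topology P) (P - Y)" by (auto intro: openin_Union)
    qed
  qed
qed

text \<open>
  The logic topology on the types over \<open>t\<close> of the images of \<open>t\<close> has the same limit points as the topology on automorphisms.
\<close>

lemma tp_act_limit_points:
  fixes S :: "('f, 'r, 'm) struct" and t :: "'i \<rightharpoonup> 'm"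
  assumes g: "g \<in> aut S"
  shows "(\<forall>\<phi>\<in>tp S (act g t) (ran t). \<exists>x\<in>X. \<phi> \<in> tp S (act x t) (ran t)) \<longleftrightarrow>
    g \<in> limit_points S (ran t) X"
proof
  assume lim: "\<forall>\<phi>\<in>tp S (act g t) (ran t). \<exists>x\<in>X. \<phi> \<in> tp S (act x t) (ran t)"
  show "g \<in> limit_points S (ran t) X"
  proof (rule limit_pointsI[OF g])
    fix P assume P: "definable S ({0, 1} \<times> ran t) P" "P (case_prod (seq2 id g))"
    define sel where "sel m = (SOME i. t i = Some m)" for m
    have sel: "t (sel m) = Some m" if "m \<in> ran t" for m
      using that unfolding sel_def ran_def by (auto intro: someI)
    define \<rho> :: "nat \<times> 'm \<Rightarrow> 'i + 'm" where "\<rho> = (\<lambda>(n, m). if n = 0 then Inr m else Inl (sel m))"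
    obtain \<phi> where \<phi>: "\<phi> \<in> formulas S (\<rho> ` ({0, 1} \<times> ran t))" "\<And>a. holds S a \<phi> = P (\<lambda>v. the (a (\<rho> v)))"
      using definable_formula[OF P(1), of \<rho>] by blast
    have "\<rho> ` ({0, 1} \<times> ran t) \<subseteq> dom t <+> ran t" using sel by (force simp: \<rho>_def)
    then have \<phi>F: "\<phi> \<in> formulas S (dom t <+> ran t)" using \<phi>(1) unfolding formulas_def by blast
    have \<phi>P: "\<phi> \<in> tp S (act x t) (ran t) \<longleftrightarrow> P (case_prod (seq2 id x))" for x
    proof -
      have "P (\<lambda>v. the (case_sum (act x t) Some (\<rho> v))) = P (case_prod (seq2 id x))"
        by (rule definable_cong[OF P(1)]) (auto simp: \<rho>_def seq2_def act_def sel)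
      then show ?thesis using \<phi>F \<phi>(2) by (simp add: tp_def dom_act)
    qed
    then show "\<exists>x\<in>X. P (case_prod (seq2 id x))" using lim P(2) by blast
  qed
next
  assume lim: "g \<in> limit_points S (ran t) X"
  show "\<forall>\<phi>\<in>tp S (act g t) (ran t). \<exists>x\<in>X. \<phi> \<in> tp S (act x t) (ran t)"
  proof
    fix \<phi> assume \<phi>: "\<phi> \<in> tp S (act g t) (ran t)"
    then have \<phi>F: "\<phi> \<in> formulas S (dom t <+> ran t)" by (simp add: tp_def dom_act)
    define \<rho> where "\<rho> = case_sum (\<lambda>i. (1 :: nat, the (t i))) (\<lambda>m. (0, m))"
    define P where "P = (\<lambda>s :: nat \<times> 'm \<Rightarrow> 'm. holds S (\<lambda>i. Some (s (\<rho> i))) \<phi>)"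
    have "definable S (\<rho> ` (dom t <+> ran t)) P"
      unfolding P_def using \<phi>F infinite_vars by (rule definable_holds)
    moreover have "\<rho> ` (dom t <+> ran t) \<subseteq> {0, 1} \<times> ran t"
      by (auto simp: \<rho>_def ran_def)
    ultimately have dP: "definable S ({0, 1} \<times> ran t) P" by (rule definable_mono)
    have P: "\<phi> \<in> tp S (act x t) (ran t) \<longleftrightarrow> P (case_prod (seq2 id x))" for x
    proof -
      have "holds S (\<lambda>i. Some (case_prod (seq2 id x) (\<rho> i))) \<phi> = holds S (case_sum (act x t) Some) \<phi>"
        using \<phi>F by (rule holds_cong) (auto simp: \<rho>_def seq2_def act_def)
      then show ?thesis using \<phi>F by (simp add: tp_def dom_act P_def)
    qed
    show "\<exists>x\<in>X. \<phi> \<in> tp S (act x t) (ran t)"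
      using limit_pointsD[OF lim dP] \<phi> unfolding P by blast
  qed
qed

context monster_model
begin

lemma limit_point_singleton:
  assumes B: "Small B" and g: "g \<in> limit_points S B {h}"
  obtains k where "k \<in> aut S" "\<And>z. z \<in> B \<Longrightarrow> k z = z" "\<And>z. z \<in> B \<Longrightarrow> k (g z) = h z"
proof -
  define V where "V = {0, 1 :: nat} \<times> B"
  have sV: "Small V" unfolding V_def by (intro Small_Times Small_finite B) simp
  obtain k where k: "k \<in> aut S" "\<And>w. w \<in> V \<Longrightarrow> k (case_prod (seq2 id g) w) = case_prod (seq2 id h) w"
  proof (rule homogeneous[OF infinite_vars sV, of "case_prod (seq2 id g)" "case_prod (seq2 id h)"])
    fix P :: "(nat \<times> 'm \<Rightarrow> 'm) \<Rightarrow> bool"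
    assume "definable S V P" "P (case_prod (seq2 id g))"
    then have "\<exists>x\<in>{h}. P (case_prod (seq2 id x))" unfolding V_def by (rule limit_pointsD[OF g])
    then show "P (case_prod (seq2 id h))" by simp
  qed (rule that)
  show thesis
  proof (rule that[OF k(1)])
    show "k z = z" if "z \<in> B" for z using k(2)[of "(0, z)"] that by (simp add: V_def seq2_def)
    show "k (g z) = h z" if "z \<in> B" for z using k(2)[of "(1, z)"] that by (simp add: V_def seq2_def)
  qed
qed

text \<open>
  The groups of Lascar strong types are defined by the logic topology on the types of images of one tuple \<open>t\<close>. If \<open>K\<close> contains the
  pointwise stabilizer of \<open>t\<close>, the coset of an automorphism depends on the type of the image of \<open>t\<close> alone, and the
  quotient topology is the one given by closed unions of cosets.
\<close>

lemma galois_quotientI: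
  fixes t :: "'i \<rightharpoonup> 'm" and \<pi> :: "('m \<Rightarrow> 'm) \<Rightarrow> 'q"
  defines "B \<equiv> ran t"
  assumes G: "aut_subgroup S G" and K: "aut_subgroup S K" and KG: "K \<subseteq> G"
    and cl: "closed_on S A G" "Small A"
    and normal: "\<And>k g. k \<in> K \<Longrightarrow> g \<in> G \<Longrightarrow> g \<circ> (k \<circ> ginv g) \<in> K"
    and B: "Small B" and fixing: "\<And>h. h \<in> aut S \<Longrightarrow> (\<And>z. z \<in> B \<Longrightarrow> h z = z) \<Longrightarrow> h \<in> K"
    and \<pi>: "\<And>f g. f \<in> G \<Longrightarrow> g \<in> G \<Longrightarrow> \<pi> f = \<pi> g \<longleftrightarrow> (\<exists>k\<in>K. g = k \<circ> f)"
  shows "galois_quotient T S \<kappa> G K B \<pi> (quotient_topology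
    (logic_topology {tp S (act g t) B | g. g \<in> G})
    (\<lambda>p. THE C. \<exists>g\<in>G. p = tp S (act g t) B \<and> C = \<pi> g))"
proof -
  define P where "P = {tp S (act g t) B | g. g \<in> G}"
  define q where "q = (\<lambda>p. THE C. \<exists>g\<in>G. p = tp S (act g t) B \<and> C = \<pi> g)"
  note Ga = aut_subgroup_aut[OF G]
  have wd: "\<pi> f = \<pi> g" if fg: "f \<in> G" "g \<in> G" and eq: "tp S (act f t) B = tp S (act g t) B" for f g
  proof -
    have "f \<in> limit_points S B {g}"
      unfolding B_def by (subst tp_act_limit_points[OF Ga[OF fg(1)], symmetric]) (use eq B_def in simp)
    then obtain k where k: "k \<in> aut S" "\<And>z. z \<in> B \<Longrightarrow> k z = z" "\<And>z. z \<in> B \<Longrightarrow> k (f z) = g z"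
      by (rule limit_point_singleton[OF B]) (rule that)
    have "\<exists>n\<in>K. g = n \<circ> f" by (rule coset_of_agreement[OF G K normal fixing fg k])
    then show ?thesis using \<pi>[OF fg] by blast
  qed
  have q: "q (tp S (act g t) B) = \<pi> g" if g: "g \<in> G" for g
    unfolding q_def by (rule the_equality) (use g wd in blast)+
  have Pim: "P = (\<lambda>g. tp S (act g t) B) ` G" unfolding P_def by blast
  have PD: "P \<subseteq> {tp S a B | a. dom a = dom t}"
  proof
    fix p assume "p \<in> P"
    then obtain g where g: "p = tp S (act g t) B" unfolding Pim by (elim imageE)
    have "dom (act g t) = dom t" by (rule dom_act)
    with g show "p \<in> {tp S a B | a. dom a = dom t}" by blast
  qed
  have topP: "topspace (logic_topology P) = P" using PD by (intro topspace_logic_topology_tp) blast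
  have qP: "q ` P = \<pi> ` G" unfolding Pim image_image by (rule image_cong[OF refl q])
  have quo: "quotient_map (logic_topology P) (quotient_topology (logic_topology P) q) q"
    by (rule quotient_map_quotient_topology)
  have top: "topspace (quotient_topology (logic_topology P) q) = \<pi> ` G"
    using quo qP topP by (simp add: quotient_map_def)
  have clG: "closed_on S B G"
  proof (rule closed_on_support)
    show "B \<subseteq> A \<union> B" "Small (A \<union> B)" using cl(2) B by (auto intro: Small_Un)
    show "closed_on S (A \<union> B) G" using cl(1) by (rule closed_on_mono) simp
    show "h \<circ> x \<in> G \<and> x \<circ> h \<in> G" if "x \<in> G" "h \<in> aut S" "\<And>z. z \<in> B \<Longrightarrow> h z = z" for x h
      using fixing[OF that(2,3)] KG that(1) aut_subgroup_comp[OF G] by blast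
  qed
  have "closedin (quotient_topology (logic_topology P) q) C \<longleftrightarrow>
      C \<subseteq> \<pi> ` G \<and> closed_on S B {g \<in> G. \<pi> g \<in> C}" for C
  proof (cases "C \<subseteq> \<pi> ` G")
    case True
    define Y where "Y = {g \<in> G. \<pi> g \<in> C}"
    have memY: "tp S (act g t) B \<in> {x \<in> P. q x \<in> C} \<longleftrightarrow> g \<in> Y" if "g \<in> G" for g
      using q[OF that] that unfolding Y_def P_def by auto
    have ex: "(\<exists>p\<in>{x \<in> P. q x \<in> C}. \<phi> \<in> p) \<longleftrightarrow> (\<exists>x\<in>Y. \<phi> \<in> tp S (act x t) B)" for \<phi>
    proof
      assume "\<exists>p\<in>{x \<in> P. q x \<in> C}. \<phi> \<in> p"
      then obtain g where "g \<in> G" "tp S (act g t) B \<in> {x \<in> P. q x \<in> C}" "\<phi> \<in> tp S (act g t) B"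
        unfolding Pim by auto
      then show "\<exists>x\<in>Y. \<phi> \<in> tp S (act x t) B" using memY[of g] by blast
    next
      assume "\<exists>x\<in>Y. \<phi> \<in> tp S (act x t) B"
      then obtain x where x: "x \<in> Y" "\<phi> \<in> tp S (act x t) B" by blast
      then have "x \<in> G" by (simp add: Y_def)
      then have "tp S (act x t) B \<in> {x \<in> P. q x \<in> C}" using memY x(1) by blast
      then show "\<exists>p\<in>{x \<in> P. q x \<in> C}. \<phi> \<in> p" using x(2) by (rule rev_bexI)
    qed
    have "closedin (quotient_topology (logic_topology P) q) C \<longleftrightarrow>
        closedin (logic_topology P) {x \<in> P. q x \<in> C}"
      using quo True top topP unfolding quotient_map_closedin by simp
    also have "\<dots> \<longleftrightarrow> (\<forall>p\<in>P. (\<forall>\<phi>\<in>p. \<exists>x\<in>Y. \<phi> \<in> tp S (act x t) B) \<longrightarrow> p \<in> {x \<in> P. q x \<in> C})"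
      unfolding closedin_logic_topology[OF PD] ex by blast
    also have "\<dots> \<longleftrightarrow> (\<forall>g\<in>G. (\<forall>\<phi>\<in>tp S (act g t) B. \<exists>x\<in>Y. \<phi> \<in> tp S (act x t) B) \<longrightarrow> g \<in> Y)"
      using memY unfolding Pim ball_simps by simp
    also have "\<dots> \<longleftrightarrow> (\<forall>g\<in>G. g \<in> limit_points S B Y \<longrightarrow> g \<in> Y)"
      unfolding B_def
      by (rule ball_cong[OF refl], rule imp_cong[OF _ refl]) (rule tp_act_limit_points[OF Ga])
    also have "\<dots> \<longleftrightarrow> closed_on S B Y"
    proof
      assume lim: "\<forall>g\<in>G. g \<in> limit_points S B Y \<longrightarrow> g \<in> Y"
      have YG: "Y \<subseteq> G" by (auto simp: Y_def)
      have "limit_points S B Y \<subseteq> G"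
        using limit_points_mono[OF YG order_refl, of S B] closed_onD[OF clG] by blast
      then show "closed_on S B Y" using lim YG Ga unfolding closed_on_def by blast
    qed (use closed_onD in blast)
    finally show ?thesis using True by (simp add: Y_def)
  next
    case False
    then show ?thesis using closedin_subset[of "quotient_topology (logic_topology P) q" C] top by blast
  qed
  then show ?thesis
    unfolding P_def[symmetric] q_def[symmetric]
    by unfold_locales (use G K KG clG normal B fixing \<pi> in blast)+
qed

end

lemma (in over_hyperimaginary) galois_quotient_Gal_L:
  assumes "small_model S \<kappa> M" "in_dcl S e M"
  shows "galois_quotient T S \<kappa> Aut Autf M (proj_L S \<kappa> e) (Gal_L_top S \<kappa> e M)"
proof -
  have ran: "ran (Some |` M) = M" by (auto simp: ran_def restrict_map_def)
  obtain A where A: "Small A" "closed_on S A Aut" by (rule closed_Aut)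
  have "Small M" using assms(1) by (simp add: small_model_def)
  have "galois_quotient T S \<kappa> Aut Autf (ran (Some |` M)) (proj_L S \<kappa> e) (quotient_topology
    (logic_topology {tp S (act g (Some |` M)) (ran (Some |` M)) | g. g \<in> Aut})
    (\<lambda>p. THE C. \<exists>g\<in>Aut. p = tp S (act g (Some |` M)) (ran (Some |` M)) \<and> C = proj_L S \<kappa> e g))"
  proof (rule galois_quotientI[OF Aut_subgroup Autf_subgroup _ A(2,1) Autf_conj])
    show "Autf \<subseteq> Aut" using Autf_Aut by blast
    show "Small (ran (Some |` M))" unfolding ran by fact
    show "h \<in> Autf" if "h \<in> aut S" "\<And>z. z \<in> ran (Some |` M) \<Longrightarrow> h z = z" for h
      using that unfolding ran by (rule fixing_Autf[OF assms])
    show "proj_L S \<kappa> e f = proj_L S \<kappa> e g \<longleftrightarrow> (\<exists>k\<in>Autf. g = k \<circ> f)" if "f \<in> Aut" "g \<in> Aut" for f g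
      by (rule proj_L_eq_iff[OF that(2)])
  qed
  then show ?thesis unfolding ran Gal_L_top_def .
qed


section \<open>Relativized Lascar groups\<close>

lemma flat_act: "flat (act (act f) c) = act f (flat c)"
proof (rule ext, clarify)
  fix i j
  show "flat (act (act f) c) (i, j) = act f (flat c) (i, j)"
    by (cases "c i") (simp_all add: flat_def act_def)
qed

lemma act_comp_fun: "act (f \<circ> g) = act f \<circ> act g"
  by (rule ext) (simp add: act_comp)

lemma act_id_fun: "act id = id"
  by (rule ext) (simp add: act_id)

lemma act2_comp: "act (act (f \<circ> g)) c = act (act f) (act (act g) c)"
  by (simp only: act_comp_fun o_apply)

lemma act2_id: "act (act id) c = c"
  by (simp only: act_id_fun id_apply)

lemma ran_flat: "ran (flat c) = \<Union>(ran ` ran c)"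
proof (intro equalityI subsetI)
  fix x assume "x \<in> ran (flat c)"
  then obtain i j where "flat c (i, j) = Some x" by (auto simp: ran_def)
  then obtain t where "c i = Some t" "t j = Some x" by (cases "c i") (auto simp: flat_def)
  then show "x \<in> \<Union>(ran ` ran c)" by (auto simp: ran_def)
next
  fix x assume "x \<in> \<Union>(ran ` ran c)"
  then obtain t i j where "c i = Some t" "t j = Some x" by (auto simp: ran_def)
  then have "flat c (i, j) = Some x" by (simp add: flat_def)
  then show "x \<in> ran (flat c)" by (rule ranI)
qed

lemma act2_eq_iff: "act (act f) c = act (act g) c \<longleftrightarrow> (\<forall>x\<in>ran (flat c). f x = g x)"
  by (simp add: act_eq_iff ran_flat)

lemma act2_fixes: "(\<And>x. x \<in> ran (flat c) \<Longrightarrow> f x = x) \<Longrightarrow> act (act f) c = c"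
  using act2_eq_iff[of f c id] by (simp add: act2_id)

context monster_model
begin

lemma Small_flat:
  assumes "Small J" "\<And>z. z \<in> Z \<Longrightarrow> dom z = J" "tuple_of \<kappa> Z c"
  shows "Small (dom (flat c))" "Small (ran (flat c))"
proof -
  have "dom (flat c) \<subseteq> dom c \<times> J"
  proof
    fix w assume "w \<in> dom (flat c)"
    then obtain i j x where w: "w = (i, j)" "flat c (i, j) = Some x" by (cases w) auto
    then obtain t where t: "c i = Some t" "t j = Some x" by (cases "c i") (auto simp: flat_def)
    then have "t \<in> Z" using assms(3) by (auto simp: tuple_of_def ran_def)
    then show "w \<in> dom c \<times> J" using t w(1) assms(2) by auto
  qed
  moreover have "Small (dom c \<times> J)" using assms(1,3) by (auto simp: tuple_of_def intro: Small_Times)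
  ultimately show sd: "Small (dom (flat c))" using Small_subset by blast
  have "ran (flat c) = (\<lambda>i. the (flat c i)) ` dom (flat c)" by (force simp: ran_def dom_def)
  then show "Small (ran (flat c))" using Small_image[OF sd] by metis
qed

end

locale relativized = over_hyperimaginary T S \<kappa> I e
  for T :: "('f, 'r, nat) fm set" and S :: "('f, 'r, 'm) struct" and \<kappa> :: "'k rel"
    and I :: "'i set" and e :: "('i \<rightharpoonup> 'm) set" +
  fixes J :: "'j set" and Z :: "('j \<rightharpoonup> 'm) set" and b :: "'k \<rightharpoonup> ('j \<rightharpoonup> 'm)" and M :: "'m set"
  assumes large: "sufficiently_large S \<kappa> I" and M: "small_model S \<kappa> M" "in_dcl S e M"
    and J: "Small J" and dom_Z: "z \<in> Z \<Longrightarrow> dom z = J" and invariant: "invariant_over S e Z"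
    and Lascar: "Lascar_tuple S \<kappa> e Z b" and dcl_b: "in_dcl S e (ran (flat b))"
begin

lemma act_Z: "f \<in> Aut \<Longrightarrow> z \<in> Z \<Longrightarrow> act f z \<in> Z"
  using invariant unfolding invariant_over_def by blast

lemma tuple_b: "tuple_of \<kappa> Z b"
  using Lascar by (simp add: Lascar_tuple_def)

lemma tuple_act:
  assumes f: "f \<in> Aut" and c: "tuple_of \<kappa> Z c"
  shows "tuple_of \<kappa> Z (act (act f) c)"
proof -
  have "ran (act (act f) c) \<subseteq> act f ` ran c" by (auto simp: ran_def act_def)
  then show ?thesis using c act_Z[OF f] by (auto simp: tuple_of_def dom_act)
qed

lemma act_restrict:
  assumes "tuple_of \<kappa> Z c"
  shows "act (restrict (act f) Z) c = act (act f) c"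
  using assms by (subst act_eq_iff) (auto simp: tuple_of_def)

text \<open>
  The automorphisms whose restriction to \<open>Z\<close> is Lascar strong. Working with this subgroup of \<open>Aut\<close> makes the
  relativized group a quotient of the same group \<open>Aut\<close> as the unrelativized one.
\<close>

definition K :: "('m \<Rightarrow> 'm) set" where
  "K = {f \<in> Aut. \<exists>n\<in>Autf. act (act n) b = act (act f) b}"

lemma restrict_Autf_rel:
  assumes f: "f \<in> Aut"
  shows "restrict (act f) Z \<in> Autf_rel S \<kappa> e Z \<longleftrightarrow> f \<in> K"
proof -
  have "restrict (act f) Z \<in> Aut_rel S e Z" using f by (auto simp: Aut_rel_def)
  then show ?thesis
    using Lascar f unfolding Lascar_tuple_def K_def equiv_L_def conj_by_def
    by (simp add: act_restrict[OF tuple_b])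
qed

text \<open>
  This is where \<open>b\<close> being a Lascar tuple matters: the condition on \<open>b\<close> that defines \<open>K\<close> entails the same condition for every
  tuple of realizations.
\<close>

lemma K_tuple:
  assumes k: "k \<in> K" and c: "tuple_of \<kappa> Z c"
  obtains n where "n \<in> Autf" "act (act n) c = act (act k) c"
proof -
  have "k \<in> Aut" using k by (simp add: K_def)
  then have "restrict (act k) Z \<in> Autf_rel S \<kappa> e Z" using restrict_Autf_rel k by simp
  then have "equiv_L S \<kappa> e c (act (restrict (act k) Z) c)" using c unfolding Autf_rel_def by blast
  then show thesis
    using that unfolding equiv_L_def conj_by_def act_restrict[OF c] by blast
qed

lemma Autf_K: "n \<in> Autf \<Longrightarrow> n \<in> K"
  using Autf_Aut by (auto simp: K_def)

lemma KI:
  assumes "f \<in> Aut" "n \<in> Autf" "act (act n) b = act (act f) b"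
  shows "f \<in> K"
  using assms by (auto simp: K_def)

lemma K_Aut: "k \<in> K \<Longrightarrow> k \<in> Aut"
  by (simp add: K_def)

lemma K_subgroup: "aut_subgroup S K"
  unfolding aut_subgroup_def
proof (intro conjI ballI subsetI)
  show "f \<in> aut S" if "f \<in> K" for f using Aut_aut[OF K_Aut[OF that]] .
  show "id \<in> K" using Autf_K aut_subgroup_id[OF Autf_subgroup] by blast
  show "f \<circ> g \<in> K" if f: "f \<in> K" and g: "g \<in> K" for f g
  proof -
    obtain n where n: "n \<in> Autf" "act (act n) b = act (act g) b" using K_tuple[OF g tuple_b] .
    obtain m where m: "m \<in> Autf" "act (act m) (act (act n) b) = act (act f) (act (act n) b)"
      using K_tuple[OF f tuple_act[OF Autf_Aut[OF n(1)] tuple_b]] .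
    show ?thesis
    proof (rule KI)
      show "f \<circ> g \<in> Aut" using comp_Aut K_Aut f g by blast
      show "m \<circ> n \<in> Autf" by (rule aut_subgroup_comp[OF Autf_subgroup m(1) n(1)])
      show "act (act (m \<circ> n)) b = act (act (f \<circ> g)) b" using m(2) n(2) by (simp add: act2_comp)
    qed
  qed
  show "ginv f \<in> K" if f: "f \<in> K" for f
  proof -
    note fA = K_Aut[OF f]
    obtain n where n: "n \<in> Autf" "act (act n) (act (act (ginv f)) b) = act (act f) (act (act (ginv f)) b)"
      using K_tuple[OF f tuple_act[OF ginv_Aut[OF fA] tuple_b]] .
    have "act (act n) (act (act (ginv f)) b) = act (act (f \<circ> ginv f)) b"
      using n(2) by (simp only: act2_comp)
    then have "act (act n) (act (act (ginv f)) b) = b"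
      by (simp only: aut_comp_ginv[OF Aut_aut[OF fA]] act2_id)
    then have "act (act (ginv n)) (act (act n) (act (act (ginv f)) b)) = act (act (ginv n)) b" by simp
    then have "act (act (ginv f)) b = act (act (ginv n)) b"
      unfolding act2_comp[symmetric] o_assoc ginv_comp_aut[OF Aut_aut[OF Autf_Aut[OF n(1)]]] id_o .
    then show ?thesis
      by (intro KI[OF ginv_Aut[OF fA] aut_subgroup_ginv[OF Autf_subgroup n(1)]]) simp
  qed
qed

lemma K_conj:
  assumes k: "k \<in> K" and g: "g \<in> Aut"
  shows "g \<circ> (k \<circ> ginv g) \<in> K"
proof -
  obtain n where n: "n \<in> Autf" "act (act n) (act (act (ginv g)) b) = act (act k) (act (act (ginv g)) b)"
    using K_tuple[OF k tuple_act[OF ginv_Aut[OF g] tuple_b]] .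
  show ?thesis
  proof (rule KI)
    show "g \<circ> (k \<circ> ginv g) \<in> Aut" by (intro comp_Aut ginv_Aut g K_Aut[OF k])
    show "g \<circ> (n \<circ> ginv g) \<in> Autf" by (rule Autf_conj[OF n(1) g])
    show "act (act (g \<circ> (n \<circ> ginv g))) b = act (act (g \<circ> (k \<circ> ginv g))) b"
      using n(2) by (simp only: act2_comp)
  qed
qed

lemma fixing_K:
  assumes "h \<in> aut S" "\<And>z. z \<in> ran (flat b) \<Longrightarrow> h z = z"
  shows "h \<in> K"
  by (rule KI[OF fixing_Aut[OF dcl_b assms] aut_subgroup_id[OF Autf_subgroup]])
    (use act2_fixes[of b h] assms(2) in \<open>simp_all add: act2_id\<close>)

lemma restrict_comp:
  assumes "g \<in> Aut"
  shows "restrict (act (f \<circ> g)) Z = compose Z (restrict (act f) Z) (restrict (act g) Z)"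
  using act_Z[OF assms] by (auto simp: compose_def restrict_def act_comp fun_eq_iff)

abbreviation proj :: "('m \<Rightarrow> 'm) \<Rightarrow> (('j \<rightharpoonup> 'm) \<Rightarrow> ('j \<rightharpoonup> 'm)) set" where
  "proj f \<equiv> proj_rel S \<kappa> e Z (restrict (act f) Z)"

lemma proj_eq: "f \<in> Aut \<Longrightarrow> proj f = {restrict (act (k \<circ> f)) Z | k. k \<in> K}"
proof -
  assume f: "f \<in> Aut"
  have "Autf_rel S \<kappa> e Z = (\<lambda>k. restrict (act k) Z) ` K"
  proof (intro equalityI subsetI)
    fix \<sigma> assume \<sigma>: "\<sigma> \<in> Autf_rel S \<kappa> e Z"
    then obtain k where k: "k \<in> Aut" "\<sigma> = restrict (act k) Z" by (auto simp: Autf_rel_def Aut_rel_def)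
    then have "k \<in> K" using restrict_Autf_rel \<sigma> by blast
    then show "\<sigma> \<in> (\<lambda>k. restrict (act k) Z) ` K" using k(2) by blast
  next
    fix \<sigma> assume "\<sigma> \<in> (\<lambda>k. restrict (act k) Z) ` K"
    then show "\<sigma> \<in> Autf_rel S \<kappa> e Z" using restrict_Autf_rel K_Aut by blast
  qed
  then show "proj f = {restrict (act (k \<circ> f)) Z | k. k \<in> K}"
    by (auto simp: proj_rel_def r_coset_def Aut_rel_group_def restrict_comp[OF f])
qed

lemma projI: "f \<in> Aut \<Longrightarrow> k \<in> K \<Longrightarrow> restrict (act (k \<circ> f)) Z \<in> proj f"
  by (subst proj_eq) blast+

lemma proj_eq_iff:
  assumes f: "f \<in> Aut" and g: "g \<in> Aut"
  shows "proj f = proj g \<longleftrightarrow> (\<exists>k\<in>K. g = k \<circ> f)"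
proof
  assume "proj f = proj g"
  moreover have "restrict (act (id \<circ> g)) Z \<in> proj g"
    unfolding proj_eq[OF g] using aut_subgroup_id[OF K_subgroup] by blast
  ultimately obtain k where k: "k \<in> K" "restrict (act g) Z = restrict (act (k \<circ> f)) Z"
    unfolding proj_eq[OF f] by auto
  define c where "c = act (act (ginv f)) b"
  have c: "tuple_of \<kappa> Z c" unfolding c_def by (rule tuple_act[OF ginv_Aut[OF f] tuple_b])
  have "act (act g) c = act (act (k \<circ> f)) c"
    using k(2) act_restrict[OF c, of g] act_restrict[OF c, of "k \<circ> f"] by simp
  then have eq: "act (act (g \<circ> ginv f)) b = act (act ((k \<circ> f) \<circ> ginv f)) b"
    by (simp only: c_def act2_comp)
  have "(k \<circ> f) \<circ> ginv f = k" by (simp add: comp_assoc aut_comp_ginv[OF Aut_aut[OF f]])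
  then have eq': "act (act (g \<circ> ginv f)) b = act (act k) b" using eq by simp
  obtain n where n: "n \<in> Autf" "act (act n) b = act (act k) b" using K_tuple[OF k(1) tuple_b] .
  have "g \<circ> ginv f \<in> K" by (rule KI[OF comp_Aut[OF g ginv_Aut[OF f]] n(1)]) (simp add: n(2) eq')
  moreover have "g = (g \<circ> ginv f) \<circ> f" by (simp add: comp_assoc ginv_comp_aut[OF Aut_aut[OF f]])
  ultimately show "\<exists>k\<in>K. g = k \<circ> f" by blast
next
  assume "\<exists>k\<in>K. g = k \<circ> f"
  then obtain k where k: "k \<in> K" "g = k \<circ> f" by blast
  note ka = aut_subgroup_aut[OF K_subgroup k(1)]
  show "proj f = proj g"
  proof (intro equalityI subsetI)
    fix \<sigma> assume "\<sigma> \<in> proj f"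
    then obtain l where l: "l \<in> K" "\<sigma> = restrict (act (l \<circ> f)) Z" unfolding proj_eq[OF f] by blast
    have "l \<circ> f = (l \<circ> ginv k) \<circ> g" by (simp add: k(2) comp_assoc ginv_aut_cancel[OF ka])
    moreover have "l \<circ> ginv k \<in> K"
      by (rule aut_subgroup_comp[OF K_subgroup l(1) aut_subgroup_ginv[OF K_subgroup k(1)]])
    ultimately show "\<sigma> \<in> proj g" using projI[OF g, of "l \<circ> ginv k"] l(2) by (simp only:)
  next
    fix \<sigma> assume "\<sigma> \<in> proj g"
    then obtain l where l: "l \<in> K" "\<sigma> = restrict (act (l \<circ> g)) Z" unfolding proj_eq[OF g] by blast
    have "l \<circ> g = (l \<circ> k) \<circ> f" by (simp add: k(2) comp_assoc)
    moreover have "l \<circ> k \<in> K" by (rule aut_subgroup_comp[OF K_subgroup l(1) k(1)])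
    ultimately show "\<sigma> \<in> proj f" using projI[OF f, of "l \<circ> k"] l(2) by (simp only:)
  qed
qed

lemma galois_quotient_Gal_rel:
  "galois_quotient T S \<kappa> Aut K (ran (flat b)) proj (Gal_rel_top S \<kappa> e Z b)"
proof -
  obtain A where A: "Small A" "closed_on S A Aut" by (rule closed_Aut)
  have "galois_quotient T S \<kappa> Aut K (ran (flat b)) proj (quotient_topology
    (logic_topology {tp S (act g (flat b)) (ran (flat b)) | g. g \<in> Aut})
    (\<lambda>p. THE C. \<exists>g\<in>Aut. p = tp S (act g (flat b)) (ran (flat b)) \<and> C = proj g))"
  proof (rule galois_quotientI[OF Aut_subgroup K_subgroup _ A(2,1) K_conj])
    show "K \<subseteq> Aut" using K_Aut by blast
    show "Small (ran (flat b))" by (rule Small_flat(2)[OF J dom_Z tuple_b])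
  qed (use fixing_K proj_eq_iff in blast)+
  moreover have fl: "flat (act (restrict (act g) Z) b) = act g (flat b)" for g
    by (simp add: act_restrict[OF tuple_b] flat_act)
  have rel: "Aut_rel S e Z = (\<lambda>f. restrict (act f) Z) ` Aut" by (auto simp: Aut_rel_def)
  have "{tp S (act g (flat b)) (ran (flat b)) | g. g \<in> Aut} =
      {tp S (flat (act \<sigma> b)) (ran (flat b)) | \<sigma>. \<sigma> \<in> Aut_rel S e Z}"
    "(\<lambda>p. THE C. \<exists>g\<in>Aut. p = tp S (act g (flat b)) (ran (flat b)) \<and> C = proj g) =
      (\<lambda>p. THE C. \<exists>\<sigma>\<in>Aut_rel S e Z.
        p = tp S (flat (act \<sigma> b)) (ran (flat b)) \<and> C = proj_rel S \<kappa> e Z \<sigma>)"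
    by (simp_all add: rel Setcompr_eq_image image_image fl)
  ultimately show ?thesis unfolding Gal_rel_top_def by simp
qed

sublocale L: galois_quotient T S \<kappa> Aut Autf M "proj_L S \<kappa> e" "Gal_L_top S \<kappa> e M"
  by (rule galois_quotient_Gal_L[OF M])

sublocale R: galois_quotient T S \<kappa> Aut K "ran (flat b)" proj "Gal_rel_top S \<kappa> e Z b"
  by (rule galois_quotient_Gal_rel)

lemma proj_L_id: "proj_L S \<kappa> e id = \<one>\<^bsub>Gal_L S \<kappa> e\<^esub>"
  by (auto simp: proj_L_def r_coset_def Aut_group_def Gal_L_def FactGroup_def)

lemma proj_id: "proj id = \<one>\<^bsub>Gal_rel S \<kappa> e Z\<^esub>"
proof -
  have "proj id = Autf_rel S \<kappa> e Z"
  proof (intro equalityI subsetI)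
    fix \<sigma> assume "\<sigma> \<in> proj id"
    then obtain k where "k \<in> K" "\<sigma> = restrict (act k) Z" unfolding proj_eq[OF id_Aut] by auto
    then show "\<sigma> \<in> Autf_rel S \<kappa> e Z" using restrict_Autf_rel K_Aut by blast
  next
    fix \<sigma> assume \<sigma>: "\<sigma> \<in> Autf_rel S \<kappa> e Z"
    then obtain k where k: "k \<in> Aut" "\<sigma> = restrict (act k) Z" by (auto simp: Autf_rel_def Aut_rel_def)
    then have "k \<in> K" using restrict_Autf_rel \<sigma> by blast
    moreover have "\<sigma> = restrict (act (k \<circ> id)) Z" using k(2) by simp
    ultimately show "\<sigma> \<in> proj id" unfolding proj_eq[OF id_Aut] by blast
  qed
  then show ?thesis by (simp add: Gal_rel_def FactGroup_def)
qed

lemma Autf_KP_eq: "Autf_KP S \<kappa> e M = L.closed_kernel"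
  unfolding Autf_KP_def L.closed_kernel_def proj_L_id ..

lemma Autf_S_eq: "Autf_S S \<kappa> e M = L.component_kernel"
  unfolding Autf_S_def L.component_kernel_def proj_L_id ..

lemma preimage_Gal_c:
  "proj_preimage S \<kappa> e Z (Gal_c S \<kappa> e Z b) = (\<lambda>f. restrict (act f) Z) ` R.closed_kernel"
  unfolding proj_preimage_def Gal_c_def R.closed_kernel_def proj_id by (auto simp: Aut_rel_def)

lemma preimage_Gal_0:
  "proj_preimage S \<kappa> e Z (Gal_0 S \<kappa> e Z b) = (\<lambda>f. restrict (act f) Z) ` R.component_kernel"
  unfolding proj_preimage_def Gal_0_def R.component_kernel_def proj_id by (auto simp: Aut_rel_def)

end


section \<open>Comparison of the two groups\<close>

text \<open>
  Whether a hyperimaginary is fixed depends only on the image of a representative.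
\<close>

lemma (in monster_model) fixes_hyp_cong:
  assumes h: "hyperimaginary S \<kappa> I' h" "a \<in> h" and f: "f \<in> aut S" "g \<in> aut S" and eq: "act f a = act g a"
  shows "fixes_hyp f h \<longleftrightarrow> fixes_hyp g h"
proof -
  obtain E a0 where E: "type_definable_equiv S I' E" "dom a0 = I'" "h = E `` {a0}"
    using h(1) unfolding hyperimaginary_def by blast
  have eqv: "equiv {a. dom a = I'} E" using E(1) by (simp add: type_definable_equiv_def)
  have dom: "dom a = I'" by (rule hyperimaginary_stabilizer(1)[OF h])
  have "h = E `` {a}" using equiv_class_eq[OF eqv, of a0 a] h(2) E(3) by simp
  then show ?thesis using fixes_hyp_iff[OF E(1) dom f(1)] fixes_hyp_iff[OF E(1) dom f(2)] eq by simp
qed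

context relativized
begin

abbreviation "B \<equiv> ran (flat b)"

definition Fix_b :: "('m \<Rightarrow> 'm) set" where
  "Fix_b = {s \<in> aut S. \<forall>z\<in>B. s z = z}"

lemma Fix_bD: "s \<in> Fix_b \<Longrightarrow> s \<in> aut S" "s \<in> Fix_b \<Longrightarrow> z \<in> B \<Longrightarrow> s z = z"
  by (simp_all add: Fix_b_def)

lemma Fix_b_K: "s \<in> Fix_b \<Longrightarrow> s \<in> K"
  using fixing_K by (simp add: Fix_b_def)

lemma id_Fix_b: "id \<in> Fix_b"
  by (simp add: Fix_b_def id_aut)

lemma closed_Fix_b: "closed_on S B Fix_b"
  using closed_on_agree[of B B id S] by (simp add: Fix_b_def)

text \<open>
  An element of \<open>K\<close> moves \<open>b\<close> like a Lascar strong automorphism over \<open>e\<close>.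
\<close>

lemma K_factor:
  assumes k: "k \<in> K"
  obtains n s where "n \<in> Autf" "s \<in> Fix_b" "k = n \<circ> s"
proof -
  obtain n where n: "n \<in> Autf" "act (act n) b = act (act k) b" using K_tuple[OF k tuple_b] .
  note na = Aut_aut[OF Autf_Aut[OF n(1)]]
  have "ginv n \<circ> k \<in> Fix_b"
    unfolding Fix_b_def
  proof (intro CollectI conjI ballI)
    show "ginv n \<circ> k \<in> aut S" by (intro comp_aut inv_aut na Aut_aut[OF K_Aut[OF k]])
    show "(ginv n \<circ> k) z = z" if "z \<in> B" for z
      using n(2) that ginv_aut[OF na, of z] unfolding act2_eq_iff by simp
  qed
  moreover have "k = n \<circ> (ginv n \<circ> k)" by (simp add: aut_ginv_cancel[OF na])
  ultimately show thesis using that n(1) by blast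
qed

text \<open>
  As \<open>K\<close> is the product of \<open>Autf\<close> and \<open>Fix_b\<close>, multiplication by \<open>Fix_b\<close> turns unions of cosets of \<open>Autf\<close> into
  unions of cosets of \<open>K\<close>.
\<close>

lemma R_saturated_product:
  assumes X: "L.saturated_set X"
  shows "R.saturated_set {x \<circ> s | x s. x \<in> X \<and> s \<in> Fix_b}"
proof (rule R.saturated_setI)
  show "{x \<circ> s | x s. x \<in> X \<and> s \<in> Fix_b} \<subseteq> Aut"
    using L.saturated_set_G[OF X] K_Aut[OF Fix_b_K] comp_Aut by blast
  fix y k assume "y \<in> {x \<circ> s | x s. x \<in> X \<and> s \<in> Fix_b}" and k: "k \<in> K"
  then obtain x s where xs: "x \<in> X" "s \<in> Fix_b" "y = x \<circ> s" by blast
  have yA: "y \<in> Aut" unfolding xs(3) by (rule comp_Aut[OF L.saturated_set_G[OF X xs(1)] K_Aut[OF Fix_b_K[OF xs(2)]]])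
  define k' where "k' = ginv y \<circ> (k \<circ> y)"
  have "k' \<in> K" using K_conj[OF k ginv_Aut[OF yA]] by (simp only: k'_def ginv_ginv[OF Aut_aut[OF yA]])
  then have "s \<circ> k' \<in> K" by (rule aut_subgroup_comp[OF K_subgroup Fix_b_K[OF xs(2)]])
  then obtain n t where n: "n \<in> Autf" "t \<in> Fix_b" "s \<circ> k' = n \<circ> t" by (rule K_factor)
  have "k \<circ> y = y \<circ> k'" by (simp add: k'_def aut_ginv_cancel[OF Aut_aut[OF yA]])
  also have "\<dots> = (x \<circ> n) \<circ> t" unfolding xs(3) comp_assoc n(3) ..
  finally show "k \<circ> y \<in> {x \<circ> s | x s. x \<in> X \<and> s \<in> Fix_b}"
    using L.saturated_set_right[OF X xs(1) n(1)] n(2) by blast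
qed

lemma closed_product:
  assumes "L.saturated_set X" "closed_on S M X"
  shows "closed_on S B {x \<circ> s | x s. x \<in> X \<and> s \<in> Fix_b}"
proof (rule R.saturated_set_closed_on[OF R_saturated_product[OF assms(1)]])
  show "Small (M \<union> B)" by (intro Small_Un L.Small_B R.Small_B)
  then show "closed_on S (M \<union> B) {x \<circ> s | x s. x \<in> X \<and> s \<in> Fix_b}"
    by (rule closed_on_mult) (rule closed_on_mono[OF assms(2)] closed_on_mono[OF closed_Fix_b], simp)+
qed

lemma R_saturated_L: "R.saturated_set X \<Longrightarrow> L.saturated_set X"
  using Autf_K unfolding R.saturated_set_def L.saturated_set_def by blast

lemma R_closed_L: "R.saturated_set X \<Longrightarrow> closed_on S B X \<Longrightarrow> closed_on S M X"
  using L.saturated_set_closed_on[OF R_saturated_L _ R.Small_B] .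

text \<open>
  A closed union of cosets of \<open>K\<close> is a closed union of cosets of \<open>Autf\<close>; so restriction to \<open>Z\<close> induces a
  continuous map of the quotients, respecting closures and components.
\<close>

lemma L_closed_kernel_R: "L.closed_kernel \<subseteq> R.closed_kernel"
  by (rule L.closed_kernel_minimal[OF R_saturated_L[OF R.saturated_closed_kernel]
        R_closed_L[OF R.saturated_closed_kernel R.closed_closed_kernel] R.id_closed_kernel])

lemma L_component_kernel_R: "L.component_kernel \<subseteq> R.component_kernel"
proof (rule R.subset_component_kernel)
  show "L.component_kernel \<subseteq> Aut" using L.saturated_set_G[OF L.saturated_component_kernel] by blast
  show "E1 \<inter> L.component_kernel = {} \<or> E2 \<inter> L.component_kernel = {}"
    if E: "R.saturated_set E1" "closed_on S B E1" "R.saturated_set E2" "closed_on S B E2"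
      "L.component_kernel \<subseteq> E1 \<union> E2" "E1 \<inter> E2 \<inter> L.component_kernel = {}" for E1 E2
    by (rule L.component_kernel_split[OF R_saturated_L[OF E(1)] R_closed_L[OF E(1,2)]
          R_saturated_L[OF E(3)] R_closed_L[OF E(3,4)] E(5,6)])
qed (rule L.id_component_kernel)

lemma R_closed_kernel_factor:
  assumes "f \<in> R.closed_kernel"
  obtains x s where "x \<in> L.closed_kernel" "s \<in> Fix_b" "f = x \<circ> s"
proof -
  have "id \<in> {x \<circ> s | x s. x \<in> L.closed_kernel \<and> s \<in> Fix_b}"
    using L.id_closed_kernel id_Fix_b by (metis (mono_tags, lifting) comp_id mem_Collect_eq)
  then have "R.closed_kernel \<subseteq> {x \<circ> s | x s. x \<in> L.closed_kernel \<and> s \<in> Fix_b}"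
    by (rule R.closed_kernel_minimal[OF R_saturated_product[OF L.saturated_closed_kernel]
          closed_product[OF L.saturated_closed_kernel L.closed_closed_kernel]])
  then show thesis using assms that by blast
qed

text \<open>
  The complement of \<open>U \<circ> Fix_b\<close> is a union of right cosets of \<open>U\<close>, of which there are only finitely many.
\<close>

lemma R_component_kernel_open_subgroup:
  assumes U: "L.open_subgroup U"
  shows "R.component_kernel \<subseteq> {u \<circ> s | u s. u \<in> U \<and> s \<in> Fix_b}"
proof -
  define C where "C = {u \<circ> s | u s. u \<in> U \<and> s \<in> Fix_b}"
  have Ug: "aut_subgroup S U" and Usat: "L.saturated_set U" and Ucl: "closed_on S M U"
    using U by (auto simp: L.open_subgroup_def)
  have satC: "R.saturated_set C" unfolding C_def by (rule R_saturated_product[OF Usat])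
  define coset where "coset g = ginv ` (\<circ>) (ginv g) ` U" for g
  have coset: "y \<in> coset g \<longleftrightarrow> (\<exists>u\<in>U. y = u \<circ> g)" if g: "g \<in> Aut" for y g
  proof -
    have inv: "ginv (ginv g \<circ> u) = ginv u \<circ> g" if "u \<in> U" for u
      using ginv_comp[OF inv_aut[OF Aut_aut[OF g]] aut_subgroup_aut[OF Ug that]]
      by (simp only: ginv_ginv[OF Aut_aut[OF g]])
    show ?thesis
    proof
      assume "y \<in> coset g"
      then obtain u where "u \<in> U" "y = ginv (ginv g \<circ> u)" unfolding coset_def by blast
      then show "\<exists>u\<in>U. y = u \<circ> g" using inv aut_subgroup_ginv[OF Ug] by blast
    next
      assume "\<exists>u\<in>U. y = u \<circ> g"
      then obtain u where u: "u \<in> U" "y = u \<circ> g" by blast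
      have "y = ginv (ginv g \<circ> ginv u)"
        using inv[OF aut_subgroup_ginv[OF Ug u(1)]] u(2) by (simp only: ginv_ginv[OF aut_subgroup_aut[OF Ug u(1)]])
      then show "y \<in> coset g" unfolding coset_def using aut_subgroup_ginv[OF Ug u(1)] by blast
    qed
  qed
  have clC: "closed_on S M (coset g)" if "g \<in> Aut" for g
    unfolding coset_def by (intro closed_on_ginv L.closed_translate Usat Ucl ginv_Aut that)
  define F where "F = coset ` (Aut - C)"
  have "F \<subseteq> (`) ginv ` ((\<lambda>g. (\<circ>) g ` U) ` Aut)"
    using ginv_Aut unfolding F_def coset_def by blast
  then have "finite F" using L.open_subgroup_finite_index[OF U] by (meson finite_imageI finite_subset)
  then have "closed_on S M (\<Union>F)"
    by (rule closed_on_Union_finite) (use clC in \<open>auto simp: F_def\<close>)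
  moreover have "\<Union>F = Aut - C"
  proof (intro equalityI subsetI)
    fix y assume "y \<in> \<Union>F"
    then obtain g where g: "g \<in> Aut" "g \<notin> C" "y \<in> coset g" unfolding F_def by blast
    then obtain u where u: "u \<in> U" "y = u \<circ> g" using coset by blast
    have "y \<notin> C"
    proof
      assume "y \<in> C"
      then obtain v s where v: "v \<in> U" "s \<in> Fix_b" "y = v \<circ> s" unfolding C_def by blast
      have "g = ginv u \<circ> y" unfolding u(2) by (simp add: ginv_aut_cancel[OF aut_subgroup_aut[OF Ug u(1)]])
      then have "g = (ginv u \<circ> v) \<circ> s" unfolding v(3) by (simp only: comp_assoc)
      moreover have "ginv u \<circ> v \<in> U" by (rule aut_subgroup_comp[OF Ug aut_subgroup_ginv[OF Ug u(1)] v(1)])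
      ultimately show False using g(2) v(2) unfolding C_def by blast
    qed
    then show "y \<in> Aut - C" using comp_Aut[OF L.saturated_set_G[OF Usat u(1)] g(1)] u(2) by simp
  next
    fix y assume y: "y \<in> Aut - C"
    then have "y \<in> coset y" using coset[of y y] aut_subgroup_id[OF Ug] by (metis DiffD1 id_comp)
    then show "y \<in> \<Union>F" using y unfolding F_def by blast
  qed
  ultimately have "closed_on S M (Aut - C)" by simp
  then have "closed_on S B (Aut - C)"
    by (rule R.saturated_set_closed_on[OF R.saturated_diff[OF satC] _ L.Small_B])
  moreover have "closed_on S B C" unfolding C_def by (rule closed_product[OF Usat Ucl])
  moreover have "id \<in> C"
    unfolding C_def using aut_subgroup_id[OF Ug] id_Fix_b by (metis (mono_tags, lifting) comp_id mem_Collect_eq)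
  ultimately have "R.component_kernel \<subseteq> C" by (intro R.component_kernel_subset_clopen satC)
  then show ?thesis by (simp only: C_def)
qed

text \<open>
  The previous lemma provides a factorization for every open subgroup \<open>U\<close>. The elements of \<open>U\<close> that agree with \<open>f\<close> on
  \<open>b\<close> form a closed set, and by compactness these sets have a common element, which is in all open subgroups.
\<close>

lemma R_component_kernel_factor:
  assumes f: "f \<in> R.component_kernel"
  obtains x s where "x \<in> L.component_kernel" "s \<in> Fix_b" "f = x \<circ> s"
proof -
  have fA: "f \<in> Aut" by (rule R.saturated_set_G[OF R.saturated_component_kernel f])
  define Y where "Y = {g \<in> aut S. \<forall>z\<in>B. g z = f z}"
  define A where "A = M \<union> (B \<union> f ` B)"
  have sA: "Small A" unfolding A_def by (intro Small_Un Small_image L.Small_B R.Small_B)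
  have clY: "closed_on S A Y" unfolding Y_def A_def by (rule closed_on_agree) blast+
  have clU: "closed_on S A U" if "L.open_subgroup U" for U
    by (rule closed_on_mono[of S M]) (use that in \<open>auto simp: L.open_subgroup_def A_def\<close>)
  have "\<Inter> ((\<lambda>U. U \<inter> Y) ` {U. L.open_subgroup U}) \<noteq> {}"
  proof (rule closed_on_compact[OF sA])
    show "(\<lambda>U. U \<inter> Y) ` {U. L.open_subgroup U} \<noteq> {}" using L.open_subgroup_G by blast
  next
    fix Z assume "Z \<in> (\<lambda>U. U \<inter> Y) ` {U. L.open_subgroup U}"
    then obtain U where U: "L.open_subgroup U" "Z = U \<inter> Y" by blast
    show "closed_on S A Z" unfolding U(2) by (rule closed_on_Int[OF clU[OF U(1)] clY])
    obtain u s where us: "u \<in> U" "s \<in> Fix_b" "f = u \<circ> s"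
      using R_component_kernel_open_subgroup[OF U(1)] f by blast
    have "u \<in> aut S" using U(1) us(1) by (auto simp: L.open_subgroup_def dest: aut_subgroup_aut)
    moreover have "u z = f z" if "z \<in> B" for z using Fix_bD(2)[OF us(2) that] us(3) by simp
    ultimately have "u \<in> Z" using us(1) U(2) by (simp add: Y_def)
    then show "Z \<noteq> {}" by blast
  next
    fix Z Z' assume "Z \<in> (\<lambda>U. U \<inter> Y) ` {U. L.open_subgroup U}" "Z' \<in> (\<lambda>U. U \<inter> Y) ` {U. L.open_subgroup U}"
    then obtain U U' where U: "L.open_subgroup U" "Z = U \<inter> Y" "L.open_subgroup U'" "Z' = U' \<inter> Y" by blast
    have "(U \<inter> U') \<inter> Y \<in> (\<lambda>U. U \<inter> Y) ` {U. L.open_subgroup U}"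
      using L.open_subgroup_Int[OF U(1,3)] by blast
    then show "\<exists>W\<in>(\<lambda>U. U \<inter> Y) ` {U. L.open_subgroup U}. W \<subseteq> Z \<inter> Z'"
      by (rule rev_bexI) (use U in blast)
  qed
  then obtain x where x: "\<And>U. L.open_subgroup U \<Longrightarrow> x \<in> U \<inter> Y" by blast
  then have "x \<in> L.component_kernel" using L.Inter_open_subgroups by blast
  moreover have xY: "x \<in> aut S" "\<And>z. z \<in> B \<Longrightarrow> x z = f z" using x[OF L.open_subgroup_G] by (auto simp: Y_def)
  have "ginv x \<circ> f \<in> Fix_b"
    unfolding Fix_b_def
  proof (intro CollectI conjI ballI)
    show "ginv x \<circ> f \<in> aut S" by (intro comp_aut inv_aut xY(1) Aut_aut[OF fA])
    show "(ginv x \<circ> f) z = z" if "z \<in> B" for z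
      using xY(2)[OF that] ginv_aut[OF xY(1), of z] by simp
  qed
  moreover have "f = x \<circ> (ginv x \<circ> f)" by (simp add: aut_ginv_cancel[OF xY(1)])
  ultimately show thesis by (rule that)
qed

text \<open>
  By the definition of Lascar tuples, an automorphism fixing \<open>b\<close> moves each tuple of realizations like a Lascar strong automorphism.
\<close>

lemma conjugate_modulo_Fix_b:
  assumes X: "L.saturated_set X" "x \<in> X" and s: "s \<in> Fix_b" and c: "tuple_of \<kappa> Z c"
  shows "\<exists>y\<in>X. act (act y) c = act (act (x \<circ> s)) c"
proof -
  obtain n where n: "n \<in> Autf" "act (act n) c = act (act s) c" using K_tuple[OF Fix_b_K[OF s] c] .
  have "x \<circ> n \<in> X" by (rule L.saturated_set_right[OF X n(1)])
  moreover have "act (act (x \<circ> n)) c = act (act (x \<circ> s)) c" using n(2) by (simp only: act2_comp)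
  ultimately show ?thesis by blast
qed


subsection \<open>Hyperimaginaries with a representative in the partial type\<close>

text \<open>
  A Lascar strong automorphism fixes bounded hyperimaginaries, and an element of \<open>K\<close> moves the representative of \<open>h\<close>,
  a tuple of realizations, like a Lascar strong automorphism. So the stabilizer of \<open>h\<close> contains \<open>K\<close>.
\<close>

lemma bounded_stabilizer:
  assumes h: "hyperimaginary S \<kappa> I' h" and bdd: "Small (orbit S e h)"
    and c: "tuple_of \<kappa> Z c" "flat c \<in> h"
  defines "Y \<equiv> {g \<in> Aut. fixes_hyp g h}"
  shows "aut_subgroup S Y" "R.saturated_set Y" "closed_on S B Y"
proof -
  have Y_eq: "Y = Aut \<inter> {g \<in> aut S. fixes_hyp g h}" using Aut_aut by (auto simp: Y_def)
  show sg: "aut_subgroup S Y"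
    using Aut_subgroup fixes_hyp_subgroup[of S h] unfolding Y_eq aut_subgroup_def by blast
  have KY: "k \<in> Y" if k: "k \<in> K" for k
  proof -
    obtain n where n: "n \<in> Autf" "act (act n) c = act (act k) c" using K_tuple[OF k c(1)] .
    have "act k (flat c) = act n (flat c)" using n(2) by (simp flip: flat_act)
    then have "fixes_hyp k h"
      using fixes_hyp_cong[OF h c(2) Aut_aut[OF K_Aut[OF k]] Aut_aut[OF Autf_Aut[OF n(1)]]]
        Autf_fixes_bounded[OF h bdd n(1)] by simp
    then show ?thesis using K_Aut[OF k] by (simp add: Y_def)
  qed
  show sat: "R.saturated_set Y"
  proof (rule R.saturated_setI)
    show "k \<circ> y \<in> Y" if "y \<in> Y" "k \<in> K" for y k
      by (rule aut_subgroup_comp[OF sg KY[OF that(2)] that(1)])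
  qed (auto simp: Y_def)
  obtain A where A: "Small A" "closed_on S A Aut" by (rule closed_Aut)
  note st = hyperimaginary_stabilizer[OF h c(2)]
  have "closed_on S (A \<union> ran (flat c)) Y"
    unfolding Y_eq by (intro closed_on_Int closed_on_mono[OF A(2)] closed_on_mono[OF st(3)]) auto
  then show "closed_on S B Y"
    by (rule R.saturated_set_closed_on[OF sat]) (intro Small_Un A(1) st(2))
qed

lemma closed_kernel_fixes_bdd:
  assumes f: "f \<in> R.closed_kernel" and h: "h \<in> bdd_restr S \<kappa> e Z"
  shows "fixes_hyp f h"
proof -
  obtain I' c where h': "hyperimaginary S \<kappa> I' h" "Small (orbit S e h)" "tuple_of \<kappa> Z c" "flat c \<in> h"
    using h unfolding bdd_restr_def by blast
  note st = bounded_stabilizer[OF h']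
  have "R.closed_kernel \<subseteq> {g \<in> Aut. fixes_hyp g h}"
    by (rule R.closed_kernel_minimal[OF st(2,3) aut_subgroup_id[OF st(1)]])
  then show ?thesis using f by blast
qed

lemma component_kernel_fixes_acl:
  assumes f: "f \<in> R.component_kernel" and h: "h \<in> acl_restr S \<kappa> e Z"
  shows "fixes_hyp f h"
proof -
  obtain I' c where h': "hyperimaginary S \<kappa> I' h" "finite (orbit S e h)" "tuple_of \<kappa> Z c" "flat c \<in> h"
    using h unfolding acl_restr_def by blast
  note st = bounded_stabilizer[OF h'(1) Small_finite[OF h'(2)] h'(3,4)]
  define Y where "Y = {g \<in> Aut. fixes_hyp g h}"
  \<comment> \<open>The cosets of the stabilizer correspond to the conjugates of \<open>h\<close>.\<close>
  have "(\<circ>) g ` Y = {g' \<in> Aut. act g' ` h = act g ` h}" if g: "g \<in> Aut" for g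
  proof (intro equalityI subsetI)
    fix g' assume "g' \<in> (\<circ>) g ` Y"
    then obtain y where y: "y \<in> Aut" "act y ` h = h" "g' = g \<circ> y" by (auto simp: Y_def fixes_hyp_def)
    have "act g' ` h = act g ` act y ` h" unfolding y(3) by (simp add: image_image act_comp)
    then show "g' \<in> {g' \<in> Aut. act g' ` h = act g ` h}" using y comp_Aut[OF g] by simp
  next
    fix g' assume g': "g' \<in> {g' \<in> Aut. act g' ` h = act g ` h}"
    have "act (ginv g \<circ> g') ` h = act (ginv g) ` act g' ` h" by (simp add: image_image act_comp)
    also have "\<dots> = act (ginv g) ` act g ` h" using g' by simp
    also have "\<dots> = act (ginv g \<circ> g) ` h" by (simp add: image_image act_comp)
    also have "\<dots> = h" by (simp add: ginv_comp_aut[OF Aut_aut[OF g]] act_id)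
    finally have "ginv g \<circ> g' \<in> Y" using g' comp_Aut[OF ginv_Aut[OF g]] by (simp add: Y_def fixes_hyp_def)
    moreover have "g' = g \<circ> (ginv g \<circ> g')" by (simp add: aut_ginv_cancel[OF Aut_aut[OF g]])
    ultimately show "g' \<in> (\<circ>) g ` Y" by blast
  qed
  then have "(\<lambda>g. (\<circ>) g ` Y) ` Aut \<subseteq> (\<lambda>h'. {g' \<in> Aut. act g' ` h = h'}) ` orbit S e h"
    by (auto simp: orbit_def)
  then have "finite ((\<lambda>g. (\<circ>) g ` Y) ` Aut)" using h'(2) by (meson finite_imageI finite_subset)
  then have "closed_on S B (Aut - Y)"
    using R.finite_index_open[OF st, folded Y_def] by blast
  then have "R.component_kernel \<subseteq> Y"
    using R.component_kernel_subset_clopen[OF st(2,3), folded Y_def] aut_subgroup_id[OF st(1), folded Y_def]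
    by blast
  then show ?thesis using f unfolding Y_def by blast
qed

lemma hyperimaginary_of_R_closed_subgroup:
  assumes Y: "aut_subgroup S Y" "K \<subseteq> Y" "closed_on S B Y"
  obtains h where "hyperimaginary S \<kappa> (dom (flat b)) h" "flat b \<in> h"
    "\<And>f. f \<in> aut S \<Longrightarrow> fixes_hyp f h \<longleftrightarrow> f \<in> Y"
  using hyperimaginary_of_closed_subgroup[OF Small_flat(1)[OF J dom_Z tuple_b] Y(1,3)] fixing_K Y(2) by blast

lemma orbit_image:
  assumes fixes_h: "\<And>f. f \<in> aut S \<Longrightarrow> fixes_hyp f h \<longleftrightarrow> f \<in> Y"
    and \<tau>: "\<And>f g. f \<in> Aut \<Longrightarrow> g \<in> Aut \<Longrightarrow> \<tau> f = \<tau> g \<Longrightarrow> ginv f \<circ> g \<in> Y"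
  shows "\<exists>\<theta>. orbit S e h \<subseteq> \<theta> ` \<tau> ` Aut"
proof -
  define sel where "sel t = (SOME f. f \<in> Aut \<and> \<tau> f = t)" for t
  have "act g ` h = act (sel (\<tau> g)) ` h" if g: "g \<in> Aut" for g
  proof -
    have sel: "sel (\<tau> g) \<in> Aut \<and> \<tau> (sel (\<tau> g)) = \<tau> g"
      unfolding sel_def by (rule someI[where P = "\<lambda>f. f \<in> Aut \<and> \<tau> f = \<tau> g" and x = g]) (simp add: g)
    define k where "k = ginv (sel (\<tau> g)) \<circ> g"
    have "k \<in> Y" unfolding k_def using sel by (intro \<tau> g) simp_all
    moreover have "k \<in> aut S" unfolding k_def using sel by (intro comp_aut inv_aut Aut_aut g) simp_all
    ultimately have kh: "act k ` h = h" using fixes_h by (simp add: fixes_hyp_def)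
    have "g = sel (\<tau> g) \<circ> k" unfolding k_def using sel by (simp add: aut_ginv_cancel[OF Aut_aut])
    then have "act g ` h = act (sel (\<tau> g)) ` act k ` h" by (metis act_comp_fun image_comp)
    then show ?thesis by (simp only: kh)
  qed
  then have "orbit S e h \<subseteq> (\<lambda>t. act (sel t) ` h) ` \<tau> ` Aut" unfolding orbit_def by blast
  then show ?thesis by blast
qed

text \<open>
  The closure of the trivial subgroup is the stabilizer of a hyperimaginary with representative \<open>b\<close>. It is bounded because its
  conjugates correspond to cosets of a subgroup that contains \<open>Autf\<close>.
\<close>

lemma fixes_bdd_closed_kernel:
  assumes f: "f \<in> aut S" and fixes_all: "\<And>h. h \<in> bdd_restr S \<kappa> e Z \<Longrightarrow> fixes_hyp f h"
  shows "f \<in> R.closed_kernel"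
proof -
  have K_sub: "K \<subseteq> R.closed_kernel"
    using R.saturated_set_left[OF R.saturated_closed_kernel R.id_closed_kernel] by auto
  obtain h where h: "hyperimaginary S \<kappa> (dom (flat b)) h" "flat b \<in> h"
    "\<And>f. f \<in> aut S \<Longrightarrow> fixes_hyp f h \<longleftrightarrow> f \<in> R.closed_kernel"
    by (rule hyperimaginary_of_R_closed_subgroup[OF R.aut_subgroup_closed_kernel K_sub
          R.closed_closed_kernel]) (rule that)
  have ker: "ginv f \<circ> g \<in> R.closed_kernel"
    if fg: "f \<in> Aut" "g \<in> Aut" and eq: "proj_L S \<kappa> e f = proj_L S \<kappa> e g" for f g
  proof -
    obtain n where n: "n \<in> Autf" "g = n \<circ> f" using proj_L_eq_iff[OF fg(2)] eq by blast
    have "ginv f \<circ> (n \<circ> ginv (ginv f)) \<in> Autf" by (rule Autf_conj[OF n(1) ginv_Aut[OF fg(1)]])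
    then show ?thesis using Autf_K K_sub by (auto simp: n(2) ginv_ginv[OF Aut_aut[OF fg(1)]])
  qed
  have "\<exists>\<theta>. orbit S e h \<subseteq> \<theta> ` proj_L S \<kappa> e ` Aut"
    by (rule orbit_image[OF h(3)]) (assumption, erule (2) ker)
  then obtain \<theta> where "orbit S e h \<subseteq> \<theta> ` proj_L S \<kappa> e ` Aut" by (elim exE)
  then have "Small (orbit S e h)" by (rule Small_subset[OF Small_image[OF Small_Gal_L[OF large]]])
  then have "h \<in> bdd_restr S \<kappa> e Z" unfolding bdd_restr_def using h(1,2) tuple_b by blast
  then show ?thesis using fixes_all h(3)[OF f] by blast
qed

text \<open>
  Likewise, every open subgroup is the stabilizer of an algebraic hyperimaginary with representative \<open>b\<close>.
\<close>

lemma fixes_acl_component_kernel: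
  assumes f: "f \<in> aut S" and fixes_all: "\<And>h. h \<in> acl_restr S \<kappa> e Z \<Longrightarrow> fixes_hyp f h"
  shows "f \<in> R.component_kernel"
proof -
  have "f \<in> U" if U: "R.open_subgroup U" for U
  proof -
    have Ug: "aut_subgroup S U" and Usat: "R.saturated_set U" and Ucl: "closed_on S B U"
      using U by (auto simp: R.open_subgroup_def)
    have K_sub: "K \<subseteq> U" using R.saturated_set_left[OF Usat aut_subgroup_id[OF Ug]] by auto
    obtain h where h: "hyperimaginary S \<kappa> (dom (flat b)) h" "flat b \<in> h"
      "\<And>f. f \<in> aut S \<Longrightarrow> fixes_hyp f h \<longleftrightarrow> f \<in> U"
      by (rule hyperimaginary_of_R_closed_subgroup[OF Ug K_sub Ucl]) (rule that)
    have coset: "ginv f \<circ> g \<in> U" if fg: "f \<in> Aut" "g \<in> Aut" and eq: "(\<circ>) f ` U = (\<circ>) g ` U" for f g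
    proof -
      have "g \<circ> id \<in> (\<circ>) f ` U" unfolding eq using aut_subgroup_id[OF Ug] by blast
      then obtain u where "u \<in> U" "g = f \<circ> u" by auto
      then show ?thesis by (simp add: ginv_aut_cancel[OF Aut_aut[OF fg(1)]])
    qed
    have "\<exists>\<theta>. orbit S e h \<subseteq> \<theta> ` (\<lambda>g. (\<circ>) g ` U) ` Aut"
      by (rule orbit_image[OF h(3)]) (assumption, erule (2) coset)
    then obtain \<theta> where "orbit S e h \<subseteq> \<theta> ` (\<lambda>g. (\<circ>) g ` U) ` Aut" by (elim exE)
    then have "finite (orbit S e h)"
      by (rule finite_subset) (intro finite_imageI R.open_subgroup_finite_index[OF U])
    then have "h \<in> acl_restr S \<kappa> e Z" unfolding acl_restr_def using h(1,2) tuple_b by blast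
    then show ?thesis using fixes_all h(3)[OF f] by blast
  qed
  then show ?thesis using R.Inter_open_subgroups by blast
qed

text \<open>
  Fixing the countable hyperimaginaries of a decomposition amounts to fixing the decomposed hyperimaginaries.
\<close>

lemma equiv_over_decomposition:
  assumes dec: "countable_decomposition S \<kappa> dec" and H: "\<And>h. h \<in> H \<Longrightarrow> \<exists>I'. hyperimaginary S \<kappa> I' h"
  shows "equiv_over S (\<Union>h\<in>H. ran (dec h)) c d \<longleftrightarrow>
    (\<exists>f\<in>aut S. (\<forall>h\<in>H. fixes_hyp f h) \<and> act (act f) c = d)"
proof -
  have "(\<forall>g\<in>(\<Union>h\<in>H. ran (dec h)). fixes_hyp f g) \<longleftrightarrow> (\<forall>h\<in>H. fixes_hyp f h)" if f: "f \<in> aut S" for f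
  proof -
    have "fixes_hyp f h \<longleftrightarrow> (\<forall>g\<in>ran (dec h). fixes_hyp f g)" if "h \<in> H" for h
      using dec H[OF that] f unfolding countable_decomposition_def by blast
    then show ?thesis by blast
  qed
  then show ?thesis unfolding equiv_over_def conj_by_def by blast
qed

lemma equiv_KP_iff:
  assumes dec: "countable_decomposition S \<kappa> dec" and c: "tuple_of \<kappa> Z c"
  shows "equiv_KP S \<kappa> e M c d \<longleftrightarrow> equiv_over S (bdd_in S \<kappa> e Z dec) c d"
    and "equiv_KP S \<kappa> e M c d \<longleftrightarrow>
      (\<exists>\<sigma>\<in>proj_preimage S \<kappa> e Z (Gal_c S \<kappa> e Z b). act \<sigma> c = d)"
proof -
  have KP: "equiv_KP S \<kappa> e M c d \<longleftrightarrow> (\<exists>f\<in>L.closed_kernel. act (act f) c = d)"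
    unfolding equiv_KP_def conj_by_def Autf_KP_eq ..
  have rel: "(\<exists>\<sigma>\<in>proj_preimage S \<kappa> e Z (Gal_c S \<kappa> e Z b). act \<sigma> c = d) \<longleftrightarrow>
      (\<exists>f\<in>R.closed_kernel. act (act f) c = d)"
    unfolding preimage_Gal_c by (simp add: act_restrict[OF c])
  have bdd: "equiv_over S (bdd_in S \<kappa> e Z dec) c d \<longleftrightarrow>
      (\<exists>f\<in>aut S. (\<forall>h\<in>bdd_restr S \<kappa> e Z. fixes_hyp f h) \<and> act (act f) c = d)"
    unfolding bdd_in_def by (rule equiv_over_decomposition[OF dec]) (simp add: bdd_restr_def)
  have LR: "(\<exists>f\<in>L.closed_kernel. act (act f) c = d) \<longleftrightarrow> (\<exists>f\<in>R.closed_kernel. act (act f) c = d)"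
  proof
    assume "\<exists>f\<in>R.closed_kernel. act (act f) c = d"
    then obtain f where f: "f \<in> R.closed_kernel" "act (act f) c = d" by blast
    obtain x s where "x \<in> L.closed_kernel" "s \<in> Fix_b" "f = x \<circ> s" using R_closed_kernel_factor[OF f(1)] .
    then show "\<exists>f\<in>L.closed_kernel. act (act f) c = d"
      using conjugate_modulo_Fix_b[OF L.saturated_closed_kernel _ _ c] f(2) by blast
  qed (use L_closed_kernel_R in blast)
  show "equiv_KP S \<kappa> e M c d \<longleftrightarrow> (\<exists>\<sigma>\<in>proj_preimage S \<kappa> e Z (Gal_c S \<kappa> e Z b). act \<sigma> c = d)"
    unfolding KP rel by (rule LR)
  have "f \<in> R.closed_kernel \<longleftrightarrow> f \<in> aut S \<and> (\<forall>h\<in>bdd_restr S \<kappa> e Z. fixes_hyp f h)" for f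
    using closed_kernel_fixes_bdd fixes_bdd_closed_kernel closed_on_aut[OF R.closed_closed_kernel] by blast
  then show "equiv_KP S \<kappa> e M c d \<longleftrightarrow> equiv_over S (bdd_in S \<kappa> e Z dec) c d"
    unfolding KP bdd LR by blast
qed

lemma equiv_S_iff:
  assumes dec: "countable_decomposition S \<kappa> dec" and c: "tuple_of \<kappa> Z c"
  shows "equiv_S S \<kappa> e M c d \<longleftrightarrow> equiv_over S (acl_in S \<kappa> e Z dec) c d"
    and "equiv_S S \<kappa> e M c d \<longleftrightarrow>
      (\<exists>\<sigma>\<in>proj_preimage S \<kappa> e Z (Gal_0 S \<kappa> e Z b). act \<sigma> c = d)"
proof -
  have Sh: "equiv_S S \<kappa> e M c d \<longleftrightarrow> (\<exists>f\<in>L.component_kernel. act (act f) c = d)"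
    unfolding equiv_S_def conj_by_def Autf_S_eq ..
  have rel: "(\<exists>\<sigma>\<in>proj_preimage S \<kappa> e Z (Gal_0 S \<kappa> e Z b). act \<sigma> c = d) \<longleftrightarrow>
      (\<exists>f\<in>R.component_kernel. act (act f) c = d)"
    unfolding preimage_Gal_0 by (simp add: act_restrict[OF c])
  have acl: "equiv_over S (acl_in S \<kappa> e Z dec) c d \<longleftrightarrow>
      (\<exists>f\<in>aut S. (\<forall>h\<in>acl_restr S \<kappa> e Z. fixes_hyp f h) \<and> act (act f) c = d)"
    unfolding acl_in_def by (rule equiv_over_decomposition[OF dec]) (simp add: acl_restr_def)
  have LR: "(\<exists>f\<in>L.component_kernel. act (act f) c = d) \<longleftrightarrow> (\<exists>f\<in>R.component_kernel. act (act f) c = d)"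
  proof
    assume "\<exists>f\<in>R.component_kernel. act (act f) c = d"
    then obtain f where f: "f \<in> R.component_kernel" "act (act f) c = d" by blast
    obtain x s where "x \<in> L.component_kernel" "s \<in> Fix_b" "f = x \<circ> s" using R_component_kernel_factor[OF f(1)] .
    then show "\<exists>f\<in>L.component_kernel. act (act f) c = d"
      using conjugate_modulo_Fix_b[OF L.saturated_component_kernel _ _ c] f(2) by blast
  qed (use L_component_kernel_R in blast)
  show "equiv_S S \<kappa> e M c d \<longleftrightarrow> (\<exists>\<sigma>\<in>proj_preimage S \<kappa> e Z (Gal_0 S \<kappa> e Z b). act \<sigma> c = d)"
    unfolding Sh rel by (rule LR)
  have "f \<in> aut S" if "f \<in> R.component_kernel" for f
    using R.saturated_set_G[OF R.saturated_component_kernel that] by (rule Aut_aut)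
  then have "f \<in> R.component_kernel \<longleftrightarrow> f \<in> aut S \<and> (\<forall>h\<in>acl_restr S \<kappa> e Z. fixes_hyp f h)" for f
    using component_kernel_fixes_acl fixes_acl_component_kernel by blast
  then show "equiv_S S \<kappa> e M c d \<longleftrightarrow> equiv_over S (acl_in S \<kappa> e Z dec) c d"
    unfolding Sh acl LR by blast
qed

end

theorem corollary2p20:
  fixes T :: "('f, 'r, nat) fm set"
    and S :: "('f, 'r, 'm) struct"
    and \<kappa> :: "'k rel"
    and I J :: "'k set"
    and e :: "('k \<rightharpoonup> 'm) set"
    and \<Sigma> :: "('f, 'r, nat + ('k + 'm)) fm set"
    and M :: "'m set"
    and b c d :: "'k \<rightharpoonup> ('k \<rightharpoonup> 'm)"
    and dec :: "('k \<times> 'k \<rightharpoonup> 'm) set \<Rightarrow> ('k \<rightharpoonup> ('k \<rightharpoonup> 'm) set)"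
  assumes "monster T S \<kappa>"
    and "hyperimaginary S \<kappa> I e"
    and "sufficiently_large S \<kappa> I"
    and "small_model S \<kappa> M" and "in_dcl S e M"
    and "partial_type S \<kappa> J \<Sigma>"
    and "invariant_over S e (sols S J \<Sigma>)"
    and "in_dcl_type S \<kappa> e (sols S J \<Sigma>)"
    and "Lascar_tuple S \<kappa> e (sols S J \<Sigma>) b" and "in_dcl S e (ran (flat b))"
    and "countable_decomposition S \<kappa> dec"
    and "tuple_of \<kappa> (sols S J \<Sigma>) c" and "tuple_of \<kappa> (sols S J \<Sigma>) d" and "dom c = dom d"
  shows "((equiv_KP S \<kappa> e M c d \<longleftrightarrow> equiv_over S (bdd_in S \<kappa> e (sols S J \<Sigma>) dec) c d) \<and>
      (equiv_KP S \<kappa> e M c d \<longleftrightarrow>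
        (\<exists>\<sigma> \<in> proj_preimage S \<kappa> e (sols S J \<Sigma>) (Gal_c S \<kappa> e (sols S J \<Sigma>) b). act \<sigma> c = d))) \<and>
      ((equiv_S S \<kappa> e M c d \<longleftrightarrow> equiv_over S (acl_in S \<kappa> e (sols S J \<Sigma>) dec) c d) \<and>
      (equiv_S S \<kappa> e M c d \<longleftrightarrow>
        (\<exists>\<sigma> \<in> proj_preimage S \<kappa> e (sols S J \<Sigma>) (Gal_0 S \<kappa> e (sols S J \<Sigma>) b). act \<sigma> c = d)))"
proof -
  interpret relativized T S \<kappa> I e J "sols S J \<Sigma>" b M
  proof
    show "small \<kappa> J" using assms(6) by (simp add: partial_type_def)
    show "dom z = J" if "z \<in> sols S J \<Sigma>" for z using that by (simp add: sols_def)
  qed fact+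
  show ?thesis
    using equiv_KP_iff[OF assms(11,12)] equiv_S_iff[OF assms(11,12)] by (intro conjI)
qed

end
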